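(* Let $V\in C^{1,\gamma}(\mathbb{T}^d)$ and let $g:[0,\infty)\to\mathbb{R}\cup\{-\infty\}$ be strictly increasing with $g\in C^{1,\gamma}((0,\infty))$, satisfying the following: there exist $c_1,c_2>0$ and $\alpha>0$ with $c_1m^{\alpha-1}\le g'(m)\le c_2m^{\alpha-1}$ for all $m>0$, where $\alpha>0$ if $d\le4$, $\alpha>\frac{d-4}{d}$ if $4<d\le8$, and $\alpha>\frac{d-4}{2}$ if $d\ge8$. Let $(u^\epsilon,m^\epsilon)$ be a regular weak solution of the discounted problem $$\epsilon u^\epsilon+\tfrac12|Du^\epsilon|^2+V=g(m^\epsilon),\qquad \epsilon m^\epsilon-\operatorname{div}(m^\epsilon Du^\epsilon)=\epsilon\quad\text{in }\mathbb{T}^d .$$ Assume that, as $\epsilon\to0$, $m^\epsilon\rightharpoonup m$ weakly in $L^1(\mathbb{T}^d)$, $u^\epsilon-\int_{\mathbb{T}^d}u^\epsilon dx\rightharpoonup u$ weakly in $W^{1,2}(\mathbb{T}^d)$, and $\epsilon\int_{\mathbb{T}^d}u^\epsilon dx\to-\overline H$. Then $(u,m,\overline H)$ is a regular weak solution of the ergodic problem $$\tfrac12|Du|^2+V=g(m)+\overline H,\qquad -\operatorname{div}(mDu)=0\quad\text{in }\mathbb{T}^d,\qquad m\ge0,\ \int_{\mathbb{T}^d}m\,dx=1.$$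
   Context: $\mathbb{T}^d$ is the $d$-dimensional flat torus identified with $[0,1]^d$, $\gamma\in(0,1)$ is a Hölder exponent (regularity of $g$ on $(0,\infty)$ understood locally). Regular weak solutions. Fix a constant $C>0$ independent of $\epsilon$ (earlier work provides such a $C$ for which, when $g$ satisfies $c_1m^{\alpha-1}\le g'(m)\le c_2m^{\alpha-1}$ for all $m>0$ with constants $c_1,c_2>0$ and an exponent $\alpha>0$ such that $\alpha>\frac{d-4}{d}$ if $4<d\le8$ and $\alpha>\frac{d-4}{2}$ if $d\ge8$, regular weak solutions of the discounted problem exist for every $\epsilon>0$). A pair $(u^\epsilon,m^\epsilon)$ is a regular weak solution of the discounted problem if: (1) $m^\epsilon\ge0$ and $\int_{\mathbb{T}^d} m^\epsilon dx=1$; (2) $\|(m^\epsilon)^{\frac{\alpha+1}{2}}\|_{W^{1,2}(\mathbb{T}^d)}\le C$; (3) $\|u^\epsilon-\int_{\mathbb{T}^d} u^\epsilon dx\|_{W^{1,2}(\mathbb{T}^d)}\le C$; (4) $|\epsilon\int_{\mathbb{T}^d} u^\epsilon dx|\le C$; (5) $\|(m^\epsilon)^{\frac{\alpha+1}{2}}Du^\epsilon\|_{BV(\mathbb{T}^d)}\le C$; and moreover $-\epsilon u^\epsilon-\frac{|Du^\epsilon|^2}{2}-V+g(m^\epsilon)\ge0$ in the sense of distributions, $\big(-\epsilon u^\epsilon-\frac{|Du^\epsilon|^2}{2}-V+g(m^\epsilon)\big)m^\epsilon=0$ almost everywhere, and $\epsilon m^\epsilon-\operatorname{div}(m^\epsilon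 Du^\epsilon)=\epsilon$ in the sense of distributions and almost everywhere. A triple $(u,m,\overline H)$, $\overline H\in\mathbb{R}$, is a regular weak solution of the ergodic problem if $(u,m)$ satisfies (1), (2), (3), (5) (with the same $C$, and $u,m$ in place of $u^\epsilon,m^\epsilon$), and $\overline H-\frac{|Du|^2}{2}-V+g(m)\ge0$ in the sense of distributions, $\big(\overline H-\frac{|Du|^2}{2}-V+g(m)\big)m=0$ almost everywhere, and $-\operatorname{div}(mDu)=0$ in the sense of distributions and almost everywhere.
   Formalization: It is additionally assumed that g is continuous at 0, i.e. g(m) tends to g(0) as m→0+; without this the claim fails (d=1, g(m)=m for m>0, g(0)=-1, V symmetric with large oscillation: the limit m vanishes on an interval where the ergodic inequality is violated). *)

theory Defs
  imports "HOL-Analysis.Analysis"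
begin

section \<open>The torus\<close>

text \<open>The torus is identified with the unit cube. Elements of Lebesgue and Sobolev spaces on the
  torus are functions on \<open>real ^ 'n\<close> of which only the values almost everywhere on the cube matter.
  Periodicity is therefore imposed only where it has content: on classical functions (the
  potential, test functions). A weak derivative on the torus is tested against periodic functions
  that need not vanish on the boundary of the cube, so it sees jumps across opposite faces.\<close>

abbreviation torus :: "(real ^ 'n) measure" where
  "torus \<equiv> lebesgue_on (cbox 0 1)"

definition periodic :: "(real ^ 'n \<Rightarrow> 'b) \<Rightarrow> bool" where
  "periodic f \<longleftrightarrow> (\<forall>x i. f (x + axis i 1) = f x)"

section \<open>Classical derivatives, test functions, Hoelder classes\<close>

definition partial_deriv :: "'n \<Rightarrow> (real ^ 'n \<Rightarrow> real) \<Rightarrow> real ^ 'n \<Rightarrow> real" where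
  "partial_deriv i f x = frechet_derivative f (at x) (axis i 1)"

definition grad :: "(real ^ 'n \<Rightarrow> real) \<Rightarrow> real ^ 'n \<Rightarrow> real ^ 'n" where
  "grad f x = (\<chi> i. partial_deriv i f x)"

definition divergence :: "(real ^ 'n \<Rightarrow> real ^ 'n) \<Rightarrow> real ^ 'n \<Rightarrow> real" where
  "divergence F x = (\<Sum>i\<in>UNIV. partial_deriv i (\<lambda>y. F y $ i) x)"

primrec C_k :: "nat \<Rightarrow> (real ^ 'n \<Rightarrow> real) \<Rightarrow> bool" where
  "C_k 0 f \<longleftrightarrow> continuous_on UNIV f"
| "C_k (Suc k) f \<longleftrightarrow> (\<forall>x. f differentiable (at x)) \<and> (\<forall>i. C_k k (partial_deriv i f))"

definition test_fun :: "(real ^ 'n \<Rightarrow> real) \<Rightarrow> bool" where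
  "test_fun \<phi> \<longleftrightarrow> periodic \<phi> \<and> (\<forall>k. C_k k \<phi>)"

definition holder_on :: "real \<Rightarrow> 'a set \<Rightarrow> ('a::metric_space \<Rightarrow> 'b::metric_space) \<Rightarrow> bool" where
  "holder_on \<gamma> S f \<longleftrightarrow> (\<exists>L. \<forall>x\<in>S. \<forall>y\<in>S. dist (f x) (f y) \<le> L * dist x y powr \<gamma>)"

definition C1_holder_torus :: "real \<Rightarrow> (real ^ 'n \<Rightarrow> real) \<Rightarrow> bool" where
  "C1_holder_torus \<gamma> f \<longleftrightarrow>
     periodic f \<and> (\<forall>x. f differentiable (at x)) \<and> holder_on \<gamma> UNIV (grad f)"

definition C1_holder_loc_pos :: "real \<Rightarrow> (real \<Rightarrow> real) \<Rightarrow> bool" where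
  "C1_holder_loc_pos \<gamma> f \<longleftrightarrow>
     (\<forall>s>0. f differentiable (at s)) \<and>
     (\<forall>a b. 0 < a \<and> a \<le> b \<longrightarrow> holder_on \<gamma> {a..b} (deriv f))"

section \<open>Sobolev and BV spaces on the torus\<close>

definition has_weak_grad :: "(real ^ 'n \<Rightarrow> real) \<Rightarrow> (real ^ 'n \<Rightarrow> real ^ 'n) \<Rightarrow> bool" where
  "has_weak_grad f G \<longleftrightarrow> integrable torus f \<and> integrable torus G \<and>
     (\<forall>\<phi>. test_fun \<phi> \<longrightarrow>
        (\<integral>x. f x *\<^sub>R grad \<phi> x \<partial>torus) = - (\<integral>x. \<phi> x *\<^sub>R G x \<partial>torus))"

text \<open>A weak gradient is unique up to null sets, so the choice below is immaterial.\<close>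

definition weak_grad :: "(real ^ 'n \<Rightarrow> real) \<Rightarrow> real ^ 'n \<Rightarrow> real ^ 'n" where
  "weak_grad f = (SOME G. has_weak_grad f G)"

definition W12 :: "(real ^ 'n \<Rightarrow> real) set" where
  "W12 = {f. f \<in> borel_measurable torus \<and> integrable torus (\<lambda>x. (f x)\<^sup>2) \<and>
             (\<exists>G. has_weak_grad f G \<and> integrable torus (\<lambda>x. (norm (G x))\<^sup>2))}"

definition W12_norm :: "(real ^ 'n \<Rightarrow> real) \<Rightarrow> real" where
  "W12_norm f =
     sqrt ((\<integral>x. (f x)\<^sup>2 \<partial>torus) + (\<integral>x. (norm (weak_grad f x))\<^sup>2 \<partial>torus))"

text \<open>The norm on \<open>real ^ 'n ^ 'n\<close> is the Frobenius norm; the rows of \<open>\<Phi>\<close> are tested against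
  the components of \<open>F\<close>.\<close>

definition total_variation :: "(real ^ 'n \<Rightarrow> real ^ 'n) \<Rightarrow> ereal" where
  "total_variation F =
     (SUP \<Phi> \<in> {\<Phi> :: real ^ 'n \<Rightarrow> real ^ 'n ^ 'n.
                  (\<forall>i j. test_fun (\<lambda>x. \<Phi> x $ i $ j)) \<and> (\<forall>x. norm (\<Phi> x) \<le> 1)}.
        ereal (\<integral>x. (\<Sum>i\<in>UNIV. F x $ i * divergence (\<lambda>y. \<Phi> y $ i) x) \<partial>torus))"

definition BV :: "(real ^ 'n \<Rightarrow> real ^ 'n) set" where
  "BV = {F. integrable torus F \<and> total_variation F < \<infinity>}"

definition BV_norm :: "(real ^ 'n \<Rightarrow> real ^ 'n) \<Rightarrow> ereal" where
  "BV_norm F = ereal (\<integral>x. norm (F x) \<partial>torus) + total_variation F"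

definition L1 :: "(real ^ 'n \<Rightarrow> real) set" where
  "L1 = {f. integrable torus f}"

definition L1_norm :: "(real ^ 'n \<Rightarrow> real) \<Rightarrow> real" where
  "L1_norm f = (\<integral>x. \<bar>f x\<bar> \<partial>torus)"

section \<open>Weak convergence\<close>

text \<open>\<open>X\<close> is a linear space of functions with seminorm \<open>N\<close>. A functional bounded by \<open>N\<close>
  does not distinguish functions at distance zero, so these functionals are exactly the elements
  of the dual of the quotient normed space.\<close>

definition bounded_functional :: "('a \<Rightarrow> real) set \<Rightarrow> (('a \<Rightarrow> real) \<Rightarrow> real) \<Rightarrow>
    (('a \<Rightarrow> real) \<Rightarrow> real) \<Rightarrow> bool" where
  "bounded_functional X N \<Lambda> \<longleftrightarrow>
     (\<forall>f\<in>X. \<forall>h\<in>X. \<Lambda> (\<lambda>x. f x + h x) = \<Lambda> f + \<Lambda> h) \<and>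
     (\<forall>c. \<forall>f\<in>X. \<Lambda> (\<lambda>x. c * f x) = c * \<Lambda> f) \<and>
     (\<exists>K. \<forall>f\<in>X. \<bar>\<Lambda> f\<bar> \<le> K * N f)"

definition weakly_tendsto :: "('a \<Rightarrow> real) set \<Rightarrow> (('a \<Rightarrow> real) \<Rightarrow> real) \<Rightarrow>
    ('e \<Rightarrow> 'a \<Rightarrow> real) \<Rightarrow> ('a \<Rightarrow> real) \<Rightarrow> 'e filter \<Rightarrow> bool" where
  "weakly_tendsto X N f l F \<longleftrightarrow>
     l \<in> X \<and> (\<forall>\<^sub>F e in F. f e \<in> X) \<and>
     (\<forall>\<Lambda>. bounded_functional X N \<Lambda> \<longrightarrow> ((\<lambda>e. \<Lambda> (f e)) \<longlongrightarrow> \<Lambda> l) F)"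

section \<open>Distributional inequalities and equations\<close>

text \<open>An extended-valued function defines a distribution when it agrees almost everywhere with an
  integrable real function; in particular it is then finite almost everywhere.\<close>

definition nonneg_distr :: "(real ^ 'n \<Rightarrow> ereal) \<Rightarrow> bool" where
  "nonneg_distr f \<longleftrightarrow>
     (\<exists>h. integrable torus h \<and> (AE x in torus. f x = ereal (h x)) \<and>
          (\<forall>\<phi>. test_fun \<phi> \<and> (\<forall>x. 0 \<le> \<phi> x) \<longrightarrow> 0 \<le> (\<integral>x. h x * \<phi> x \<partial>torus)))"

text \<open>The distributional divergence of the integrable field \<open>F\<close> is the integrable function \<open>h\<close>.\<close>

definition has_weak_div :: "(real ^ 'n \<Rightarrow> real ^ 'n) \<Rightarrow> (real ^ 'n \<Rightarrow> real) \<Rightarrow> bool" where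
  "has_weak_div F h \<longleftrightarrow> integrable torus F \<and> integrable torus h \<and>
     (\<forall>\<phi>. test_fun \<phi> \<longrightarrow>
        (\<integral>x. F x \<bullet> grad \<phi> x \<partial>torus) = - (\<integral>x. h x * \<phi> x \<partial>torus))"

text \<open>\<open>\<epsilon> m - div (m Du) = k\<close> in the sense of distributions and almost everywhere. The pointwise
  equation concerns the function that represents the distribution \<open>div (m Du)\<close>.\<close>

definition transport_distr ::
    "real \<Rightarrow> real \<Rightarrow> (real ^ 'n \<Rightarrow> real) \<Rightarrow> (real ^ 'n \<Rightarrow> real) \<Rightarrow> bool" where
  "transport_distr \<epsilon> k u m \<longleftrightarrow>
     integrable torus m \<and> integrable torus (\<lambda>x. m x *\<^sub>R weak_grad u x) \<and>
     (\<forall>\<phi>. test_fun \<phi> \<longrightarrow>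
        (\<integral>x. \<epsilon> * m x * \<phi> x \<partial>torus) + (\<integral>x. (m x *\<^sub>R weak_grad u x) \<bullet> grad \<phi> x \<partial>torus)
          = (\<integral>x. k * \<phi> x \<partial>torus))"

definition transport_ae ::
    "real \<Rightarrow> real \<Rightarrow> (real ^ 'n \<Rightarrow> real) \<Rightarrow> (real ^ 'n \<Rightarrow> real) \<Rightarrow> bool" where
  "transport_ae \<epsilon> k u m \<longleftrightarrow>
     (\<exists>h. has_weak_div (\<lambda>x. m x *\<^sub>R weak_grad u x) h \<and>
          (AE x in torus. \<epsilon> * m x - h x = k))"

section \<open>Regular weak solutions\<close>

definition torus_mean :: "(real ^ 'n \<Rightarrow> real) \<Rightarrow> real" where
  "torus_mean f = (\<integral>x. f x \<partial>torus)"

definition regular_bounds ::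
    "real \<Rightarrow> real \<Rightarrow> (real ^ 'n \<Rightarrow> real) \<Rightarrow> (real ^ 'n \<Rightarrow> real) \<Rightarrow> bool" where
  "regular_bounds C \<alpha> u m \<longleftrightarrow>
     (AE x in torus. 0 \<le> m x) \<and> integrable torus m \<and> (\<integral>x. m x \<partial>torus) = 1 \<and>
     (\<lambda>x. m x powr ((\<alpha> + 1) / 2)) \<in> W12 \<and>
     W12_norm (\<lambda>x. m x powr ((\<alpha> + 1) / 2)) \<le> C \<and>
     integrable torus u \<and>
     (\<lambda>x. u x - torus_mean u) \<in> W12 \<and> W12_norm (\<lambda>x. u x - torus_mean u) \<le> C \<and>
     (\<lambda>x. m x powr ((\<alpha> + 1) / 2) *\<^sub>R weak_grad u x) \<in> BV \<and>
     BV_norm (\<lambda>x. m x powr ((\<alpha> + 1) / 2) *\<^sub>R weak_grad u x) \<le> ereal C"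

text \<open>In the complementarity conditions below, \<open>ereal\<close> multiplication has
  \<open>- \<infinity> * 0 = 0\<close>, so they hold trivially where \<open>m\<close> vanishes, also if \<open>g 0 = - \<infinity>\<close>.\<close>

definition regular_weak_discounted ::
    "real \<Rightarrow> real \<Rightarrow> (real ^ 'n \<Rightarrow> real) \<Rightarrow> (real \<Rightarrow> ereal) \<Rightarrow> real \<Rightarrow>
      (real ^ 'n \<Rightarrow> real) \<Rightarrow> (real ^ 'n \<Rightarrow> real) \<Rightarrow> bool" where
  "regular_weak_discounted C \<alpha> V g \<epsilon> u m \<longleftrightarrow>
     regular_bounds C \<alpha> u m \<and> \<bar>\<epsilon> * torus_mean u\<bar> \<le> C \<and>
     nonneg_distr
       (\<lambda>x. ereal (- \<epsilon> * u x - (norm (weak_grad u x))\<^sup>2 / 2 - V x) + g (m x)) \<and>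
     (AE x in torus.
        (ereal (- \<epsilon> * u x - (norm (weak_grad u x))\<^sup>2 / 2 - V x) + g (m x)) * ereal (m x) = 0) \<and>
     transport_distr \<epsilon> \<epsilon> u m \<and> transport_ae \<epsilon> \<epsilon> u m"

definition regular_weak_ergodic ::
    "real \<Rightarrow> real \<Rightarrow> (real ^ 'n \<Rightarrow> real) \<Rightarrow> (real \<Rightarrow> ereal) \<Rightarrow>
      (real ^ 'n \<Rightarrow> real) \<Rightarrow> (real ^ 'n \<Rightarrow> real) \<Rightarrow> real \<Rightarrow> bool" where
  "regular_weak_ergodic C \<alpha> V g u m H \<longleftrightarrow>
     regular_bounds C \<alpha> u m \<and>
     nonneg_distr
       (\<lambda>x. ereal (H - (norm (weak_grad u x))\<^sup>2 / 2 - V x) + g (m x)) \<and>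
     (AE x in torus.
        (ereal (H - (norm (weak_grad u x))\<^sup>2 / 2 - V x) + g (m x)) * ereal (m x) = 0) \<and>
     transport_distr 0 0 u m \<and> transport_ae 0 0 u m"

end

theory Submission
  imports Defs "HOL-Probability.Probability_Measure" "HOL-Complex_Analysis.Great_Picard"
begin

text \<open>The powers \<open>m\<^sup>\<epsilon> powr ((\<alpha> + 1) / 2)\<close> and the fluxes \<open>m\<^sup>\<epsilon> powr ((\<alpha> + 1) / 2) *\<^sub>R Du\<^sup>\<epsilon>\<close> are
  bounded in BV, so along a sequence they converge in \<open>L\<^sup>1\<close> and almost everywhere. Hence
  \<open>m\<^sup>\<epsilon>\<close> converges almost everywhere, and so does \<open>Du\<^sup>\<epsilon>\<close> where \<open>m > 0\<close>; this gives the complementarity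
  condition. The inequality follows from the weak lower semicontinuity of \<open>\<integral>|Du|\<^sup>2 \<phi>\<close>.
  The continuity equation passes to the limit because the fluxes \<open>m\<^sup>\<epsilon> Du\<^sup>\<epsilon>\<close> are uniformly integrable:
  by complementarity \<open>|Du\<^sup>\<epsilon>|\<^sup>2\<close> is at most a multiple of
  \<open>1 + (m\<^sup>\<epsilon>)\<^sup>\<alpha> + \<epsilon>|u\<^sup>\<epsilon> - \<integral>u\<^sup>\<epsilon>|\<close> where \<open>m\<^sup>\<epsilon> > 0\<close>,
  and \<open>m\<^sup>\<epsilon>\<close> is bounded in \<open>L\<^sup>p\<close> for some \<open>p > 4/3\<close>. For \<open>\<alpha> > 1/3\<close> one can take \<open>p = \<alpha> + 1\<close>; the
  condition on \<open>\<alpha>\<close> leaves only dimensions up to 5, where a weak form of the Sobolev embedding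
  suffices.

  Compactness in BV comes from convolution with trigonometric kernels: they are finite sums of products
  of test functions, so the smoothing operators have finite rank.\<close>

section \<open>Test functions\<close>

text \<open>The exponent 4/3 comes from the discount term. In the flux, the gradient bound leaves
  the product of the density with the square root of the oscillation of the value function. That
  oscillation is controlled in L2, its root in L4, so the density must be uniformly integrable to
  the conjugate power 4/3. The other obstacle is the set where the limit density vanishes: there the
  gradients are known to converge only weakly. The fluxes still tend to 0 there, since the gradient
  bound does not blow up as the density tends to 0. In the inequality the gradient enters through a
  concave term, which is replaced by an affine upper bound at the limit gradient before passing to
  the limit. Kernels of finite rank also keep measure theory light: differentiation under the
  integral, adjoints and coefficient limits become statements about finite sums, and Fubini's
  theorem is applied to continuous integrands only.\<close>

lemma C_k_SucD: "C_k (Suc k) f \<Longrightarrow> C_k k f"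
proof (induction k arbitrary: f)
  case 0
  then show ?case
    by (auto intro!: differentiable_imp_continuous_on simp: differentiable_on_def intro: differentiable_at_withinI)
next
  case (Suc k)
  then show ?case by auto
qed

lemma test_fun_periodic: "test_fun \<phi> \<Longrightarrow> periodic \<phi>"
  by (simp add: test_fun_def)

lemma test_fun_differentiable: "test_fun \<phi> \<Longrightarrow> \<phi> differentiable (at x)"
  unfolding test_fun_def by (metis C_k.simps(2))

lemma test_fun_continuous_on: "test_fun \<phi> \<Longrightarrow> continuous_on S \<phi>"
  unfolding test_fun_def by (metis C_k.simps(1) continuous_on_subset subset_UNIV)

text \<open>\<open>grad\<close> is assembled from partial derivatives; linearity of the Frechet
  derivative and the expansion of \<open>h\<close> in unit vectors show that it represents the full
  derivative.\<close>

lemma test_fun_has_derivative: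
  "test_fun \<phi> \<Longrightarrow> (\<phi> has_derivative (\<lambda>h. grad \<phi> x \<bullet> h)) (at x)"
proof -
  assume "test_fun \<phi>"
  then have d: "(\<phi> has_derivative frechet_derivative \<phi> (at x)) (at x)"
    using frechet_derivative_works test_fun_differentiable by blast
  then interpret bounded_linear "frechet_derivative \<phi> (at x)"
    by (rule has_derivative_bounded_linear)
  have "frechet_derivative \<phi> (at x) h = grad \<phi> x \<bullet> h" for h
  proof -
    have "frechet_derivative \<phi> (at x) h = frechet_derivative \<phi> (at x) (\<Sum>i\<in>UNIV. h $ i *\<^sub>R axis i 1)"
      by (simp add: basis_expansion scalar_mult_eq_scaleR[symmetric])
    also have "\<dots> = grad \<phi> x \<bullet> h"
      by (simp add: sum scaleR inner_vec_def grad_def partial_deriv_def mult.commute)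
    finally show ?thesis .
  qed
  then have "frechet_derivative \<phi> (at x) = (\<lambda>h. grad \<phi> x \<bullet> h)" by (rule ext)
  with d show ?thesis by simp
qed

lemma partial_deriv_unique:
  "(f has_derivative f') (at x) \<Longrightarrow> partial_deriv i f x = f' (axis i 1)"
  by (metis frechet_derivative_at partial_deriv_def)

lemma periodic_partial_deriv:
  fixes f :: "real ^ 'n \<Rightarrow> real"
  assumes "periodic f" "\<And>x. f differentiable (at x)"
  shows "periodic (partial_deriv i f)"
  unfolding periodic_def
proof (intro allI)
  fix x :: "real ^ 'n" and j
  have d: "(f has_derivative frechet_derivative f (at y)) (at y)" for y
    using assms(2) frechet_derivative_works by blast
  have "((\<lambda>y. f (y + axis j 1)) has_derivative frechet_derivative f (at (x + axis j 1))) (at x)"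
    by (rule has_derivative_compose[where f = "\<lambda>y. y + axis j 1" and f' = "\<lambda>h. h", OF _ d])
      (auto intro!: derivative_eq_intros)
  moreover have "(\<lambda>y. f (y + axis j 1)) = f"
    using assms(1) by (auto simp: periodic_def)
  ultimately have "(f has_derivative frechet_derivative f (at (x + axis j 1))) (at x)" by simp
  then show "partial_deriv i f (x + axis j 1) = partial_deriv i f x"
    by (metis frechet_derivative_at partial_deriv_def)
qed

lemma test_fun_partial_deriv: "test_fun \<phi> \<Longrightarrow> test_fun (partial_deriv i \<phi>)"
  using periodic_partial_deriv[of \<phi> i] test_fun_differentiable[of \<phi>]
  unfolding test_fun_def by (metis C_k.simps(2))

section \<open>Closure of smooth periodic functions under sums and products\<close>

lemma partial_deriv_const: "partial_deriv i (\<lambda>x. c) = (\<lambda>x. 0)"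
  by (rule ext) (subst partial_deriv_unique, rule has_derivative_const, simp)

lemma partial_deriv_add:
  assumes "\<And>x. f differentiable (at x)" "\<And>x. g differentiable (at x)"
  shows "partial_deriv i (\<lambda>x. f x + g x) = (\<lambda>x. partial_deriv i f x + partial_deriv i g x)"
proof (rule ext)
  fix x
  have "((\<lambda>x. f x + g x) has_derivative
      (\<lambda>h. frechet_derivative f (at x) h + frechet_derivative g (at x) h)) (at x)"
    using assms frechet_derivative_works by (blast intro: has_derivative_add)
  from partial_deriv_unique[OF this, of i]
  show "partial_deriv i (\<lambda>x. f x + g x) x = partial_deriv i f x + partial_deriv i g x"
    by (simp add: partial_deriv_def)
qed

lemma partial_deriv_mult:
  assumes "\<And>x. f differentiable (at x)" "\<And>x. g differentiable (at x)"
  shows "partial_deriv i (\<lambda>x. f x * g x) =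
    (\<lambda>x. f x * partial_deriv i g x + partial_deriv i f x * g x)"
proof (rule ext)
  fix x
  have "((\<lambda>x. f x * g x) has_derivative
      (\<lambda>h. f x * frechet_derivative g (at x) h + frechet_derivative f (at x) h * g x)) (at x)"
    using assms frechet_derivative_works by (blast intro: has_derivative_mult)
  from partial_deriv_unique[OF this, of i]
  show "partial_deriv i (\<lambda>x. f x * g x) x = f x * partial_deriv i g x + partial_deriv i f x * g x"
    by (simp add: partial_deriv_def)
qed

lemma C_k_const: "C_k k (\<lambda>x. c)"
  by (induction k arbitrary: c) (auto simp: partial_deriv_const)

lemma C_k_add: "C_k k f \<Longrightarrow> C_k k g \<Longrightarrow> C_k k (\<lambda>x. f x + g x)"
  by (induction k arbitrary: f g) (auto simp: partial_deriv_add intro: continuous_on_add)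

lemma C_k_mult: "C_k k f \<Longrightarrow> C_k k g \<Longrightarrow> C_k k (\<lambda>x. f x * g x)"
proof (induction k arbitrary: f g)
  case (Suc k)
  then have "C_k k f" "C_k k g" by (auto intro: C_k_SucD)
  with Suc show ?case by (auto simp: partial_deriv_mult intro!: C_k_add)
qed (auto intro: continuous_on_mult)

lemma test_fun_const: "test_fun (\<lambda>x. c)"
  by (simp add: test_fun_def C_k_const periodic_def)

lemma test_fun_add: "test_fun f \<Longrightarrow> test_fun g \<Longrightarrow> test_fun (\<lambda>x. f x + g x)"
  by (auto simp: test_fun_def C_k_add periodic_def)

lemma test_fun_mult: "test_fun f \<Longrightarrow> test_fun g \<Longrightarrow> test_fun (\<lambda>x. f x * g x)"
  by (auto simp: test_fun_def C_k_mult periodic_def)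

lemma test_fun_sum: "(\<And>j. j \<in> J \<Longrightarrow> test_fun (f j)) \<Longrightarrow> test_fun (\<lambda>x. \<Sum>j\<in>J. f j x)"
  by (induction J rule: infinite_finite_induct) (auto intro: test_fun_const test_fun_add)

text \<open>Combinations of one cosine and one sine are closed under differentiation, so the
  induction runs over all coefficients at once.\<close>

lemma C_k_wave: "C_k k (\<lambda>x::real^'n. a * cos (2 * pi * (x $ i)) + b * sin (2 * pi * (x $ i)))"
proof (induction k arbitrary: a b)
  case 0
  show ?case by (auto intro!: continuous_intros)
next
  case (Suc k)
  let ?f = "\<lambda>a b (x::real^'n). a * cos (2 * pi * (x $ i)) + b * sin (2 * pi * (x $ i))"
  have d: "(?f a b has_derivative (\<lambda>h. h $ i * ?f (2 * pi * b) (- 2 * pi * a) x)) (at x)" for x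
    by (auto intro!: derivative_eq_intros bounded_linear.has_derivative[OF bounded_linear_vec_nth]
        simp: algebra_simps)
  have "partial_deriv j (?f a b) = ?f (axis j 1 $ i * (2 * pi * b)) (axis j 1 $ i * (- 2 * pi * a))" for j
    by (rule ext) (simp only: partial_deriv_unique[OF d], simp add: algebra_simps)
  moreover have "?f a b differentiable (at x)" for x
    using d by (rule differentiableI)
  ultimately show ?case using Suc by (simp only: C_k.simps) blast
qed

lemma test_fun_wave: "test_fun (\<lambda>x::real^'n. a * cos (2 * pi * (x $ i)) + b * sin (2 * pi * (x $ i)))"
proof -
  have "cos (2 * pi * (x + axis j 1) $ i) = cos (2 * pi * (x $ i))"
    "sin (2 * pi * (x + axis j 1) $ i) = sin (2 * pi * (x $ i))" for x :: "real^'n" and j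
    by (simp_all add: axis_def distrib_left cos_add sin_add)
  then show ?thesis by (simp add: test_fun_def C_k_wave periodic_def)
qed

lemma test_fun_cos: "test_fun (\<lambda>x::real^'n. cos (2 * pi * (x $ i)))"
  using test_fun_wave[of 1 i 0] by simp

lemma test_fun_sin: "test_fun (\<lambda>x::real^'n. sin (2 * pi * (x $ i)))"
  using test_fun_wave[of 0 i 1] by simp

lemma continuous_on_grad: "test_fun \<phi> \<Longrightarrow> continuous_on S (grad \<phi>)"
  unfolding grad_def by (auto intro!: continuous_on_vec_lambda test_fun_continuous_on test_fun_partial_deriv)

section \<open>Periodic integrals and a trigonometric approximate identity\<close>

lemma torus_prob_space: "prob_space (torus :: (real ^ 'n) measure)"
proof
  have "emeasure lebesgue (cbox 0 1 :: (real ^ 'n) set) = emeasure lborel (cbox 0 1 :: (real ^ 'n) set)"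
    by simp
  also have "\<dots> = ennreal (\<Prod>b\<in>Basis. (1 - 0 :: real ^ 'n) \<bullet> b)"
    by (rule emeasure_lborel_cbox) (auto simp: Basis_vec_def inner_axis)
  also have "\<dots> = 1"
  proof -
    have "b \<in> Basis \<Longrightarrow> (1 :: real ^ 'n) \<bullet> b = 1" for b by (auto simp: Basis_vec_def inner_axis)
    then show ?thesis by simp
  qed
  finally show "emeasure torus (space (torus :: (real ^ 'n) measure)) = 1"
    by (simp add: emeasure_restrict_space)
qed

interpretation torus: prob_space "torus :: (real ^ 'n) measure"
  by (rule torus_prob_space)

lemma integrable_torus_continuous:
  fixes f :: "real ^ 'n \<Rightarrow> 'b :: euclidean_space"
  shows "continuous_on (cbox 0 1) f \<Longrightarrow> integrable torus f"
  by (rule continuous_imp_integrable)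

section \<open>Integrals of periodic functions over a period cell\<close>

lemma periodic_int: "periodic f \<Longrightarrow> f (x + of_int k *\<^sub>R axis i 1) = f x"
proof (induction k rule: int_induct[where k = 0])
  case (step1 k)
  have "f (x + of_int (k + 1) *\<^sub>R axis i 1) = f ((x + of_int k *\<^sub>R axis i 1) + axis i 1)"
    by (simp add: algebra_simps)
  with step1 show ?case by (simp add: periodic_def)
next
  case (step2 k)
  have "f (x + of_int k *\<^sub>R axis i 1) = f ((x + of_int (k - 1) *\<^sub>R axis i 1) + axis i 1)"
    by (simp add: algebra_simps)
  with step2 show ?case by (simp add: periodic_def)
qed simp

lemma periodic_shift: "periodic f \<Longrightarrow> periodic (\<lambda>x. f (x + z))"
  unfolding periodic_def by (metis add.assoc add.commute)

text \<open>The cube is cut where the coordinate \<open>i\<close> equals \<open>1 - t\<close>. The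
  shift moves the lower piece onto the upper piece of the cube cut at \<open>t\<close>; the upper
  piece leaves the cube and returns, one period back, as the lower piece.\<close>

lemma periodic_integral_shift_axis:
  fixes p :: "real ^ 'n \<Rightarrow> real"
  assumes p: "continuous_on UNIV p" "periodic p" and t: "0 \<le> t" "t \<le> 1"
  shows "integral (cbox 0 1) (\<lambda>x. p (x + t *\<^sub>R axis i 1)) = integral (cbox 0 1) p"
proof -
  define e :: "real ^ 'n" where "e = axis i 1"
  \<comment> \<open>\<open>cbox 0 (u c)\<close> and \<open>cbox (l c) 1\<close> are the parts of the
    cube below and above the hyperplane where the coordinate \<open>i\<close> equals
    \<open>c\<close>.\<close>
  define l where "l c = (\<chi> j. if j = i then c else (0::real))" for c
  define u where "u c = (\<chi> j. if j = i then c else (1::real))" for c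
  have e: "e \<in> Basis" by (auto simp: e_def Basis_vec_def)
  have inner_e: "x \<bullet> e = x $ i" for x by (simp add: e_def inner_axis)
  have split: "integral (cbox 0 1) f = integral (cbox 0 (u c)) f + integral (cbox (l c) 1) f"
    if "0 \<le> c" "c \<le> 1" "continuous_on UNIV f" for c and f :: "real ^ 'n \<Rightarrow> real"
  proof -
    have "cbox 0 1 \<inter> {x. x \<bullet> e \<le> c} = cbox 0 (u c)" "cbox 0 1 \<inter> {x. x \<bullet> e \<ge> c} = cbox (l c) 1"
      using order_trans[OF _ that(2)] order_trans[OF that(1)]
      by (auto simp: inner_e mem_box_cart u_def l_def split: if_splits; metis)+
    moreover have "f integrable_on cbox 0 1"
      using that by (intro integrable_continuous) (metis continuous_on_subset subset_UNIV)
    ultimately show ?thesis using integral_split[OF _ e, of f 0 1 c] by simp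
  qed
  have c: "continuous_on UNIV (\<lambda>x. p (x + t *\<^sub>R e))"
    by (rule continuous_on_compose2[OF p(1)]) (auto intro!: continuous_intros)
  have eq: "p (x + t *\<^sub>R e) = p (x + (t - 1) *\<^sub>R e)" for x
    using periodic_int[OF p(2), of "x + t *\<^sub>R e" "-1" i] by (simp add: e_def algebra_simps)
  have "integral (cbox 0 1) (\<lambda>x. p (x + t *\<^sub>R e)) =
      integral (cbox 0 (u (1 - t))) (\<lambda>x. p (x + t *\<^sub>R e)) +
      integral (cbox (l (1 - t)) 1) (\<lambda>x. p (x + (t - 1) *\<^sub>R e))"
    using split[OF _ _ c, of "1 - t"] t by (simp add: eq)
  also have "integral (cbox 0 (u (1 - t))) (\<lambda>x. p (x + t *\<^sub>R e)) = integral (cbox (l t) 1) p"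
  proof -
    have "0 = l t - t *\<^sub>R e" "u (1 - t) = 1 - t *\<^sub>R e"
      by (auto simp: vec_eq_iff l_def u_def e_def axis_def)
    then show ?thesis using integral_shift_cbox[of "l t" "t *\<^sub>R e" 1 p] by simp
  qed
  also have "integral (cbox (l (1 - t)) 1) (\<lambda>x. p (x + (t - 1) *\<^sub>R e)) = integral (cbox 0 (u t)) p"
  proof -
    have "l (1 - t) = 0 - (t - 1) *\<^sub>R e" "1 = u t - (t - 1) *\<^sub>R e"
      by (auto simp: vec_eq_iff l_def u_def e_def axis_def)
    then show ?thesis using integral_shift_cbox[of 0 "(t - 1) *\<^sub>R e" "u t" p] by simp
  qed
  finally show ?thesis using split[of t p] t p by (simp add: e_def)
qed

text \<open>The coordinates are shifted one after the other; of each shift only the fractional part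
  counts, which lies between 0 and 1.\<close>

lemma periodic_integral_shift_HK:
  fixes p :: "real ^ 'n \<Rightarrow> real"
  assumes p: "continuous_on UNIV p" "periodic p"
  shows "integral (cbox 0 1) (\<lambda>x. p (x + z)) = integral (cbox 0 1) p"
proof -
  have c: "continuous_on UNIV (\<lambda>x. p (x + z))" for z
    by (rule continuous_on_compose2[OF p(1)]) (auto intro!: continuous_intros)
  have "integral (cbox 0 1) (\<lambda>x. p (x + (\<Sum>i\<in>I. z $ i *\<^sub>R axis i 1))) = integral (cbox 0 1) p"
    if "finite I" for I :: "'n set"
    using that
  proof induction
    case (insert i I)
    define y where "y = (\<Sum>i\<in>I. z $ i *\<^sub>R axis i (1::real))"
    have "p (x + (\<Sum>i\<in>insert i I. z $ i *\<^sub>R axis i 1)) = p ((x + frac (z $ i) *\<^sub>R axis i 1) + y)" for x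
      using periodic_int[OF p(2), of "x + frac (z $ i) *\<^sub>R axis i 1 + y" "\<lfloor>z $ i\<rfloor>" i] insert
      by (simp add: y_def frac_def algebra_simps)
    then have "integral (cbox 0 1) (\<lambda>x. p (x + (\<Sum>i\<in>insert i I. z $ i *\<^sub>R axis i 1))) =
        integral (cbox 0 1) (\<lambda>x. p (x + y))"
      using periodic_integral_shift_axis[OF c periodic_shift[OF p(2)], of "frac (z $ i)" i y]
        frac_lt_1[of "z $ i"] by simp
    with insert show ?case by (simp add: y_def)
  qed simp
  from this[of UNIV] show ?thesis by (simp add: basis_expansion scalar_mult_eq_scaleR[symmetric])
qed

lemma integral_torus_eq:
  fixes p :: "real ^ 'n \<Rightarrow> real"
  assumes "continuous_on (cbox a b) p"
  shows "(\<integral>x. p x \<partial>lebesgue_on (cbox a b)) = integral (cbox a b) p"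
  using assms by (intro lebesgue_integral_eq_integral continuous_imp_integrable) auto

lemma periodic_integral_shift:
  fixes p :: "real ^ 'n \<Rightarrow> real"
  assumes p: "continuous_on UNIV p" "periodic p"
  shows "(\<integral>x. p (x + z) \<partial>torus) = (\<integral>x. p x \<partial>torus)"
proof -
  have "continuous_on (cbox 0 1) (\<lambda>x. p (x + z))"
    by (rule continuous_on_compose2[OF p(1)]) (auto intro!: continuous_intros)
  then show ?thesis
    using continuous_on_subset[OF p(1)]
    by (simp add: integral_torus_eq periodic_integral_shift_HK[OF p])
qed

lemma periodic_uminus:
  assumes "periodic p" shows "periodic (\<lambda>x. p (- x))"
  unfolding periodic_def
proof (intro allI)
  fix x i
  show "p (- (x + axis i 1)) = p (- x)"
    using assms[unfolded periodic_def, rule_format, of "- (x + axis i 1)" i] by simp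
qed

text \<open>Reflection takes the cube to \<open>cbox (- 1) 0\<close>, a translate by a vector of
  periods. This is what allows the substitution of \<open>x - y\<close> for \<open>y\<close> in
  convolutions.\<close>

lemma periodic_integral_reflect:
  fixes p :: "real ^ 'n \<Rightarrow> real"
  assumes p: "continuous_on UNIV p" "periodic p"
  shows "(\<integral>y. p (z - y) \<partial>torus) = (\<integral>x. p x \<partial>torus)"
proof -
  have c: "continuous_on UNIV (\<lambda>x. p (x + a))" "continuous_on UNIV (\<lambda>x. p (- x))"
    "continuous_on UNIV (\<lambda>x. p (a - x))" for a
    by (rule continuous_on_compose2[OF p(1)]; auto intro!: continuous_intros)+
  have "(\<integral>y. p (z - y) \<partial>torus) = (\<integral>y. p (- y) \<partial>torus)"
    using periodic_integral_shift[OF c(2) periodic_uminus[OF p(2)], of "- z"] by simp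
  also have "\<dots> = integral (cbox 0 1) (\<lambda>y. p (- y))"
    using c(2) continuous_on_subset by (intro integral_torus_eq) blast
  also have "\<dots> = integral (cbox (- 1) (- 0)) p"
    using integral_reflect[of 0 "-1" p] by (metis add.inverse_inverse integral_reflect)
  also have "\<dots> = integral (cbox 0 1) (\<lambda>x. p (x + - 1))"
    using integral_shift_cbox[of "-1" "-1" 0 p] by simp
  also have "\<dots> = integral (cbox 0 1) p" by (rule periodic_integral_shift_HK[OF p])
  also have "\<dots> = (\<integral>x. p x \<partial>torus)"
    using p(1) continuous_on_subset by (intro integral_torus_eq[symmetric]) blast
  finally show ?thesis .
qed

text \<open>On the unit cube the kernel peaks at every corner; on the centred cube its only peak is
  the origin, and \<open>norm z\<close> measures the distance to it.\<close>

lemma periodic_integral_centered: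
  fixes p :: "real ^ 'n \<Rightarrow> real"
  assumes p: "continuous_on UNIV p" "periodic p"
  shows "(\<integral>x. p x \<partial>lebesgue_on (cbox (- (1/2) *\<^sub>R 1) ((1/2) *\<^sub>R 1))) = (\<integral>x. p x \<partial>torus)"
proof -
  have "(\<integral>x. p x \<partial>lebesgue_on (cbox (- (1/2) *\<^sub>R 1) ((1/2) *\<^sub>R 1))) =
      integral (cbox (- (1/2) *\<^sub>R 1) ((1/2) *\<^sub>R 1)) p"
    using p(1) continuous_on_subset by (intro integral_torus_eq) blast
  also have "\<dots> = integral (cbox 0 1) (\<lambda>x. p (x + - (1/2) *\<^sub>R 1))"
  proof -
    have "- (1/2) *\<^sub>R 1 - - (1/2) *\<^sub>R 1 = (0 :: real ^ 'n)"
      "(1/2) *\<^sub>R 1 - - (1/2) *\<^sub>R 1 = (1 :: real ^ 'n)"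
      by (auto simp: vec_eq_iff)
    then show ?thesis using integral_shift_cbox[of "- (1/2) *\<^sub>R 1 :: real ^ 'n" "- (1/2) *\<^sub>R 1" "(1/2) *\<^sub>R 1" p]
      by metis
  qed
  also have "\<dots> = integral (cbox 0 1) p" by (rule periodic_integral_shift_HK[OF p])
  also have "\<dots> = (\<integral>x. p x \<partial>torus)"
    using p(1) continuous_on_subset by (intro integral_torus_eq[symmetric]) blast
  finally show ?thesis .
qed

text \<open>A nonnegative trigonometric polynomial whose maximum is attained exactly at the integer
  points. Its normalised powers therefore form an approximate identity on the torus.\<close>

definition peak :: "real ^ 'n \<Rightarrow> real" where
  "peak z = (\<Sum>i\<in>UNIV. 1 + cos (2 * pi * (z $ i)))"

definition kern :: "nat \<Rightarrow> real ^ 'n \<Rightarrow> real" where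
  "kern N z = peak z ^ N / (\<integral>x. peak (x :: real ^ 'n) ^ N \<partial>torus)"

text \<open>Kernels of finite rank. A list carries the factors, so that sums of kernels are
  concatenations.\<close>

definition separable :: "(real ^ 'n \<Rightarrow> real ^ 'n \<Rightarrow> real) \<Rightarrow> bool" where
  "separable k \<longleftrightarrow> (\<exists>ps. (\<forall>(a, b)\<in>set ps. test_fun a \<and> test_fun b) \<and>
     k = (\<lambda>x y. \<Sum>(a, b)\<leftarrow>ps. a x * b y))"

lemma separable_single: "test_fun a \<Longrightarrow> test_fun b \<Longrightarrow> separable (\<lambda>x y. a x * b y)"
  unfolding separable_def by (rule exI[of _ "[(a, b)]"]) auto

lemma separable_add: "separable k \<Longrightarrow> separable l \<Longrightarrow> separable (\<lambda>x y. k x y + l x y)"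
  unfolding separable_def
proof (elim exE conjE)
  fix ps qs assume "\<forall>(a, b)\<in>set ps. test_fun a \<and> test_fun b" "\<forall>(a, b)\<in>set qs. test_fun a \<and> test_fun b"
    "k = (\<lambda>x y. \<Sum>(a, b)\<leftarrow>ps. a x * b y)" "l = (\<lambda>x y. \<Sum>(a, b)\<leftarrow>qs. a x * b y)"
  then show "\<exists>ps. (\<forall>(a, b)\<in>set ps. test_fun a \<and> test_fun b) \<and>
      (\<lambda>x y. k x y + l x y) = (\<lambda>x y. \<Sum>(a, b)\<leftarrow>ps. a x * b y)"
    by (intro exI[of _ "ps @ qs"]) auto
qed

lemma separable_sum: 
  "finite J \<Longrightarrow> (\<And>j. j \<in> J \<Longrightarrow> separable (k j)) \<Longrightarrow> separable (\<lambda>x y. \<Sum>j\<in>J. k j x y)"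
proof (induction J rule: finite_induct)
  case empty
  then show ?case using separable_single[OF test_fun_const[of 0] test_fun_const[of 0]] by simp
qed (auto intro: separable_add)

lemma separable_sum_listE:
  assumes "separable k"
  obtains J :: nat and a b where "\<And>j. j < J \<Longrightarrow> test_fun (a j)" "\<And>j. j < J \<Longrightarrow> test_fun (b j)"
    "\<And>x y. k x y = (\<Sum>j<J. a j x * b j y)"
proof -
  from assms obtain ps where ps: "\<forall>(a, b)\<in>set ps. test_fun a \<and> test_fun b"
    "k = (\<lambda>x y. \<Sum>(a, b)\<leftarrow>ps. a x * b y)" unfolding separable_def by blast
  have t: "test_fun (fst (ps ! j)) \<and> test_fun (snd (ps ! j))" if "j < length ps" for j
    using ps(1) nth_mem[OF that] by (auto simp: case_prod_beta)
  show thesis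
    by (rule that[of "length ps" "\<lambda>j. fst (ps ! j)" "\<lambda>j. snd (ps ! j)"])
      (use t in \<open>auto simp: ps(2) sum_list_sum_nth case_prod_beta atLeast0LessThan\<close>)
qed

lemma separable_mult: 
  assumes "separable k" "separable l" shows "separable (\<lambda>x y. k x y * l x y)"
proof -
  obtain J a b where 1: "\<And>j::nat. j < J \<Longrightarrow> test_fun (a j)" "\<And>j. j < J \<Longrightarrow> test_fun (b j)"
    "\<And>x y. k x y = (\<Sum>j<J. a j x * b j y)" using separable_sum_listE[OF assms(1)] by metis
  obtain L c d where 2: "\<And>j::nat. j < L \<Longrightarrow> test_fun (c j)" "\<And>j. j < L \<Longrightarrow> test_fun (d j)"
    "\<And>x y. l x y = (\<Sum>j<L. c j x * d j y)" using separable_sum_listE[OF assms(2)] by metis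
  have "(\<lambda>x y. k x y * l x y) = (\<lambda>x y. \<Sum>j<J. \<Sum>i<L. (a j x * c i x) * (b j y * d i y))"
    by (simp add: 1 2 sum_product mult_ac fun_eq_iff)
  moreover have "separable \<dots>"
    by (intro separable_sum separable_single test_fun_mult 1 2) auto
  ultimately show ?thesis by simp
qed

text \<open>The addition theorem for the cosine separates the variables in
  \<open>peak (x - y)\<close>, and products of separable kernels are separable.\<close>

lemma separable_peak_power: "separable (\<lambda>x y. peak (x - y) ^ N)"
proof (induction N)
  case 0
  then show ?case using separable_single[OF test_fun_const[of 1] test_fun_const[of 1]] by simp
next
  case (Suc N)
  have "separable (\<lambda>x y. \<Sum>i\<in>UNIV. 1 * 1 + (cos (2 * pi * (x $ i)) * cos (2 * pi * (y $ i)) + 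
      sin (2 * pi * (x $ i)) * sin (2 * pi * (y $ i))))"
    by (intro separable_sum separable_add separable_single test_fun_const test_fun_cos test_fun_sin) auto
  then have "separable (\<lambda>x y. peak (x - y))"
    by (simp add: peak_def cos_diff right_diff_distrib)
  from separable_mult[OF this Suc] show ?case by simp
qed

lemma peak_nonneg: "0 \<le> peak z"
  unfolding peak_def by (intro sum_nonneg) (smt (verit) cos_ge_minus_one)

lemma peak_le: "peak (z :: real ^ 'n) \<le> 2 * real CARD('n)"
proof -
  have "peak z \<le> (\<Sum>i\<in>(UNIV :: 'n set). 2 :: real)"
    unfolding peak_def by (intro sum_mono) (smt (verit) cos_le_one)
  then show ?thesis by simp
qed

lemma peak_0: "peak (0 :: real ^ 'n) = 2 * real CARD('n)"
  by (simp add: peak_def)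

lemma peak_uminus: "peak (- z) = peak z"
  by (simp add: peak_def)

lemma continuous_on_peak:
  fixes f :: "'a::t2_space \<Rightarrow> real ^ 'n"
  shows "continuous_on S f \<Longrightarrow> continuous_on S (\<lambda>x. peak (f x))"
  unfolding peak_def by (auto intro!: continuous_intros)

lemma periodic_peak: "periodic (peak :: real ^ 'n \<Rightarrow> real)"
proof -
  have "cos (2 * pi * (x + axis j 1) $ i) = cos (2 * pi * (x $ i))" for x :: "real^'n" and i j
    by (simp add: axis_def distrib_left cos_add)
  then show ?thesis by (simp add: peak_def periodic_def)
qed

lemma peak_maxD: 
  assumes "peak (z :: real ^ 'n) = 2 * real CARD('n)" shows "cos (2 * pi * (z $ i)) = 1"
proof -
  have "(\<Sum>i\<in>(UNIV :: 'n set). 1 - cos (2 * pi * (z $ i))) = 0"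
    using assms by (simp add: peak_def sum.distrib sum_subtractf)
  then have "\<forall>i. 1 - cos (2 * pi * (z $ i)) = 0"
    by (subst (asm) sum_nonneg_eq_0_iff) auto
  then show ?thesis by simp
qed

lemma cos_2pi_eq_1_iff_0: 
  assumes "cos (2 * pi * t) = 1" "\<bar>t\<bar> < 1" shows "t = 0"
proof -
  obtain k :: int where "2 * pi * t = 2 * pi * k"
    using assms(1) cos_one_2pi_int by (metis mult.commute mult.left_commute)
  then have t: "t = k" by simp
  with assms(2) have "k = 0" by linarith
  with t show ?thesis by simp
qed

text \<open>Laplace's method. Where \<open>d\<close> is not small, compactness keeps
  \<open>q\<close> below some \<open>\<rho> < m\<close>, so the numerator is of order
  \<open>\<rho> ^ N\<close> there. The denominator is at least of order \<open>c ^ N\<close> for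
  every \<open>c < m\<close>, since \<open>q > c\<close> on a set of positive measure near
  \<open>x0\<close>.\<close>

lemma laplace_concentration:
  fixes q d :: "'a::euclidean_space \<Rightarrow> real" and a b :: 'a
  defines "M \<equiv> lebesgue_on (cbox a b)"
  assumes cont: "continuous_on (cbox a b) q" "continuous_on (cbox a b) d"
    and nonneg: "\<And>x. x \<in> cbox a b \<Longrightarrow> 0 \<le> q x" "\<And>x. x \<in> cbox a b \<Longrightarrow> 0 \<le> d x"
    and le: "\<And>x. x \<in> cbox a b \<Longrightarrow> q x \<le> m" and m: "0 < m"
    and x0: "x0 \<in> cbox a b" "q x0 = m" and box: "box a b \<noteq> {}"
    and max: "\<And>x. x \<in> cbox a b \<Longrightarrow> q x = m \<Longrightarrow> d x = 0"
  shows "(\<lambda>N. (\<integral>x. q x ^ N * d x \<partial>M) / (\<integral>x. q x ^ N \<partial>M)) \<longlonglongrightarrow> 0"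
    and "0 < (\<integral>x. q x ^ N \<partial>M)"
proof -
  let ?S = "cbox a b"
  have int: "integrable M f" if "continuous_on ?S f" for f :: "'a \<Rightarrow> real"
    using that unfolding M_def by (rule continuous_imp_integrable)
  have fin: "finite_measure M" unfolding M_def
    using emeasure_lborel_cbox_finite[of a b]
    by (intro finite_measureI) (simp add: emeasure_restrict_space less_top)
  interpret finite_measure M by fact
  have sp: "space M = ?S" by (simp add: M_def)
  have low: "\<exists>\<mu>>0. \<forall>N. c ^ N * \<mu> \<le> (\<integral>x. q x ^ N \<partial>M)" if c: "0 < c" "c < m" for c
  proof -
    obtain U where U: "open U" "U \<inter> ?S = q -` {c<..} \<inter> ?S"
      using continuous_on_open_invariant[THEN iffD1, OF cont(1), rule_format, OF open_greaterThan[of c]]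
      by blast
    \<comment> \<open>The maximum point may lie on the boundary of the box, so the open set where
      \<open>q > c\<close> is shown to meet the interior by density of the interior.\<close>
    have "x0 \<in> closure (box a b)" using x0(1) closure_box[OF box] by simp
    moreover have "x0 \<in> U" using U(2) x0 c by auto
    ultimately have "U \<inter> closure (box a b) \<noteq> {}" by blast
    then have ne: "box a b \<inter> U \<noteq> {}"
      using open_Int_closure_eq_empty[OF U(1)] by (simp add: Int_commute)
    define W where "W = box a b \<inter> U"
    have W: "open W" "W \<noteq> {}" "W \<subseteq> ?S" using U(1) ne box_subset_cbox[of a b] by (auto simp: W_def)
    have Wm: "W \<in> sets M" using W by (auto simp: M_def sets_restrict_space_iff)
    have Wq: "c < q x" if "x \<in> W" for x using that W(3) U(2) by (auto simp: W_def)
    have pos: "measure M W > 0"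
    proof -
      have "emeasure lborel W \<noteq> 0"
        using W(1,2) open_not_negligible[of W] by (simp add: negligible_iff_emeasure0)
      moreover have "emeasure M W = emeasure lborel W"
        using W by (simp add: M_def emeasure_restrict_space)
      ultimately show ?thesis using emeasure_eq_measure[of W] by (auto simp: zero_less_measure_iff)
    qed
    have "c ^ N * measure M W \<le> (\<integral>x. q x ^ N \<partial>M)" for N
    proof -
      have "c ^ N * measure M W = (\<integral>x. c ^ N * indicator W x \<partial>M)"
        using Wm by simp
      also have "\<dots> \<le> (\<integral>x. q x ^ N \<partial>M)"
      proof (rule integral_mono)
        show "integrable M (\<lambda>x. c ^ N * indicator W x)" using Wm
          by (intro integrable_mult_right integrable_real_indicator) (auto simp: less_top[symmetric])
        show "integrable M (\<lambda>x. q x ^ N)" by (intro int continuous_intros cont)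
        fix x assume "x \<in> space M"
        then show "c ^ N * indicator W x \<le> q x ^ N"
          using nonneg c(1) Wq[of x] by (cases "x \<in> W") (auto simp: sp intro!: power_mono)
      qed
      finally show ?thesis .
    qed
    with pos show ?thesis by blast
  qed
  show pos: "0 < (\<integral>x. q x ^ N \<partial>M)" for N
  proof -
    obtain \<mu> where "\<mu> > 0" "(m/2) ^ N * \<mu> \<le> (\<integral>x. q x ^ N \<partial>M)" using low[of "m/2"] m by auto
    moreover have "0 < (m/2) ^ N * \<mu>" using m \<open>\<mu> > 0\<close> by simp
    ultimately show ?thesis by linarith
  qed
  show "(\<lambda>N. (\<integral>x. q x ^ N * d x \<partial>M) / (\<integral>x. q x ^ N \<partial>M)) \<longlonglongrightarrow> 0"
  proof (rule LIMSEQ_I)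
    fix r :: real assume r: "0 < r"
    obtain D where D: "D > 0" "\<And>x. x \<in> ?S \<Longrightarrow> d x \<le> D"
    proof -
      have "bounded (d ` ?S)" using cont by (intro compact_imp_bounded compact_continuous_image) auto
      then obtain D where D: "\<And>x. x \<in> ?S \<Longrightarrow> norm (d x) \<le> D" by (auto simp: bounded_iff)
      have "d x \<le> max D 1" if "x \<in> ?S" for x using D[OF that] by simp
      then show ?thesis using that[of "max D 1"] by simp
    qed
    \<comment> \<open>The maximum of \<open>q\<close> over the compact set where \<open>d\<close> is
      at least \<open>r/2\<close>. The value \<open>m/2\<close> covers the empty set and keeps
      \<open>\<rho>\<close> positive.\<close>
    obtain \<rho> where \<rho>: "0 < \<rho>" "\<rho> < m" "\<And>x. x \<in> ?S \<Longrightarrow> r/2 \<le> d x \<Longrightarrow> q x \<le> \<rho>"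
    proof (cases "{x \<in> ?S. r/2 \<le> d x} = {}")
      case True
      then show ?thesis using that[of "m/2"] m by auto
    next
      case False
      have "compact {x \<in> ?S. r/2 \<le> d x}"
      proof -
        have "closed (?S \<inter> d -` {r/2..})"
          by (rule continuous_closed_preimage[OF cont(2)]) auto
        moreover have "?S \<inter> d -` {r/2..} = {x \<in> ?S. r/2 \<le> d x}" by auto
        ultimately show ?thesis
          by (metis bounded_Int bounded_cbox compact_eq_bounded_closed)
      qed
      then obtain y where y: "y \<in> ?S" "r/2 \<le> d y" "\<And>x. x \<in> ?S \<Longrightarrow> r/2 \<le> d x \<Longrightarrow> q x \<le> q y"
        using continuous_attains_sup[of "{x \<in> ?S. r/2 \<le> d x}" q] False cont(1)
        by (auto intro: continuous_on_subset)
      have "q y < m" using le[OF y(1)] max[OF y(1)] y(2) r by fastforce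
      then show ?thesis using that[of "max (q y) (m/2)"] y m by (auto simp: le_max_iff_disj)
    qed
    \<comment> \<open>Strictly between \<open>\<rho>\<close> and \<open>m\<close>: above
      \<open>\<rho>\<close> to make the quotient of powers decay, below \<open>m\<close> for the
      lower bound of the denominator.\<close>
    define c where "c = (\<rho> + m) / 2"
    have c: "0 < c" "c < m" "\<rho> < c" using \<rho> by (auto simp: c_def)
    obtain \<mu> where \<mu>: "\<mu> > 0" "\<And>N. c ^ N * \<mu> \<le> (\<integral>x. q x ^ N \<partial>M)" using low[OF c(1,2)] by blast
    have "(\<lambda>N. (\<rho> / c) ^ N) \<longlonglongrightarrow> 0" using c \<rho> by (intro LIMSEQ_realpow_zero) auto
    then have "(\<lambda>N. D * measure M ?S / \<mu> * (\<rho> / c) ^ N) \<longlonglongrightarrow> D * measure M ?S / \<mu> * 0"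
      by (rule tendsto_mult_left)
    then have "\<forall>\<^sub>F N in sequentially. D * measure M ?S / \<mu> * (\<rho> / c) ^ N < r/2"
      using r by (intro order_tendstoD(2)) auto
    then obtain N0 where N0: "\<And>N. N \<ge> N0 \<Longrightarrow> D * measure M ?S / \<mu> * (\<rho> / c) ^ N < r/2"
      by (auto simp: eventually_sequentially)
    have "norm ((\<integral>x. q x ^ N * d x \<partial>M) / (\<integral>x. q x ^ N \<partial>M) - 0) < r" if "N \<ge> N0" for N
    proof -
      let ?Z = "\<integral>x. q x ^ N \<partial>M"
      \<comment> \<open>The integrand is at most the first summand where \<open>d\<close> is below
        \<open>r/2\<close>, and at most the second one elsewhere.\<close>
      have "(\<integral>x. q x ^ N * d x \<partial>M) \<le> (\<integral>x. r/2 * q x ^ N + D * \<rho> ^ N \<partial>M)"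
      proof (rule integral_mono)
        show "integrable M (\<lambda>x. q x ^ N * d x)" "integrable M (\<lambda>x. r/2 * q x ^ N + D * \<rho> ^ N)"
          by (intro int continuous_intros cont)+
        fix x assume "x \<in> space M"
        then have x: "x \<in> ?S" by (simp add: sp)
        show "q x ^ N * d x \<le> r/2 * q x ^ N + D * \<rho> ^ N"
        proof (cases "r/2 \<le> d x")
          case True
          have "q x ^ N * d x \<le> \<rho> ^ N * D"
            using \<rho>(3)[OF x True] D(2)[OF x] nonneg[OF x] \<rho> by (intro mult_mono power_mono) auto
          moreover have "0 \<le> r/2 * q x ^ N" using r nonneg[OF x] by simp
          ultimately show ?thesis by (simp add: mult.commute)
        next
          case False
          then have "q x ^ N * d x \<le> q x ^ N * (r/2)" using nonneg[OF x] by (intro mult_left_mono) auto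
          moreover have "0 \<le> D * \<rho> ^ N" using D \<rho> by simp
          ultimately show ?thesis by (simp add: mult.commute)
        qed
      qed
      also have "\<dots> = r/2 * ?Z + D * \<rho> ^ N * measure M ?S"
        using int[of "\<lambda>x. q x ^ N"] cont by (simp add: sp continuous_on_power)
      finally have 1: "(\<integral>x. q x ^ N * d x \<partial>M) \<le> r/2 * ?Z + D * \<rho> ^ N * measure M ?S" .
      have "D * measure M ?S * \<rho> ^ N = (D * measure M ?S / \<mu> * (\<rho> / c) ^ N) * (c ^ N * \<mu>)"
        using \<mu> c by (simp add: field_simps)
      also have "\<dots> \<le> (D * measure M ?S / \<mu> * (\<rho> / c) ^ N) * ?Z"
        using D \<mu> c \<rho> by (intro mult_left_mono \<mu>) auto
      also have "\<dots> < r/2 * ?Z" using N0[OF that] pos by (intro mult_strict_right_mono)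
      finally have "(\<integral>x. q x ^ N * d x \<partial>M) < r * ?Z" using 1 by (simp add: mult_ac field_simps)
      moreover have "0 \<le> (\<integral>x. q x ^ N * d x \<partial>M)"
        using nonneg by (intro Bochner_Integration.integral_nonneg) (auto simp: sp)
      ultimately show ?thesis using pos[of N] by (simp add: pos_divide_less_eq)
    qed
    then show "\<exists>no. \<forall>n\<ge>no. norm ((\<integral>x. q x ^ n * d x \<partial>M) / (\<integral>x. q x ^ n \<partial>M) - 0) < r" by blast
  qed
qed

section \<open>Smoothing\<close>

lemma box_01_ne: "box 0 (1 :: real ^ 'n) \<noteq> {}"
proof -
  have "(1/2) *\<^sub>R (1 :: real ^ 'n) \<in> box 0 1" by (auto simp: mem_box_cart)
  then show ?thesis by blast
qed

lemma AE_torus_interior: "AE x in torus. x \<in> box 0 (1 :: real ^ 'n)"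
proof -
  have "cbox 0 1 - box 0 (1 :: real ^ 'n) \<in> null_sets lebesgue"
    using negligible_frontier_interval negligible_iff_null_sets by blast
  then have "AE x in lebesgue. x \<notin> cbox 0 1 - box 0 (1 :: real ^ 'n)" by (rule AE_not_in)
  then show ?thesis by (subst AE_restrict_space_iff) auto
qed

lemma borel_measurable_torus_continuous:
  fixes f :: "real ^ 'n \<Rightarrow> 'b :: euclidean_space"
  shows "continuous_on UNIV f \<Longrightarrow> f \<in> borel_measurable torus"
  using integrable_torus_continuous continuous_on_subset
  by (metis borel_measurable_integrable subset_UNIV)

lemma continuous_torus_bounded:
  fixes f :: "real ^ 'n \<Rightarrow> 'b :: real_normed_vector"
  assumes "continuous_on UNIV f"
  obtains D where "0 < D" "\<And>x. x \<in> cbox 0 1 \<Longrightarrow> norm (f x) \<le> D"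
proof -
  have "bounded (f ` cbox 0 1)"
    using assms by (intro compact_imp_bounded compact_continuous_image) (auto intro: continuous_on_subset)
  then obtain D where "\<And>x. x \<in> cbox 0 1 \<Longrightarrow> norm (f x) \<le> D" by (auto simp: bounded_iff)
  then show ?thesis using that[of "max D 1"] by (auto simp: le_max_iff_disj)
qed

lemma integrable_bounded_scaleR:
  fixes f :: "'a \<Rightarrow> 'b :: {banach, second_countable_topology}"
  assumes "integrable M f" and [measurable]: "b \<in> borel_measurable M"
    and "AE x in M. \<bar>b x\<bar> \<le> D"
  shows "integrable M (\<lambda>x. b x *\<^sub>R f x)"
proof (rule Bochner_Integration.integrable_bound)
  show "integrable M (\<lambda>x. D *\<^sub>R f x)" using assms(1) by simp
  show "(\<lambda>x. b x *\<^sub>R f x) \<in> borel_measurable M" using assms(1) by measurable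
  show "AE x in M. norm (b x *\<^sub>R f x) \<le> norm (D *\<^sub>R f x)"
    using assms(3) by eventually_elim (auto intro!: mult_right_mono)
qed

lemma integrable_continuous_scaleR:
  fixes f :: "real ^ 'n \<Rightarrow> 'b :: {banach, second_countable_topology}"
  assumes "integrable torus f" "continuous_on UNIV b"
  shows "integrable torus (\<lambda>x. b x *\<^sub>R f x)"
proof -
  obtain D where "0 < D" "\<And>x. x \<in> cbox 0 1 \<Longrightarrow> norm (b x) \<le> D"
    using continuous_torus_bounded[OF assms(2)] by blast
  then show ?thesis
    by (intro integrable_bounded_scaleR[where D = D] assms borel_measurable_torus_continuous) auto
qed

lemma integrable_continuous_mult:
  fixes f :: "real ^ 'n \<Rightarrow> real"
  assumes "integrable torus f" "continuous_on UNIV b"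
  shows "integrable torus (\<lambda>x. b x * f x)" "integrable torus (\<lambda>x. f x * b x)"
  using integrable_continuous_scaleR[OF assms] by (simp_all add: mult.commute)

lemma integral_peak_power_pos: "0 < (\<integral>x. peak (x :: real ^ 'n) ^ N \<partial>torus)"
  by (rule laplace_concentration(2)[where d = "\<lambda>x. 0" and m = "2 * real CARD('n)" and ?x0.0 = 0])
    (auto simp: peak_nonneg peak_le peak_0 box_01_ne mem_box_cart intro!: continuous_on_peak continuous_intros)

lemma kern_nonneg: "0 \<le> kern N z"
  unfolding kern_def using integral_peak_power_pos by (intro divide_nonneg_pos zero_le_power peak_nonneg)

lemma kern_uminus: "kern N (- z) = kern N z"
  by (simp add: kern_def peak_uminus)

lemma kern_minus_commute: "kern N (x - y) = kern N (y - x)"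
  by (metis kern_uminus minus_diff_eq)

lemma continuous_on_kern:
  fixes f :: "'a::t2_space \<Rightarrow> real ^ 'n"
  shows "continuous_on S f \<Longrightarrow> continuous_on S (\<lambda>x. kern N (f x))"
  unfolding kern_def by (auto intro!: continuous_intros continuous_on_peak simp: less_imp_neq[OF integral_peak_power_pos, symmetric])

lemma periodic_kern: "periodic (kern N :: real ^ 'n \<Rightarrow> real)"
  using periodic_peak[where 'n = 'n] by (simp add: kern_def periodic_def)

lemma integral_kern: "(\<integral>y. kern N (x - y :: real ^ 'n) \<partial>torus) = 1"
proof -
  have "(\<integral>y. kern N (x - y) \<partial>torus) = (\<integral>y. kern N (y :: real ^ 'n) \<partial>torus)"
    by (rule periodic_integral_reflect[OF continuous_on_kern[OF continuous_on_id] periodic_kern])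
  also have "\<dots> = 1"
    using integral_peak_power_pos[of N, where 'n = 'n] by (simp add: kern_def)
  finally show ?thesis .
qed

lemma kern_separableE:
  obtains J :: nat and a b where "\<And>j. j < J \<Longrightarrow> test_fun (a j)" "\<And>j. j < J \<Longrightarrow> test_fun (b j)"
    "\<And>x y :: real ^ 'n. kern N (x - y) = (\<Sum>j<J. a j x * b j y)"
proof -
  obtain J a b where 1: "\<And>j::nat. j < J \<Longrightarrow> test_fun (a j)" "\<And>j. j < J \<Longrightarrow> test_fun (b j)"
    "\<And>x y :: real ^ 'n. peak (x - y) ^ N = (\<Sum>j<J. a j x * b j y)"
    using separable_sum_listE[OF separable_peak_power[of N]] by metis
  let ?Z = "\<integral>x. peak (x :: real ^ 'n) ^ N \<partial>torus"
  show thesis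
  proof (rule that[of J "\<lambda>j x. a j x * (1 / ?Z)" b])
    show "test_fun (\<lambda>x. a j x * (1 / ?Z))" if "j < J" for j
      by (intro test_fun_mult test_fun_const 1 that)
  qed (auto simp: kern_def 1 sum_divide_distrib)
qed

lemma test_fun_kern:
  fixes x y :: "real ^ 'n"
  shows "test_fun (\<lambda>x. kern N (x - y))" "test_fun (\<lambda>y. kern N (x - y))"
    "test_fun (kern N :: real ^ 'n \<Rightarrow> real)"
proof -
  obtain J a b where 1: "\<And>j::nat. j < J \<Longrightarrow> test_fun (a j)" "\<And>j. j < J \<Longrightarrow> test_fun (b j)"
    "\<And>x y :: real ^ 'n. kern N (x - y) = (\<Sum>j<J. a j x * b j y)" by (rule kern_separableE[where N = N]) (rule that)
  show 2: "test_fun (\<lambda>x. kern N (x - y))" for y :: "real ^ 'n" unfolding 1(3)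
    by (intro test_fun_sum test_fun_mult test_fun_const 1) auto
  show "test_fun (\<lambda>y. kern N (x - y))" using 2[of x] by (simp add: kern_minus_commute)
  show "test_fun (kern N :: real ^ 'n \<Rightarrow> real)" using 2[of 0] by simp
qed

lemma partial_deriv_kern:
  "partial_deriv i (\<lambda>x. kern N (x - y)) x = partial_deriv i (kern N) (x - y)"
  "partial_deriv i (\<lambda>y. kern N (x - y)) y = - partial_deriv i (kern N) (x - y)"
proof -
  note d = test_fun_has_derivative[OF test_fun_kern(3), of N]
  have "((\<lambda>x. kern N (x - y)) has_derivative (\<lambda>h. grad (kern N) (x - y) \<bullet> h)) (at x)"
    by (rule has_derivative_compose[where f = "\<lambda>x. x - y" and f' = "\<lambda>h. h", OF _ d])
      (auto intro!: derivative_eq_intros)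
  from partial_deriv_unique[OF this, of i]
  show "partial_deriv i (\<lambda>x. kern N (x - y)) x = partial_deriv i (kern N) (x - y)"
    by (simp add: inner_axis grad_def)
  have "((\<lambda>y. kern N (x - y)) has_derivative (\<lambda>h. grad (kern N) (x - y) \<bullet> (- h))) (at y)"
    by (rule has_derivative_compose[where f = "\<lambda>y. x - y" and f' = "\<lambda>h. - h", OF _ d])
      (auto intro!: derivative_eq_intros)
  from partial_deriv_unique[OF this, of i]
  show "partial_deriv i (\<lambda>y. kern N (x - y)) y = - partial_deriv i (kern N) (x - y)"
    by (simp add: inner_axis grad_def)
qed

text \<open>Convolution on the torus. Only the kernel is evaluated at shifted points, so
  \<open>f\<close> may be any function on the cube, and the result is still periodic.\<close>

definition smooth :: "nat \<Rightarrow> (real ^ 'n \<Rightarrow> real) \<Rightarrow> real ^ 'n \<Rightarrow> real" where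
  "smooth N f x = (\<integral>y. kern N (x - y) * f y \<partial>torus)"

lemma integrable_kern_mult:
  "integrable torus f \<Longrightarrow> integrable torus (\<lambda>y. kern N (x - y) * f y)"
  by (intro integrable_continuous_mult(1) test_fun_continuous_on[OF test_fun_kern(2)])

text \<open>The finite-rank form: \<open>f\<close> enters only through finitely many integrals
  against test functions. These are the coefficients from which compactness is obtained.\<close>

lemma smooth_sum:
  assumes "\<And>x y. kern N (x - y) = (\<Sum>j<J. a j x * b j y)" "\<And>j. j < J \<Longrightarrow> test_fun (b j)"
    "integrable torus f"
  shows "smooth N f = (\<lambda>x. \<Sum>j<J. a j x * (\<integral>y. b j y * f y \<partial>torus))"
proof (rule ext)
  fix x
  have "integrable torus (\<lambda>y. b j y * f y)" if "j < J" for j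
    using assms(2)[OF that] assms(3) by (intro integrable_continuous_mult(1) test_fun_continuous_on)
  then show "smooth N f x = (\<Sum>j<J. a j x * (\<integral>y. b j y * f y \<partial>torus))"
    by (simp add: smooth_def assms(1) sum_distrib_right mult.assoc)
qed

lemma test_fun_smooth:
  fixes f :: "real ^ 'n \<Rightarrow> real"
  assumes "integrable torus f" shows "test_fun (smooth N f)"
proof -
  obtain J a b where 1: "\<And>j::nat. j < J \<Longrightarrow> test_fun (a j)" "\<And>j. j < J \<Longrightarrow> test_fun (b j)"
    "\<And>x y :: real ^ 'n. kern N (x - y) = (\<Sum>j<J. a j x * b j y)" by (rule kern_separableE[where N = N]) (rule that)
  have "smooth N f = (\<lambda>x. \<Sum>j<J. a j x * (\<integral>y. b j y * f y \<partial>torus))"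
    by (rule smooth_sum) (use 1 assms in auto)
  moreover have "test_fun \<dots>" by (intro test_fun_sum test_fun_mult test_fun_const 1) auto
  ultimately show ?thesis by simp
qed

lemma integrable_test_fun: "test_fun \<phi> \<Longrightarrow> integrable torus \<phi>"
  by (intro integrable_torus_continuous test_fun_continuous_on)

section \<open>Linearity, monotonicity and contraction properties of smoothing\<close>

lemma smooth_const: "smooth N (\<lambda>x. c) x = c"
proof -
  have "smooth N (\<lambda>x. c) x = (\<integral>y. kern N (x - y) \<partial>torus) * c" unfolding smooth_def by simp
  then show ?thesis by (simp add: integral_kern)
qed

lemma smooth_add:
  "integrable torus f \<Longrightarrow> integrable torus g \<Longrightarrow> smooth N (\<lambda>x. f x + g x) x = smooth N f x + smooth N g x"
  by (simp add: smooth_def distrib_left integrable_kern_mult)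

lemma smooth_diff:
  "integrable torus f \<Longrightarrow> integrable torus g \<Longrightarrow> smooth N (\<lambda>x. f x - g x) x = smooth N f x - smooth N g x"
  by (simp add: smooth_def right_diff_distrib integrable_kern_mult)

lemma smooth_cmult: "smooth N (\<lambda>x. c * f x) x = c * smooth N f x"
  by (simp add: smooth_def mult.left_commute)

lemma smooth_mono:
  assumes "integrable torus f" "integrable torus g" "AE x in torus. f x \<le> g x"
  shows "smooth N f x \<le> smooth N g x"
  unfolding smooth_def
  by (intro integral_mono_AE integrable_kern_mult assms) (use assms(3) in \<open>eventually_elim, auto intro: mult_left_mono kern_nonneg\<close>)

lemma abs_smooth_le:
  assumes "integrable torus f" shows "\<bar>smooth N f x\<bar> \<le> smooth N (\<lambda>x. \<bar>f x\<bar>) x"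
  using integral_abs_bound[of torus "\<lambda>y. kern N (x - y) * f y"]
  by (simp add: smooth_def abs_mult kern_nonneg)

text \<open>The kernel is even, hence symmetric in \<open>x\<close> and \<open>y\<close>. Both sides
  are the same finite sum of products of integrals.\<close>

lemma smooth_adjoint:
  fixes f g :: "real ^ 'n \<Rightarrow> real"
  assumes "integrable torus f" "integrable torus g"
  shows "(\<integral>x. smooth N f x * g x \<partial>torus) = (\<integral>x. f x * smooth N g x \<partial>torus)"
proof -
  obtain J a b where 1: "\<And>j::nat. j < J \<Longrightarrow> test_fun (a j)" "\<And>j. j < J \<Longrightarrow> test_fun (b j)"
    "\<And>x y :: real ^ 'n. kern N (x - y) = (\<Sum>j<J. a j x * b j y)" by (rule kern_separableE[where N = N]) (rule that)
  have 2: "kern N (x - y) = (\<Sum>j<J. b j x * a j y)" for x y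
    using 1(3)[of y x] by (simp add: kern_minus_commute[of N x y] mult.commute)
  have int: "integrable torus (\<lambda>x. a j x * g x)" "integrable torus (\<lambda>x. b j x * f x)" if "j < J" for j
    using that 1 assms by (auto intro!: integrable_continuous_mult(1) test_fun_continuous_on)
  have "(\<integral>x. smooth N f x * g x \<partial>torus) =
      (\<integral>x. (\<Sum>j<J. (a j x * g x) * (\<integral>y. b j y * f y \<partial>torus)) \<partial>torus)"
    by (simp add: smooth_sum[OF 1(3,2) assms(1)] sum_distrib_left sum_distrib_right mult_ac)
  also have "\<dots> = (\<Sum>j<J. (\<integral>y. a j y * g y \<partial>torus) * (\<integral>y. b j y * f y \<partial>torus))"
    using int by simp
  also have "\<dots> = (\<integral>x. (\<Sum>j<J. (b j x * f x) * (\<integral>y. a j y * g y \<partial>torus)) \<partial>torus)"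
    using int by (simp add: mult.commute)
  also have "\<dots> = (\<integral>x. f x * smooth N g x \<partial>torus)"
    by (simp add: smooth_sum[OF 2 1(1) assms(2)] sum_distrib_left mult_ac)
  finally show ?thesis .
qed

lemma integral_smooth: 
  assumes "integrable torus f" shows "(\<integral>x. smooth N f x \<partial>torus) = (\<integral>x. f x \<partial>torus)"
  using smooth_adjoint[OF assms, of "\<lambda>x. 1" N] by (simp add: smooth_const)

lemma smooth_L1_contraction:
  assumes "integrable torus f"
  shows "(\<integral>x. \<bar>smooth N f x\<bar> \<partial>torus) \<le> (\<integral>x. \<bar>f x\<bar> \<partial>torus)"
proof -
  have "(\<integral>x. \<bar>smooth N f x\<bar> \<partial>torus) \<le> (\<integral>x. smooth N (\<lambda>x. \<bar>f x\<bar>) x \<partial>torus)"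
    using assms by (intro integral_mono integrable_abs integrable_test_fun[OF test_fun_smooth] abs_smooth_le)
  also have "\<dots> = (\<integral>x. \<bar>f x\<bar> \<partial>torus)" using assms by (intro integral_smooth) simp
  finally show ?thesis .
qed

text \<open>Jensen's inequality for the probability density \<open>kern N (x - y)\<close>, obtained
  by smoothing the nonnegative square of \<open>f - c\<close>, where \<open>c\<close> is the
  smoothed value at \<open>x\<close>.\<close>

lemma smooth_square_le:
  assumes "integrable torus f" "integrable torus (\<lambda>x. (f x)\<^sup>2)"
  shows "(smooth N f x)\<^sup>2 \<le> smooth N (\<lambda>x. (f x)\<^sup>2) x"
proof -
  define c where "c = smooth N f x"
  have "0 = smooth N (\<lambda>y. 0) x" by (simp add: smooth_const)
  also have "\<dots> \<le> smooth N (\<lambda>y. ((f y)\<^sup>2 - (2 * c) * f y) + c\<^sup>2) x"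
  proof (intro smooth_mono AE_I2)
    show "0 \<le> (f y)\<^sup>2 - 2 * c * f y + c\<^sup>2" for y
      using zero_le_power2[of "f y - c"] by (simp add: power2_diff mult_ac)
  qed (use assms in simp_all)
  also have "\<dots> = smooth N (\<lambda>x. (f x)\<^sup>2) x - 2 * c * c + c\<^sup>2"
    using assms by (simp add: smooth_add smooth_diff smooth_cmult smooth_const c_def)
  finally show ?thesis by (simp add: c_def power2_eq_square)
qed

lemma smooth_L2_contraction:
  assumes "integrable torus f" "integrable torus (\<lambda>x. (f x)\<^sup>2)"
  shows "(\<integral>x. (smooth N f x)\<^sup>2 \<partial>torus) \<le> (\<integral>x. (f x)\<^sup>2 \<partial>torus)"
proof -
  have "(\<integral>x. (smooth N f x)\<^sup>2 \<partial>torus) \<le> (\<integral>x. smooth N (\<lambda>x. (f x)\<^sup>2) x \<partial>torus)"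
    using assms test_fun_mult[OF test_fun_smooth test_fun_smooth, of f f N]
    by (intro integral_mono integrable_test_fun[OF test_fun_smooth] smooth_square_le)
      (auto simp: power2_eq_square intro: integrable_test_fun)
  also have "\<dots> = (\<integral>x. (f x)\<^sup>2 \<partial>torus)" using assms by (intro integral_smooth)
  finally show ?thesis .
qed

lemma partial_deriv_sum_mult:
  assumes "\<And>j. j < J \<Longrightarrow> test_fun (a j)"
  shows "partial_deriv i (\<lambda>x. \<Sum>j<(J::nat). a j x * c j) x = (\<Sum>j<J. partial_deriv i (a j) x * c j)"
proof -
  have "((\<lambda>x. \<Sum>j<J. a j x * c j) has_derivative (\<lambda>h. \<Sum>j<J. (grad (a j) x \<bullet> h) * c j)) (at x)"
    by (intro has_derivative_sum has_derivative_mult_left test_fun_has_derivative assms) auto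
  from partial_deriv_unique[OF this, of i] show ?thesis by (simp add: inner_axis grad_def)
qed

lemma partial_deriv_smooth:
  fixes f :: "real ^ 'n \<Rightarrow> real"
  assumes "integrable torus f"
  shows "partial_deriv i (smooth N f) x = (\<integral>y. partial_deriv i (kern N) (x - y) * f y \<partial>torus)"
proof -
  obtain J a b where 1: "\<And>j::nat. j < J \<Longrightarrow> test_fun (a j)" "\<And>j. j < J \<Longrightarrow> test_fun (b j)"
    "\<And>x y :: real ^ 'n. kern N (x - y) = (\<Sum>j<J. a j x * b j y)" by (rule kern_separableE[where N = N]) (rule that)
  have 2: "partial_deriv i (kern N) (x - y) = (\<Sum>j<J. partial_deriv i (a j) x * b j y)" for y
    unfolding partial_deriv_kern(1)[symmetric] 1(3) by (rule partial_deriv_sum_mult[OF 1(1)])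
  have int: "integrable torus (\<lambda>x. b j x * f x)" if "j < J" for j
    using that 1 assms by (auto intro!: integrable_continuous_mult(1) test_fun_continuous_on)
  have "partial_deriv i (smooth N f) x =
      (\<Sum>j<J. partial_deriv i (a j) x * (\<integral>y. b j y * f y \<partial>torus))"
    by (subst smooth_sum[OF 1(3,2) assms]) (auto intro: partial_deriv_sum_mult 1)
  also have "\<dots> = (\<integral>y. (\<Sum>j<J. partial_deriv i (a j) x * (b j y * f y)) \<partial>torus)"
    using int by simp
  also have "\<dots> = (\<integral>y. partial_deriv i (kern N) (x - y) * f y \<partial>torus)"
    by (simp add: 2 sum_distrib_left sum_distrib_right mult_ac)
  finally show ?thesis .
qed

text \<open>Smoothing commutes with weak derivatives: the derivative of the kernel in
  \<open>x\<close> is minus the one in \<open>y\<close>, and the kernel is an admissible test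
  function in \<open>y\<close>.\<close>

lemma partial_deriv_smooth_weak:
  assumes "integrable torus f"
    and "\<And>\<phi>. test_fun \<phi> \<Longrightarrow> (\<integral>x. f x * partial_deriv i \<phi> x \<partial>torus) = - (\<integral>x. h x * \<phi> x \<partial>torus)"
  shows "partial_deriv i (smooth N f) x = smooth N h x"
proof -
  have "partial_deriv i (smooth N f) x = - (\<integral>y. f y * partial_deriv i (\<lambda>y. kern N (x - y)) y \<partial>torus)"
    by (simp add: partial_deriv_smooth[OF assms(1)] partial_deriv_kern mult.commute)
  also have "\<dots> = smooth N h x"
    by (subst assms(2)[OF test_fun_kern(2)]) (simp add: smooth_def mult.commute)
  finally show ?thesis .
qed

text \<open>The derivative of an even kernel is odd, hence the sign. Both functions are merely
  integrable, which matters later when one of them is a sign function.\<close>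

lemma partial_deriv_smooth_adjoint:
  fixes f g :: "real ^ 'n \<Rightarrow> real"
  assumes "integrable torus f" "integrable torus g"
  shows "(\<integral>x. partial_deriv i (smooth N f) x * g x \<partial>torus) = - (\<integral>x. f x * partial_deriv i (smooth N g) x \<partial>torus)"
proof -
  obtain J a b where 1: "\<And>j::nat. j < J \<Longrightarrow> test_fun (a j)" "\<And>j. j < J \<Longrightarrow> test_fun (b j)"
    "\<And>x y :: real ^ 'n. kern N (x - y) = (\<Sum>j<J. a j x * b j y)" by (rule kern_separableE[where N = N]) (rule that)
  have 2: "kern N (x - y) = (\<Sum>j<J. b j x * a j y)" for x y
    using 1(3)[of y x] by (simp add: kern_minus_commute[of N x y] mult.commute)
  \<comment> \<open>The derivative is put on the factors \<open>b j\<close> in \<open>y\<close>.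
    After \<open>f\<close> and \<open>g\<close> exchange roles these become the factors in
    \<open>x\<close>, so the same sum is the derivative of \<open>smooth N g\<close>.\<close>
  have 3: "partial_deriv i (kern N) (x - y) = - (\<Sum>j<J. partial_deriv i (b j) y * a j x)" for x y
  proof -
    have "- partial_deriv i (kern N) (x - y) = partial_deriv i (\<lambda>y. \<Sum>j<J. b j y * a j x) y"
      unfolding partial_deriv_kern(2)[symmetric] 1(3) by (simp add: mult.commute)
    also have "\<dots> = (\<Sum>j<J. partial_deriv i (b j) y * a j x)" by (rule partial_deriv_sum_mult[OF 1(2)])
    finally show ?thesis by simp
  qed
  have int: "integrable torus (\<lambda>x. a j x * g x)" "integrable torus (\<lambda>x. partial_deriv i (b j) x * f x)" if "j < J" for j
    using that 1 assms by (auto intro!: integrable_continuous_mult(1) test_fun_continuous_on test_fun_partial_deriv)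
  have "partial_deriv i (smooth N f) x = - (\<Sum>j<J. a j x * (\<integral>y. partial_deriv i (b j) y * f y \<partial>torus))" for x
  proof -
    have "partial_deriv i (smooth N f) x = (\<integral>y. - (\<Sum>j<J. a j x * (partial_deriv i (b j) y * f y)) \<partial>torus)"
      by (simp add: partial_deriv_smooth[OF assms(1)] 3 sum_distrib_left sum_distrib_right mult_ac)
    also have "\<dots> = - (\<Sum>j<J. a j x * (\<integral>y. partial_deriv i (b j) y * f y \<partial>torus))"
      using int by simp
    finally show ?thesis .
  qed
  then have "(\<integral>x. partial_deriv i (smooth N f) x * g x \<partial>torus) =
      - (\<integral>x. (\<Sum>j<J. (\<integral>y. partial_deriv i (b j) y * f y \<partial>torus) * (a j x * g x)) \<partial>torus)"
    by (simp add: sum_distrib_left sum_distrib_right mult_ac)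
  also have "\<dots> = - (\<Sum>j<J. (\<integral>y. partial_deriv i (b j) y * f y \<partial>torus) * (\<integral>x. a j x * g x \<partial>torus))"
    using int by simp
  also have "\<dots> = - (\<integral>y. (\<Sum>j<J. (\<integral>x. a j x * g x \<partial>torus) * (partial_deriv i (b j) y * f y)) \<partial>torus)"
    using int by (simp add: mult.commute)
  also have "\<dots> = - (\<integral>x. f x * partial_deriv i (smooth N g) x \<partial>torus)"
  proof -
    have "smooth N g = (\<lambda>x. \<Sum>j<J. b j x * (\<integral>y. a j y * g y \<partial>torus))"
      by (rule smooth_sum) (use 1 2 assms in auto)
    then have "partial_deriv i (smooth N g) x = (\<Sum>j<J. partial_deriv i (b j) x * (\<integral>y. a j y * g y \<partial>torus))" for x
      by (simp add: partial_deriv_sum_mult 1)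
    then show ?thesis by (simp add: sum_distrib_left mult_ac)
  qed
  finally show ?thesis .
qed

text \<open>\<open>f\<close> need not match on opposite faces. At an interior point this does no
  harm: no other point of the closed cube differs from \<open>x\<close> by an integer vector, so the
  kernel centred at \<open>x\<close> has a single peak in the cube.\<close>

lemma smooth_tendsto_continuous:
  fixes f :: "real ^ 'n \<Rightarrow> real"
  assumes "continuous_on UNIV f" "x \<in> box 0 1"
  shows "(\<lambda>N. smooth N f x) \<longlonglongrightarrow> f x"
proof -
  let ?d = "\<lambda>y. \<bar>f y - f x\<bar>"
  have c: "continuous_on S ?d" for S
    by (intro continuous_intros continuous_on_subset[OF assms(1)]) auto
  have Z: "(\<integral>y. peak (x - y) ^ N \<partial>torus) = (\<integral>y. peak (y :: real ^ 'n) ^ N \<partial>torus)" for N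
    using periodic_peak[where 'n = 'n]
    by (intro periodic_integral_reflect[of "\<lambda>y. peak y ^ N"] continuous_intros continuous_on_peak)
      (auto simp: periodic_def)
  have "(\<lambda>N. (\<integral>y. peak (x - y) ^ N * ?d y \<partial>torus) / (\<integral>y. peak (x - y) ^ N \<partial>torus)) \<longlonglongrightarrow> 0"
  proof (rule laplace_concentration(1)[where m = "2 * real CARD('n)" and ?x0.0 = x])
    show "x \<in> cbox 0 1" using assms(2) box_subset_cbox by blast
    fix y assume y: "y \<in> cbox 0 (1 :: real ^ 'n)" "peak (x - y) = 2 * real CARD('n)"
    have "x $ i - y $ i = 0" for i
    proof (rule cos_2pi_eq_1_iff_0)
      show "cos (2 * pi * (x $ i - y $ i)) = 1" using peak_maxD[OF y(2), of i] by simp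
      have "0 < x $ i" "x $ i < 1" "0 \<le> y $ i" "y $ i \<le> 1"
        using assms(2) y(1) by (simp_all add: mem_box_cart)
      then show "\<bar>x $ i - y $ i\<bar> < 1" by linarith
    qed
    then have "x = y" by (simp add: vec_eq_iff)
    then show "?d y = 0" by simp
  qed (auto intro!: continuous_on_peak continuous_intros c simp: peak_nonneg peak_le peak_0 box_01_ne)
  moreover have "(\<integral>y. peak (x - y) ^ N * ?d y \<partial>torus) / (\<integral>y. peak (x - y) ^ N \<partial>torus) = smooth N ?d x" for N
    by (simp add: smooth_def kern_def Z)
  ultimately have "(\<lambda>N. smooth N ?d x) \<longlonglongrightarrow> 0" by simp
  moreover have "\<bar>smooth N f x - f x\<bar> \<le> smooth N ?d x" for N
  proof -
    have i: "integrable torus f" by (intro integrable_torus_continuous continuous_on_subset[OF assms(1)]) auto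
    have "smooth N f x - f x = smooth N (\<lambda>y. f y - f x) x"
      using i by (simp add: smooth_diff smooth_const)
    then show ?thesis using abs_smooth_le[of "\<lambda>y. f y - f x" N x] i by simp
  qed
  ultimately have "(\<lambda>N. smooth N f x - f x) \<longlonglongrightarrow> 0"
    by (intro Lim_null_comparison[of "\<lambda>N. smooth N f x - f x" "\<lambda>N. smooth N ?d x"]) auto
  then show ?thesis by (simp add: LIM_zero_iff)
qed

text \<open>The functions approximated by their smoothings form a closed set in L1, because
  smoothing contracts the L1 norm.\<close>

lemma smooth_tendsto_L1_closed:
  assumes f: "integrable torus f"
    and approx: "\<And>e. 0 < e \<Longrightarrow> \<exists>g. integrable torus g \<and> (\<integral>x. \<bar>g x - f x\<bar> \<partial>torus) < e \<and>
      (\<lambda>N. \<integral>x. \<bar>smooth N g x - g x\<bar> \<partial>torus) \<longlonglongrightarrow> 0"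
  shows "(\<lambda>N. \<integral>x. \<bar>smooth N f x - f x\<bar> \<partial>torus) \<longlonglongrightarrow> 0"
proof (rule LIMSEQ_I)
  fix r :: real assume "0 < r"
  then obtain g where g: "integrable torus g" "(\<integral>x. \<bar>g x - f x\<bar> \<partial>torus) < r/3"
    "(\<lambda>N. \<integral>x. \<bar>smooth N g x - g x\<bar> \<partial>torus) \<longlonglongrightarrow> 0" using approx[of "r/3"] by auto
  obtain N0 where N0: "\<And>N. N \<ge> N0 \<Longrightarrow> \<bar>\<integral>x. \<bar>smooth N g x - g x\<bar> \<partial>torus\<bar> < r/3"
    using LIMSEQ_D[OF g(3), of "r/3"] \<open>0 < r\<close> by auto
  have "norm ((\<integral>x. \<bar>smooth N f x - f x\<bar> \<partial>torus) - 0) < r" if "N \<ge> N0" for N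
  proof -
    note s = integrable_test_fun[OF test_fun_smooth]
    have gf: "integrable torus (\<lambda>x. g x - f x)" using g f by simp
    have "(\<integral>x. \<bar>smooth N f x - f x\<bar> \<partial>torus) \<le>
        (\<integral>x. \<bar>smooth N (\<lambda>x. g x - f x) x\<bar> + \<bar>smooth N g x - g x\<bar> + \<bar>g x - f x\<bar> \<partial>torus)"
    proof (rule integral_mono)
      show "\<bar>smooth N f x - f x\<bar> \<le> \<bar>smooth N (\<lambda>x. g x - f x) x\<bar> + \<bar>smooth N g x - g x\<bar> + \<bar>g x - f x\<bar>" for x
        using smooth_diff[OF g(1) f, of N x] by simp
    qed (intro Bochner_Integration.integrable_add Bochner_Integration.integrable_diff integrable_abs s f g gf)+
    also have "\<dots> = (\<integral>x. \<bar>smooth N (\<lambda>x. g x - f x) x\<bar> \<partial>torus) + (\<integral>x. \<bar>smooth N g x - g x\<bar> \<partial>torus) + (\<integral>x. \<bar>g x - f x\<bar> \<partial>torus)"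
      using f g s[OF gf] s[OF g(1)] by simp
    also have "\<dots> < r" using smooth_L1_contraction[OF gf, of N] g(2) N0[OF that] by linarith
    finally show ?thesis by simp
  qed
  then show "\<exists>no. \<forall>N\<ge>no. norm ((\<integral>x. \<bar>smooth N f x - f x\<bar> \<partial>torus) - 0) < r" by blast
qed

lemma smooth_tendsto_L1_continuous:
  fixes f :: "real ^ 'n \<Rightarrow> real"
  assumes "continuous_on UNIV f"
  shows "(\<lambda>N. \<integral>x. \<bar>smooth N f x - f x\<bar> \<partial>torus) \<longlonglongrightarrow> 0"
proof -
  obtain D where D: "0 < D" "\<And>x. x \<in> cbox 0 1 \<Longrightarrow> norm (f x) \<le> D"
    using continuous_torus_bounded[OF assms] by blast
  have i: "integrable torus f" by (intro integrable_torus_continuous continuous_on_subset[OF assms]) auto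
  have [measurable]: "f \<in> borel_measurable torus" "smooth N f \<in> borel_measurable torus" for N
    using i integrable_test_fun[OF test_fun_smooth[OF i]] by auto
  have le: "\<bar>smooth N f x\<bar> \<le> D" for N x
  proof -
    have "\<bar>smooth N f x\<bar> \<le> smooth N (\<lambda>x. \<bar>f x\<bar>) x" by (rule abs_smooth_le[OF i])
    also have "\<dots> \<le> smooth N (\<lambda>x. D) x" using i D by (intro smooth_mono AE_I2) auto
    finally show ?thesis by (simp add: smooth_const)
  qed
  have "(\<lambda>N. \<integral>x. \<bar>smooth N f x - f x\<bar> \<partial>torus) \<longlonglongrightarrow> (\<integral>x. 0 \<partial>(torus :: (real ^ 'n) measure))"
  proof (rule integral_dominated_convergence[where w = "\<lambda>x. 2 * D"])
    show "AE x in torus. (\<lambda>N. \<bar>smooth N f x - f x\<bar>) \<longlonglongrightarrow> 0"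
      using AE_torus_interior
    proof eventually_elim
      case (elim x)
      then show ?case using smooth_tendsto_continuous[OF assms elim]
        by (intro tendsto_rabs_zero) (simp add: LIM_zero_iff)
    qed
    show "AE x in torus. norm \<bar>smooth N f x - f x\<bar> \<le> 2 * D" for N
    proof (rule AE_I2)
      fix x :: "real ^ 'n" assume "x \<in> space torus"
      then have "\<bar>f x\<bar> \<le> D" using D(2) by simp
      with le[of N x] show "norm \<bar>smooth N f x - f x\<bar> \<le> 2 * D" by simp
    qed
  qed auto
  then show ?thesis by simp
qed

text \<open>Approximation in two stages: truncation at a level \<open>k\<close> gives bounded
  functions, and these are limits of continuous ones. Each stage is a dominated convergence.\<close>

lemma smooth_tendsto_L1:
  fixes f :: "real ^ 'n \<Rightarrow> real"
  assumes f: "integrable torus f"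
  shows "(\<lambda>N. \<integral>x. \<bar>smooth N f x - f x\<bar> \<partial>torus) \<longlonglongrightarrow> 0"
proof (rule smooth_tendsto_L1_closed[OF f])
  define cl where "cl k t = max (- real k) (min (real k) t)" for k t
  fix e :: real assume e: "0 < e"
  have [measurable]: "f \<in> borel_measurable torus" using f by simp
  have [measurable]: "cl k \<in> borel_measurable borel" for k unfolding cl_def by measurable
  have cl1: "\<bar>cl k t\<bar> \<le> real k" for k t by (auto simp: cl_def)
  have "(\<lambda>k. \<integral>x. \<bar>cl k (f x) - f x\<bar> \<partial>torus) \<longlonglongrightarrow> (\<integral>x. 0 \<partial>(torus :: (real ^ 'n) measure))"
  proof (rule integral_dominated_convergence[where w = "\<lambda>x. \<bar>f x\<bar>"])
    show "AE x in torus. (\<lambda>k. \<bar>cl k (f x) - f x\<bar>) \<longlonglongrightarrow> 0"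
    proof (rule AE_I2)
      fix x
      obtain K :: nat where "\<bar>f x\<bar> \<le> K" using real_arch_simple by blast
      then have "\<forall>k\<ge>K. \<bar>cl k (f x) - f x\<bar> = 0" by (auto simp: cl_def)
      then show "(\<lambda>k. \<bar>cl k (f x) - f x\<bar>) \<longlonglongrightarrow> 0"
        by (intro tendsto_eventually) (simp add: eventually_sequentially, blast)
    qed
    show "AE x in torus. norm \<bar>cl k (f x) - f x\<bar> \<le> \<bar>f x\<bar>" for k
      by (intro AE_I2) (auto simp: cl_def max_def min_def)
  qed (use f in auto)
  then obtain k where k: "(\<integral>x. \<bar>cl k (f x) - f x\<bar> \<partial>torus) < e"
    using LIMSEQ_D[of "\<lambda>k. \<integral>x. \<bar>cl k (f x) - f x\<bar> \<partial>torus" 0 e] e by auto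
  define h where "h x = cl k (f x)" for x
  have [measurable]: "h \<in> borel_measurable torus" unfolding h_def by measurable
  have hb: "\<bar>h x\<bar> \<le> real k" for x by (simp add: h_def cl1)
  have ih: "integrable torus h" by (rule torus.integrable_const_bound[of _ "real k"]) (auto simp: hb)
  have "(\<lambda>N. \<integral>x. \<bar>smooth N h x - h x\<bar> \<partial>torus) \<longlonglongrightarrow> 0"
  proof (rule smooth_tendsto_L1_closed[OF ih])
    fix e :: real assume e: "0 < e"
    \<comment> \<open>This notion of measurability supplies continuous functions converging off a
      null set. Clamping them at the level \<open>k\<close> provides the dominating constant and
      keeps the limit, since \<open>h\<close> takes values in the clamped range.\<close>
    have "h measurable_on cbox 0 1" by (subst measurable_on_iff_borel_measurable) auto
    then obtain A g where g: "negligible A" "\<And>n. continuous_on UNIV (g n)"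
      "\<And>x. x \<notin> A \<Longrightarrow> (\<lambda>n. g n x) \<longlonglongrightarrow> (if x \<in> cbox 0 1 then h x else 0)"
      unfolding measurable_on_def by blast
    have cg: "continuous_on UNIV (\<lambda>x. cl k (g n x))" for n
      unfolding cl_def by (intro continuous_intros g)
    have [measurable]: "(\<lambda>x. cl k (g n x)) \<in> borel_measurable torus" for n
      by (rule borel_measurable_torus_continuous[OF cg])
    have "(\<lambda>n. \<integral>x. \<bar>cl k (g n x) - h x\<bar> \<partial>torus) \<longlonglongrightarrow> (\<integral>x. 0 \<partial>(torus :: (real ^ 'n) measure))"
    proof (rule integral_dominated_convergence[where w = "\<lambda>x. 2 * real k"])
      have "AE x in lebesgue. x \<notin> A" using g(1) AE_not_in negligible_iff_null_sets by blast
      then have "AE x in torus. x \<notin> A" by (subst AE_restrict_space_iff) auto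
      then show "AE x in torus. (\<lambda>n. \<bar>cl k (g n x) - h x\<bar>) \<longlonglongrightarrow> 0"
      proof (rule AE_mp[OF _ AE_I2], intro impI)
        fix x assume "x \<in> space (torus :: (real ^ 'n) measure)" "x \<notin> A"
        then have "(\<lambda>n. g n x) \<longlonglongrightarrow> h x" using g(3)[of x] by simp
        then have "(\<lambda>n. cl k (g n x)) \<longlonglongrightarrow> cl k (h x)" unfolding cl_def by (intro tendsto_intros)
        moreover have "cl k (h x) = h x" by (simp add: h_def cl_def)
        ultimately show "(\<lambda>n. \<bar>cl k (g n x) - h x\<bar>) \<longlonglongrightarrow> 0"
          by (intro tendsto_rabs_zero) (simp add: LIM_zero_iff)
      qed
      show "AE x in torus. norm \<bar>cl k (g n x) - h x\<bar> \<le> 2 * real k" for n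
      proof (rule AE_I2)
        show "norm \<bar>cl k (g n x) - h x\<bar> \<le> 2 * real k" for x
          using cl1[of k "g n x"] hb[of x] by simp
      qed
    qed auto
    then obtain n where n: "(\<integral>x. \<bar>cl k (g n x) - h x\<bar> \<partial>torus) < e"
      using LIMSEQ_D[of "\<lambda>n. \<integral>x. \<bar>cl k (g n x) - h x\<bar> \<partial>torus" 0 e] e by auto
    show "\<exists>g. integrable torus g \<and> (\<integral>x. \<bar>g x - h x\<bar> \<partial>torus) < e \<and>
      (\<lambda>N. \<integral>x. \<bar>smooth N g x - g x\<bar> \<partial>torus) \<longlonglongrightarrow> 0"
      using n cg smooth_tendsto_L1_continuous[OF cg[of n]]
      by (intro exI[of _ "\<lambda>x. cl k (g n x)"] conjI integrable_torus_continuous) (auto intro: continuous_on_subset)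
  qed
  with k ih show "\<exists>g. integrable torus g \<and> (\<integral>x. \<bar>g x - f x\<bar> \<partial>torus) < e \<and>
      (\<lambda>N. \<integral>x. \<bar>smooth N g x - g x\<bar> \<partial>torus) \<longlonglongrightarrow> 0"
    by (intro exI[of _ h]) (auto simp: h_def)
qed

section \<open>Averaging estimates and completeness of the space of integrable functions\<close>

text \<open>The measures that occur are completed Lebesgue measures and densities over them.
  Measurability of the identity pulls the Borel measurability of a continuous integrand back to the
  product.\<close>

lemma Fubini_continuous:
  fixes F :: "'a::euclidean_space \<Rightarrow> 'b::euclidean_space \<Rightarrow> real"
  assumes "prob_space M" "prob_space N"
    and [measurable]: "(\<lambda>x. x) \<in> borel_measurable M" "(\<lambda>y. y) \<in> borel_measurable N"
    and cont: "continuous_on UNIV (\<lambda>p. F (fst p) (snd p))"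
    and bounded: "\<And>x y. x \<in> space M \<Longrightarrow> y \<in> space N \<Longrightarrow> \<bar>F x y\<bar> \<le> D"
  shows "(\<integral>x. (\<integral>y. F x y \<partial>N) \<partial>M) = (\<integral>y. (\<integral>x. F x y \<partial>M) \<partial>N)"
    and "integrable M (\<lambda>x. \<integral>y. F x y \<partial>N)" "integrable N (\<lambda>y. \<integral>x. F x y \<partial>M)"
proof -
  interpret M: prob_space M by fact
  interpret N: prob_space N by fact
  interpret P: pair_prob_space M N ..
  have [measurable]: "(\<lambda>p. F (fst p) (snd p)) \<in> borel_measurable (borel \<Otimes>\<^sub>M borel)"
    using borel_measurable_continuous_onI[OF cont] by (simp add: borel_prod)
  have [measurable]: "(\<lambda>p. (fst p, snd p)) \<in> M \<Otimes>\<^sub>M N \<rightarrow>\<^sub>M borel \<Otimes>\<^sub>M borel"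
    by measurable
  have "(\<lambda>p. F (fst (fst p, snd p)) (snd (fst p, snd p))) \<in> borel_measurable (M \<Otimes>\<^sub>M N)"
    by measurable
  then have "(\<lambda>(x, y). F x y) \<in> borel_measurable (M \<Otimes>\<^sub>M N)"
    by (simp add: case_prod_beta')
  then have int: "integrable (M \<Otimes>\<^sub>M N) (\<lambda>(x, y). F x y)"
    by (intro P.integrable_const_bound[of _ D] AE_I2) (auto simp: space_pair_measure bounded)
  show "(\<integral>x. (\<integral>y. F x y \<partial>N) \<partial>M) = (\<integral>y. (\<integral>x. F x y \<partial>M) \<partial>N)"
    using P.Fubini_integral[OF int] by simp
  show "integrable M (\<lambda>x. \<integral>y. F x y \<partial>N)" using P.integrable_fst[OF int] .
  show "integrable N (\<lambda>y. \<integral>x. F x y \<partial>M)" using P.integrable_snd[OF int] .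
qed

lemma id_borel_lebesgue_on: "(\<lambda>x. x) \<in> borel_measurable (lebesgue_on S)"
  using id_borel_measurable_lebesgue_on by (simp add: id_def)

lemma prob_space_unit_interval: "prob_space (lebesgue_on {0..1::real})"
  by (rule prob_spaceI) (simp add: emeasure_restrict_space)

lemma continuous_Times_bounded:
  fixes F :: "'a::euclidean_space \<Rightarrow> 'b::euclidean_space \<Rightarrow> real"
  assumes "continuous_on UNIV (\<lambda>p. F (fst p) (snd p))" "compact S" "compact T"
  obtains D where "\<And>x y. x \<in> S \<Longrightarrow> y \<in> T \<Longrightarrow> \<bar>F x y\<bar> \<le> D"
proof -
  have "bounded ((\<lambda>p. F (fst p) (snd p)) ` (S \<times> T))"
    using assms by (intro compact_imp_bounded compact_continuous_image compact_Times)
      (auto intro: continuous_on_subset)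
  then obtain D where D: "\<And>p. p \<in> S \<times> T \<Longrightarrow> norm (F (fst p) (snd p)) \<le> D"
    unfolding bounded_iff by blast
  show ?thesis by (rule that[of D]) (use D in force)
qed

text \<open>The increment of \<open>w\<close> is the mean of \<open>grad w \<bullet> z\<close> along
  the segment from \<open>x\<close> to \<open>x + z\<close>. Jensen's inequality moves
  \<open>q\<close> inside the mean, and translation invariance removes the dependence on the point
  of the segment.\<close>

lemma translation_estimate:
  fixes w :: "real ^ 'n \<Rightarrow> real"
  assumes w: "test_fun w" and q: "convex_on UNIV q" "continuous_on UNIV q"
  shows "(\<integral>x. q (w (x + z) - w x) \<partial>torus) \<le> (\<integral>x. q (grad w x \<bullet> z) \<partial>torus)"
proof -
  let ?U = "lebesgue_on {0..1::real}"
  interpret U: prob_space ?U by (rule prob_space_unit_interval)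
  have cg: "continuous_on UNIV (grad w)" by (rule continuous_on_grad[OF w])
  have cw: "continuous_on UNIV w" by (rule test_fun_continuous_on[OF w])
  define F where "F x s = q (grad w (x + s *\<^sub>R z) \<bullet> z)" for x and s :: real
  have cF: "continuous_on UNIV (\<lambda>p. F (fst p) (snd p))"
    unfolding F_def
    by (rule continuous_on_compose2[OF q(2)])
      (auto intro!: continuous_intros continuous_on_compose2[OF cg])
  obtain D where D: "\<And>x s. x \<in> cbox 0 1 \<Longrightarrow> s \<in> {0..1} \<Longrightarrow> \<bar>F x s\<bar> \<le> D"
    using continuous_Times_bounded[OF cF compact_cbox compact_Icc] by metis
  note fub = Fubini_continuous[OF torus_prob_space prob_space_unit_interval id_borel_lebesgue_on
      id_borel_lebesgue_on cF, of D]
  have jensen: "q (w (x + z) - w x) \<le> (\<integral>s. F x s \<partial>?U)" for x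
  proof -
    let ?G = "\<lambda>s. grad w (x + s *\<^sub>R z) \<bullet> z"
    have cG: "continuous_on UNIV ?G" by (auto intro!: continuous_intros continuous_on_compose2[OF cg])
    have "(?G has_integral (w (x + 1 *\<^sub>R z) - w (x + 0 *\<^sub>R z))) {0..1}"
    proof (rule fundamental_theorem_of_calculus)
      fix s :: real assume "s \<in> {0..1}"
      have "((\<lambda>s. w (x + s *\<^sub>R z)) has_derivative (\<lambda>h. grad w (x + s *\<^sub>R z) \<bullet> (h *\<^sub>R z))) (at s within {0..1})"
        by (rule has_derivative_compose[where f = "\<lambda>s. x + s *\<^sub>R z" and f' = "\<lambda>h. h *\<^sub>R z",
              OF _ test_fun_has_derivative[OF w]]) (auto intro!: derivative_eq_intros)
      then show "((\<lambda>s. w (x + s *\<^sub>R z)) has_vector_derivative ?G s) (at s within {0..1})"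
        by (simp add: has_vector_derivative_def)
    qed simp
    moreover have iG: "integrable ?U ?G"
      by (intro continuous_imp_integrable_real continuous_on_subset[OF cG]) auto
    ultimately have "(\<integral>s. ?G s \<partial>?U) = w (x + z) - w x"
      by (subst lebesgue_integral_eq_integral) (auto intro: integral_unique)
    moreover have "q (\<integral>s. ?G s \<partial>?U) \<le> (\<integral>s. q (?G s) \<partial>?U)"
    proof (rule U.jensens_inequality[OF iG, where I = UNIV])
      show "integrable ?U (\<lambda>s. q (?G s))"
        by (intro continuous_imp_integrable_real continuous_on_compose2[OF q(2)] continuous_on_subset[OF cG]) auto
    qed (use q in auto)
    ultimately show ?thesis by (simp add: F_def)
  qed
  have "(\<integral>x. q (w (x + z) - w x) \<partial>torus) \<le> (\<integral>x. (\<integral>s. F x s \<partial>?U) \<partial>torus)"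
  proof (rule integral_mono[OF _ _ jensen])
    show "integrable torus (\<lambda>x. q (w (x + z) - w x))"
      by (intro integrable_torus_continuous continuous_on_compose2[OF q(2)] continuous_intros
          continuous_on_compose2[OF cw]) auto
    show "integrable torus (\<lambda>x. (\<integral>s. F x s \<partial>?U))" using D by (intro fub(2)) auto
  qed
  also have "\<dots> = (\<integral>s. (\<integral>x. F x s \<partial>torus) \<partial>?U)" using D by (intro fub(1)) auto
  also have "(\<lambda>s. \<integral>x. F x s \<partial>torus) = (\<lambda>s. \<integral>x. q (grad w x \<bullet> z) \<partial>torus)"
  proof
    fix s :: real
    have per: "periodic (partial_deriv i w)" for i
      using test_fun_periodic[OF test_fun_partial_deriv[OF w]] .
    have "periodic (\<lambda>x. q (grad w x \<bullet> z))"
      using per by (simp add: periodic_def grad_def)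
    then show "(\<integral>x. F x s \<partial>torus) = (\<integral>x. q (grad w x \<bullet> z) \<partial>torus)"
      unfolding F_def
      by (intro periodic_integral_shift[where p = "\<lambda>x. q (grad w x \<bullet> z)"] continuous_on_compose2[OF q(2)]
          continuous_intros cg) auto
  qed
  finally show ?thesis using U.prob_space by simp
qed

text \<open>Jensen's inequality for the probability density \<open>\<rho>\<close>, followed by the
  translation estimate for the shift \<open>- z\<close>. A general convex \<open>q\<close> serves
  two purposes: the absolute value gives a convergence rate in L1, the square a Poincare-type
  estimate in L2.\<close>

lemma averaging_estimate:
  fixes w :: "real ^ 'n \<Rightarrow> real" and a b :: "real ^ 'n"
  defines "M \<equiv> lebesgue_on (cbox a b)"
  assumes w: "test_fun w" and q: "convex_on UNIV q" "continuous_on UNIV q"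
    and \<rho>: "continuous_on UNIV \<rho>" "\<And>z. 0 \<le> \<rho> z" "(\<integral>z. \<rho> z \<partial>M) = 1"
    and h: "continuous_on UNIV h" "\<And>z. (\<integral>x. q (grad w x \<bullet> z) \<partial>torus) \<le> h z"
  shows "(\<integral>x. q (\<integral>z. \<rho> z * (w (x - z) - w x) \<partial>M) \<partial>torus) \<le> (\<integral>z. \<rho> z * h (- z) \<partial>M)"
proof -
  let ?\<nu> = "density M (\<lambda>z. ennreal (\<rho> z))"
  have cw: "continuous_on UNIV w" by (rule test_fun_continuous_on[OF w])
  have iM: "integrable M f" if "continuous_on UNIV f" for f :: "real ^ 'n \<Rightarrow> real"
    using that unfolding M_def by (intro continuous_imp_integrable) (auto intro: continuous_on_subset)
  have [measurable]: "\<rho> \<in> borel_measurable M" using iM[OF \<rho>(1)] by simp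
  have sp: "space M = cbox a b" by (simp add: M_def)
  have P: "prob_space ?\<nu>"
  proof (rule prob_spaceI)
    have "emeasure ?\<nu> (space ?\<nu>) = (\<integral>\<^sup>+z. ennreal (\<rho> z) \<partial>M)"
      by (subst emeasure_density) (auto intro!: nn_integral_cong)
    also have "\<dots> = 1" using nn_integral_eq_integral[OF iM[OF \<rho>(1)]] \<rho> by simp
    finally show "emeasure ?\<nu> (space ?\<nu>) = 1" .
  qed
  then interpret \<nu>: prob_space ?\<nu> .
  have idM: "(\<lambda>x. x) \<in> borel_measurable M" unfolding M_def by (rule id_borel_lebesgue_on)
  have idnu: "(\<lambda>x. x) \<in> borel_measurable ?\<nu>" using idM by simp
  have dens: "(\<integral>z. f z \<partial>?\<nu>) = (\<integral>z. \<rho> z * f z \<partial>M)" if "continuous_on UNIV f" for f :: "real ^ 'n \<Rightarrow> real"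
    using iM[OF that] \<rho> by (subst integral_density) auto
  have inu: "integrable ?\<nu> f" if "continuous_on UNIV f" for f :: "real ^ 'n \<Rightarrow> real"
    using iM[OF that] \<rho> iM[OF continuous_on_mult[OF \<rho>(1) that]] by (subst integrable_density) auto
  define F where "F x z = q (w (x - z) - w x)" for x z
  have cF: "continuous_on UNIV (\<lambda>p. F (fst p) (snd p))"
    unfolding F_def
    by (intro continuous_on_compose2[OF q(2)] continuous_intros continuous_on_compose2[OF cw]) auto
  obtain D where D: "\<And>x z. x \<in> cbox 0 1 \<Longrightarrow> z \<in> cbox a b \<Longrightarrow> \<bar>F x z\<bar> \<le> D"
    using continuous_Times_bounded[OF cF compact_cbox compact_cbox] by metis
  note fub = Fubini_continuous[OF torus_prob_space P id_borel_lebesgue_on idnu cF, of D]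
  have c1: "continuous_on UNIV (\<lambda>z. w (x - z) - w x)" for x
    by (intro continuous_intros continuous_on_compose2[OF cw]) auto
  have c2: "continuous_on UNIV (\<lambda>z. F x z)" for x
    unfolding F_def by (intro continuous_on_compose2[OF q(2)] c1) auto
  have jensen: "q (\<integral>z. \<rho> z * (w (x - z) - w x) \<partial>M) \<le> (\<integral>z. F x z \<partial>?\<nu>)" for x
    unfolding dens[OF c1, symmetric] F_def
    using inu[OF c2] q(1) by (intro \<nu>.jensens_inequality[OF inu[OF c1], where I = UNIV]) (auto simp: F_def)
  have "(\<integral>x. q (\<integral>z. \<rho> z * (w (x - z) - w x) \<partial>M) \<partial>torus) \<le> (\<integral>x. (\<integral>z. F x z \<partial>?\<nu>) \<partial>torus)"
  proof (cases "integrable torus (\<lambda>x. q (\<integral>z. \<rho> z * (w (x - z) - w x) \<partial>M))")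
    case True
    then show ?thesis using D by (intro integral_mono[OF _ _ jensen] fub(2)) (auto simp: sp)
  next
    \<comment> \<open>This case cannot occur: the averages are measurable and bounded, and the
      continuous \<open>q\<close> is bounded on their range, so the integrand is integrable after
      all.\<close>
    case False
    define G where "G x z = w (x - z) - w x" for x z
    have cG: "continuous_on UNIV (\<lambda>p. G (fst p) (snd p))"
      unfolding G_def by (intro continuous_intros continuous_on_compose2[OF cw]) auto
    obtain E where E: "\<And>x z. x \<in> cbox 0 1 \<Longrightarrow> z \<in> cbox a b \<Longrightarrow> \<bar>G x z\<bar> \<le> E"
      using continuous_Times_bounded[OF cG compact_cbox compact_cbox] by metis
    have "integrable torus (\<lambda>x. \<integral>z. G x z \<partial>?\<nu>)"
      using E by (intro Fubini_continuous(2)[OF torus_prob_space P id_borel_lebesgue_on idnu cG, of E]) (auto simp: sp)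
    then have m: "(\<lambda>x. \<integral>z. G x z \<partial>?\<nu>) \<in> borel_measurable torus" by simp
    have le: "\<bar>\<integral>z. G x z \<partial>?\<nu>\<bar> \<le> E" if "x \<in> cbox 0 1" for x
    proof -
      have "\<bar>\<integral>z. G x z \<partial>?\<nu>\<bar> \<le> (\<integral>z. \<bar>G x z\<bar> \<partial>?\<nu>)" by (rule integral_abs_bound)
      also have "\<dots> \<le> (\<integral>z. E \<partial>?\<nu>)"
        using E[OF that] inu[OF c1[of x]] by (intro integral_mono) (auto simp: sp G_def)
      finally show ?thesis using \<nu>.prob_space by simp
    qed
    have "bounded (q ` {-E..E})"
      using q(2) by (intro compact_imp_bounded compact_continuous_image) (auto intro: continuous_on_subset)
    then obtain K where K0: "\<And>y. y \<in> q ` {-E..E} \<Longrightarrow> norm y \<le> K"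
      unfolding bounded_iff by blast
    have K: "\<bar>q t\<bar> \<le> K" if "\<bar>t\<bar> \<le> E" for t
    proof -
      have "t \<in> {-E..E}" using that by auto
      then show ?thesis using K0[of "q t"] by simp
    qed
    have "integrable torus (\<lambda>x. q (\<integral>z. G x z \<partial>?\<nu>))"
    proof (rule torus.integrable_const_bound[of _ K])
      show "AE x in torus. norm (q (\<integral>z. G x z \<partial>?\<nu>)) \<le> K"
        using K le by (intro AE_I2) auto
      show "(\<lambda>x. q (\<integral>z. G x z \<partial>?\<nu>)) \<in> borel_measurable torus"
        by (rule measurable_compose[OF m borel_measurable_continuous_onI[OF q(2)]])
    qed
    with False show ?thesis by (simp add: G_def dens[OF c1])
  qed
  also have "\<dots> = (\<integral>z. (\<integral>x. F x z \<partial>torus) \<partial>?\<nu>)" using D by (intro fub(1)) (auto simp: sp)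
  also have "\<dots> \<le> (\<integral>z. h (- z) \<partial>?\<nu>)"
  proof (rule integral_mono)
    show "integrable ?\<nu> (\<lambda>z. \<integral>x. F x z \<partial>torus)" using D by (intro fub(3)) (auto simp: sp)
    show "integrable ?\<nu> (\<lambda>z. h (- z))"
      by (intro inu continuous_on_compose2[OF h(1)] continuous_intros) auto
    show "(\<integral>x. F x z \<partial>torus) \<le> h (- z)" for z
      using order_trans[OF translation_estimate[OF w q] h(2), of "- z"] by (simp add: F_def)
  qed
  also have "\<dots> = (\<integral>z. \<rho> z * h (- z) \<partial>M)"
    by (intro dens continuous_on_compose2[OF h(1)] continuous_intros) auto
  finally show ?thesis .
qed

text \<open>A subsequence converges almost everywhere; Fatou's lemma turns the Cauchy estimate into
  an estimate of the distance to the pointwise limit of that subsequence.\<close>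

lemma L1_complete:
  fixes s :: "nat \<Rightarrow> 'a \<Rightarrow> 'b::{banach, second_countable_topology}"
  assumes s[measurable]: "\<And>n. integrable M (s n)"
    and cauchy: "\<And>e. e > 0 \<Longrightarrow> \<exists>N. \<forall>i\<ge>N. \<forall>j\<ge>N. (\<integral>x. norm (s i x - s j x) \<partial>M) < e"
  obtains f where "integrable M f" "(\<lambda>n. \<integral>x. norm (s n x - f x) \<partial>M) \<longlonglongrightarrow> 0"
proof -
  obtain r where r: "strict_mono r" "AE x in M. Cauchy (\<lambda>i. s (r i) x)"
    using cauchy_L1_AE_cauchy_subseq[OF s cauchy] by metis
  define f where "f x = lim (\<lambda>i. s (r i) x)" for x
  have [measurable]: "f \<in> borel_measurable M"
    unfolding f_def by (rule borel_measurable_lim_metric) simp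
  have lim: "AE x in M. (\<lambda>i. s (r i) x) \<longlonglongrightarrow> f x"
    using r(2) unfolding f_def by eventually_elim (simp add: Cauchy_convergent_iff convergent_LIMSEQ_iff)
  have bound: "(\<integral>\<^sup>+x. ennreal (norm (s i x - f x)) \<partial>M) \<le> ennreal e"
    if N: "\<forall>i\<ge>N. \<forall>j\<ge>N. (\<integral>x. norm (s i x - s j x) \<partial>M) < e" and "i \<ge> N" for N i e
  proof -
    have "(\<integral>\<^sup>+x. ennreal (norm (s i x - f x)) \<partial>M) = (\<integral>\<^sup>+x. liminf (\<lambda>j. ennreal (norm (s i x - s (r j) x))) \<partial>M)"
    proof (rule nn_integral_cong_AE)
      show "AE x in M. ennreal (norm (s i x - f x)) = liminf (\<lambda>j. ennreal (norm (s i x - s (r j) x)))"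
        using lim
      proof eventually_elim
        case (elim x)
        then have "(\<lambda>j. ennreal (norm (s i x - s (r j) x))) \<longlonglongrightarrow> ennreal (norm (s i x - f x))"
          by (intro tendsto_ennrealI tendsto_intros)
        then show ?case by (intro lim_imp_Liminf[symmetric]) auto
      qed
    qed
    also have "\<dots> \<le> liminf (\<lambda>j. \<integral>\<^sup>+x. ennreal (norm (s i x - s (r j) x)) \<partial>M)"
      by (rule nn_integral_liminf) simp
    also have "\<dots> \<le> liminf (\<lambda>j. ennreal e)"
    proof (rule Liminf_mono)
      show "\<forall>\<^sub>F j in sequentially. (\<integral>\<^sup>+x. ennreal (norm (s i x - s (r j) x)) \<partial>M) \<le> ennreal e"
        unfolding eventually_sequentially
      proof (intro exI[of _ N] allI impI)
        fix j assume "N \<le> j"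
        then have "r j \<ge> N" using seq_suble[OF r(1), of j] by linarith
        then have "(\<integral>x. norm (s i x - s (r j) x) \<partial>M) < e" using N \<open>i \<ge> N\<close> by blast
        moreover have "(\<integral>\<^sup>+x. ennreal (norm (s i x - s (r j) x)) \<partial>M) = ennreal (\<integral>x. norm (s i x - s (r j) x) \<partial>M)"
          using s by (intro nn_integral_eq_integral) auto
        ultimately show "(\<integral>\<^sup>+x. ennreal (norm (s i x - s (r j) x)) \<partial>M) \<le> ennreal e"
          by (simp add: ennreal_leI)
      qed
    qed
    also have "\<dots> = ennreal e" by (simp add: Liminf_const)
    finally show ?thesis .
  qed
  have int: "integrable M f"
  proof -
    obtain N where N: "\<forall>i\<ge>N. \<forall>j\<ge>N. (\<integral>x. norm (s i x - s j x) \<partial>M) < 1" using cauchy[of 1] by auto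
    have "integrable M (\<lambda>x. s N x - f x)"
      using bound[OF N order_refl] by (intro integrableI_bounded) (auto simp: less_top[symmetric] top_unique)
    with s have "integrable M (\<lambda>x. s N x - (s N x - f x))" by (rule Bochner_Integration.integrable_diff)
    moreover have "(\<lambda>x. s N x - (s N x - f x)) = f" by simp
    ultimately show ?thesis by (simp only:)
  qed
  have "(\<lambda>n. \<integral>x. norm (s n x - f x) \<partial>M) \<longlonglongrightarrow> 0"
  proof (rule LIMSEQ_I)
    fix e :: real assume "0 < e"
    then obtain N where N: "\<forall>i\<ge>N. \<forall>j\<ge>N. (\<integral>x. norm (s i x - s j x) \<partial>M) < e/2" using cauchy[of "e/2"] by auto
    have "norm ((\<integral>x. norm (s n x - f x) \<partial>M) - 0) < e" if "n \<ge> N" for n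
    proof -
      have "ennreal (\<integral>x. norm (s n x - f x) \<partial>M) \<le> ennreal (e/2)"
        using bound[OF N that] int s by (subst nn_integral_eq_integral[symmetric]) auto
      then have "(\<integral>x. norm (s n x - f x) \<partial>M) \<le> e/2" using \<open>0 < e\<close> by (simp add: ennreal_le_iff)
      then show ?thesis using \<open>0 < e\<close> by simp
    qed
    then show "\<exists>no. \<forall>n\<ge>no. norm ((\<integral>x. norm (s n x - f x) \<partial>M) - 0) < e" by blast
  qed
  with int show thesis by (rule that)
qed

section \<open>Compactness of bounded sets of BV functions\<close>

text \<open>Each value \<open>smooth N f x\<close> is an integral of \<open>f\<close> against a test
  function and so vanishes, while the smoothings converge to \<open>f\<close> in L1.\<close>

lemma fundamental_lemma:
  fixes f :: "real ^ 'n \<Rightarrow> real"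
  assumes f: "integrable torus f" and 0: "\<And>\<phi>. test_fun \<phi> \<Longrightarrow> (\<integral>x. f x * \<phi> x \<partial>torus) = 0"
  shows "AE x in torus. f x = 0"
proof -
  have "smooth N f x = 0" for N x
    using 0[OF test_fun_kern(2)] by (simp add: smooth_def mult.commute)
  then have "(\<lambda>N::nat. \<integral>x. \<bar>f x\<bar> \<partial>torus) \<longlonglongrightarrow> 0"
    using smooth_tendsto_L1[OF f] by simp
  then have "(\<integral>x. \<bar>f x\<bar> \<partial>torus) = 0" by (simp add: LIMSEQ_const_iff)
  then show ?thesis
    using integral_nonneg_eq_0_iff_AE[of torus "\<lambda>x. \<bar>f x\<bar>"] f by simp
qed

abbreviation centered :: "(real ^ 'n) measure" where
  "centered \<equiv> lebesgue_on (cbox (- (1/2) *\<^sub>R 1) ((1/2) *\<^sub>R 1))"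

text \<open>The mean distance from the origin under the kernel, which becomes the rate of L1
  approximation for functions of bounded variation. The \<open>itself\<close> argument carries the
  dimension.\<close>

definition kern_moment :: "'n::finite itself \<Rightarrow> nat \<Rightarrow> real" where
  "kern_moment _ N = (\<integral>z. kern N z * norm z \<partial>(centered :: (real ^ 'n) measure))"

text \<open>Laplace concentration with \<open>d = norm\<close>: coordinates in the closed centred
  cube are at most 1/2 in modulus, so the maximum is attained at the origin alone.\<close>

lemma kern_moment_tendsto: "kern_moment TYPE('n::finite) \<longlonglongrightarrow> 0"
proof -
  let ?a = "- (1/2) *\<^sub>R 1 :: real ^ 'n" and ?b = "(1/2) *\<^sub>R 1 :: real ^ 'n"
  have "(\<lambda>N. (\<integral>z. peak z ^ N * norm z \<partial>(centered :: (real ^ 'n) measure)) /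
      (\<integral>z. peak z ^ N \<partial>(centered :: (real ^ 'n) measure))) \<longlonglongrightarrow> 0"
  proof (rule laplace_concentration(1)[where m = "2 * real CARD('n)" and ?x0.0 = 0])
    show "0 \<in> cbox ?a ?b" by (auto simp: mem_box_cart)
    have "(0 :: real ^ 'n) \<in> box ?a ?b" by (auto simp: mem_box_cart)
    then show "box ?a ?b \<noteq> {}" by blast
    fix z assume z: "z \<in> cbox ?a ?b" "peak z = 2 * real CARD('n)"
    have "z $ i = 0" for i
    proof (rule cos_2pi_eq_1_iff_0)
      show "cos (2 * pi * (z $ i)) = 1" by (rule peak_maxD[OF z(2)])
      have "- (1/2) \<le> z $ i" "z $ i \<le> 1/2" using z(1) by (simp_all add: mem_box_cart)
      then show "\<bar>z $ i\<bar> < 1" by linarith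
    qed
    then have "z = 0" by (simp add: vec_eq_iff)
    then show "norm z = 0" by simp
  qed (auto intro!: continuous_on_peak continuous_intros simp: peak_nonneg peak_le peak_0)
  moreover have "(\<integral>z. peak z ^ N \<partial>(centered :: (real ^ 'n) measure)) = (\<integral>z. peak (z :: real ^ 'n) ^ N \<partial>torus)" for N
    using periodic_peak[where 'n = 'n]
    by (intro periodic_integral_centered continuous_intros continuous_on_peak) (auto simp: periodic_def)
  moreover have "kern_moment TYPE('n) = (\<lambda>N. \<integral>z. kern N z * norm z \<partial>(centered :: (real ^ 'n) measure))"
    by (simp add: kern_moment_def fun_eq_iff)
  ultimately show ?thesis by (simp add: kern_def)
qed

text \<open>On the centred cube \<open>smooth N w x - w x\<close> is a kernel average of increments
  of \<open>w\<close>, and an increment by \<open>z\<close> costs \<open>norm z\<close> times the L1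
  norm of the gradient.\<close>

lemma smooth_rate:
  fixes w :: "real ^ 'n \<Rightarrow> real"
  assumes w: "test_fun w"
  shows "(\<integral>x. \<bar>smooth N w x - w x\<bar> \<partial>torus) \<le> kern_moment TYPE('n) N * (\<integral>x. norm (grad w x) \<partial>torus)"
proof -
  let ?G = "\<integral>x. norm (grad w x) \<partial>torus"
  have cw: "continuous_on UNIV w" by (rule test_fun_continuous_on[OF w])
  have cg: "continuous_on UNIV (grad w)" by (rule continuous_on_grad[OF w])
  have rep: "(\<integral>z. kern N z * (w (x - z) - w x) \<partial>centered) = smooth N w x - w x" for x
  proof -
    let ?p = "\<lambda>z. kern N z * (w (x - z) - w x)"
    have p: "continuous_on UNIV ?p" "periodic ?p"
    proof -
      show "continuous_on UNIV ?p"
        by (intro continuous_intros continuous_on_kern continuous_on_compose2[OF cw]) auto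
      have "w (x - (z + axis i 1)) = w (x - z)" for z i
        using test_fun_periodic[OF w, unfolded periodic_def, rule_format, of "x - (z + axis i 1)" i] by simp
      then show "periodic ?p" using periodic_kern[of N, where 'n = 'n] by (simp add: periodic_def)
    qed
    have "(\<integral>z. ?p z \<partial>centered) = (\<integral>y. ?p y \<partial>torus)" by (rule periodic_integral_centered[OF p])
    also have "\<dots> = (\<integral>y. ?p (x - y) \<partial>torus)" by (rule periodic_integral_reflect[OF p, symmetric])
    also have "\<dots> = smooth N (\<lambda>y. w y - w x) x" by (simp add: smooth_def)
    also have "\<dots> = smooth N w x - w x"
      using integrable_test_fun[OF w] by (simp add: smooth_diff smooth_const)
    finally show ?thesis .
  qed
  have "(\<integral>x. \<bar>\<integral>z. kern N z * (w (x - z) - w x) \<partial>centered\<bar> \<partial>torus) \<le>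
      (\<integral>z. kern N z * (norm (- z) * ?G) \<partial>(centered :: (real ^ 'n) measure))"
  proof (rule averaging_estimate[OF w, where h = "\<lambda>z. norm z * ?G" and q = abs and \<rho> = "kern N"])
    show "convex_on UNIV (abs :: real \<Rightarrow> real)"
    proof (rule convex_onI)
      fix t x y :: real assume t: "0 < t" "t < 1"
      show "\<bar>(1 - t) *\<^sub>R x + t *\<^sub>R y\<bar> \<le> (1 - t) * \<bar>x\<bar> + t * \<bar>y\<bar>"
        using abs_triangle_ineq[of "(1 - t) * x" "t * y"] t by (simp add: abs_mult)
    qed simp
    have "(\<integral>z. kern N z \<partial>(centered :: (real ^ 'n) measure)) = (\<integral>z. kern N (z :: real ^ 'n) \<partial>torus)"
      by (intro periodic_integral_centered continuous_on_kern continuous_on_id periodic_kern)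
    also have "\<dots> = 1"
      using integral_peak_power_pos[of N, where 'n = 'n] by (simp add: kern_def)
    finally show "(\<integral>z. kern N z \<partial>(centered :: (real ^ 'n) measure)) = 1" .
    fix z :: "real ^ 'n"
    have "(\<integral>x. \<bar>grad w x \<bullet> z\<bar> \<partial>torus) \<le> (\<integral>x. norm z * norm (grad w x) \<partial>torus)"
    proof (rule integral_mono)
      show "\<bar>grad w x \<bullet> z\<bar> \<le> norm z * norm (grad w x)" for x
        using Cauchy_Schwarz_ineq2[of "grad w x" z] by (simp add: mult.commute)
    qed (intro integrable_torus_continuous continuous_intros continuous_on_subset[OF cg], simp)+
    then show "(\<integral>x. \<bar>grad w x \<bullet> z\<bar> \<partial>torus) \<le> norm z * ?G" by simp
  qed (auto intro!: continuous_intros continuous_on_kern simp: kern_nonneg)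
  also have "\<dots> = kern_moment TYPE('n) N * ?G"
    unfolding kern_moment_def by (simp flip: mult.assoc)
  finally show ?thesis by (simp only: rep)
qed

text \<open>Scalar bounded variation, one coordinate derivative at a time. Sobolev functions and the
  components of BV fields both satisfy it, so one compactness theorem serves the powers of the
  density and the fluxes.\<close>

definition bv_bound :: "real \<Rightarrow> (real ^ 'n \<Rightarrow> real) \<Rightarrow> bool" where
  "bv_bound C f \<longleftrightarrow> integrable torus f \<and> (\<integral>x. \<bar>f x\<bar> \<partial>torus) \<le> C \<and>
     (\<forall>i \<phi>. test_fun \<phi> \<and> (\<forall>x. \<bar>\<phi> x\<bar> \<le> 1) \<longrightarrow> \<bar>\<integral>x. f x * partial_deriv i \<phi> x \<partial>torus\<bar> \<le> C)"

text \<open>The L1 norm of the smoothed derivative is its pairing with its own sign. The sign is not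
  a test function, but the adjoint identity shifts the smoothing onto it, and a smoothed sign is a
  test function bounded by 1.\<close>

lemma bv_bound_smooth_partial:
  assumes "bv_bound C f"
  shows "(\<integral>x. \<bar>partial_deriv i (smooth N f) x\<bar> \<partial>torus) \<le> C"
proof -
  have f: "integrable torus f" using assms by (simp add: bv_bound_def)
  let ?d = "partial_deriv i (smooth N f)"
  have td: "test_fun ?d" by (intro test_fun_partial_deriv test_fun_smooth f)
  have [measurable]: "?d \<in> borel_measurable torus" using integrable_test_fun[OF td] by simp
  define s where "s x = sgn (?d x)" for x
  have ints: "integrable torus s"
    unfolding s_def by (rule torus.integrable_const_bound[of _ 1]) (auto simp: sgn_if)
  have "\<bar>smooth N s x\<bar> \<le> 1" for x
  proof -
    have "\<bar>smooth N s x\<bar> \<le> smooth N (\<lambda>x. \<bar>s x\<bar>) x" by (rule abs_smooth_le[OF ints])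
    also have "\<dots> \<le> smooth N (\<lambda>x. 1) x"
      by (intro smooth_mono AE_I2 integrable_abs ints) (auto simp: s_def sgn_if)
    finally show ?thesis by (simp add: smooth_const)
  qed
  then have "\<bar>\<integral>x. f x * partial_deriv i (smooth N s) x \<partial>torus\<bar> \<le> C"
    using assms test_fun_smooth[OF ints, of N] by (simp add: bv_bound_def)
  moreover have "(\<integral>x. \<bar>?d x\<bar> \<partial>torus) = (\<integral>x. ?d x * s x \<partial>torus)"
    by (intro Bochner_Integration.integral_cong) (auto simp: s_def abs_sgn)
  ultimately show ?thesis using partial_deriv_smooth_adjoint[OF f ints, of i N] by simp
qed

text \<open>The rate holds for \<open>smooth N f\<close>, whose derivatives have L1 norm at most
  \<open>C\<close> for every \<open>N\<close>; then \<open>N\<close> tends to infinity with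
  \<open>M\<close> fixed. The factor \<open>CARD('n)\<close> comes from bounding the Euclidean norm
  of the gradient by the sum of its components.\<close>

lemma bv_bound_smooth_rate:
  fixes f :: "real ^ 'n \<Rightarrow> real" and C :: real
  assumes bv: "bv_bound C f"
  shows "(\<integral>x. \<bar>smooth M f x - f x\<bar> \<partial>torus) \<le> kern_moment TYPE('n) M * (CARD('n) * C)"
proof -
  have f: "integrable torus f" using assms by (simp add: bv_bound_def)
  have km: "0 \<le> kern_moment TYPE('n) M"
    unfolding kern_moment_def by (intro Bochner_Integration.integral_nonneg) (simp add: kern_nonneg)
  have rate: "(\<integral>x. \<bar>smooth M (smooth N f) x - smooth N f x\<bar> \<partial>torus) \<le> kern_moment TYPE('n) M * (CARD('n) * C)" for N
  proof -
    have t: "test_fun (smooth N f)" by (rule test_fun_smooth[OF f])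
    have ip: "integrable torus (\<lambda>x. \<bar>partial_deriv i (smooth N f) x\<bar>)" for i
      by (intro integrable_abs integrable_test_fun test_fun_partial_deriv t)
    have "(\<integral>x. norm (grad (smooth N f) x) \<partial>torus) \<le> (\<integral>x. (\<Sum>i\<in>UNIV. \<bar>partial_deriv i (smooth N f) x\<bar>) \<partial>torus)"
    proof (rule integral_mono)
      show "integrable torus (\<lambda>x. norm (grad (smooth N f) x))"
        by (intro integrable_torus_continuous continuous_intros continuous_on_grad t)
      show "norm (grad (smooth N f) x) \<le> (\<Sum>i\<in>UNIV. \<bar>partial_deriv i (smooth N f) x\<bar>)" for x
        using norm_le_l1_cart[of "grad (smooth N f) x"] by (simp add: grad_def)
    qed (use ip in simp)
    also have "\<dots> = (\<Sum>i\<in>UNIV. (\<integral>x. \<bar>partial_deriv i (smooth N f) x\<bar> \<partial>torus))"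
      using ip by simp
    also have "\<dots> \<le> (\<Sum>i\<in>(UNIV :: 'n set). C)" by (intro sum_mono bv_bound_smooth_partial[OF bv])
    finally have "(\<integral>x. norm (grad (smooth N f) x) \<partial>torus) \<le> CARD('n) * C" by simp
    with km smooth_rate[OF t, of M] show ?thesis
      by (meson mult_left_mono order_trans)
  qed
  have le: "(\<integral>x. \<bar>smooth M f x - f x\<bar> \<partial>torus) \<le>
      kern_moment TYPE('n) M * (CARD('n) * C) + 2 * (\<integral>x. \<bar>smooth N f x - f x\<bar> \<partial>torus)" for N
  proof -
    have i1: "integrable torus (smooth N f)" "integrable torus (smooth M f)"
      by (intro integrable_test_fun test_fun_smooth f)+
    let ?d = "\<lambda>x. smooth N f x - f x"
    have d: "integrable torus ?d" using i1 f by simp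
    have i2: "integrable torus (smooth M ?d)" "integrable torus (smooth M (smooth N f))"
      by (intro integrable_test_fun test_fun_smooth d i1)+
    have "(\<integral>x. \<bar>smooth M f x - f x\<bar> \<partial>torus) \<le>
        (\<integral>x. \<bar>smooth M (smooth N f) x - smooth N f x\<bar> + (\<bar>smooth M ?d x\<bar> + \<bar>?d x\<bar>) \<partial>torus)"
    proof (rule integral_mono)
      show "\<bar>smooth M f x - f x\<bar> \<le> \<bar>smooth M (smooth N f) x - smooth N f x\<bar> + (\<bar>smooth M ?d x\<bar> + \<bar>?d x\<bar>)" for x
        using smooth_diff[OF i1(1) f, of M x] by linarith
      show "integrable torus (\<lambda>x. \<bar>smooth M f x - f x\<bar>)"
        by (intro integrable_abs Bochner_Integration.integrable_diff i1 f)
      show "integrable torus (\<lambda>x. \<bar>smooth M (smooth N f) x - smooth N f x\<bar> + (\<bar>smooth M ?d x\<bar> + \<bar>?d x\<bar>))"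
        by (intro integrable_abs Bochner_Integration.integrable_diff Bochner_Integration.integrable_add i1 i2 f)
    qed
    also have "\<dots> = (\<integral>x. \<bar>smooth M (smooth N f) x - smooth N f x\<bar> \<partial>torus) +
        ((\<integral>x. \<bar>smooth M ?d x\<bar> \<partial>torus) + (\<integral>x. \<bar>?d x\<bar> \<partial>torus))"
      using i1 i2 d f by simp
    finally show ?thesis using rate[of N] smooth_L1_contraction[OF d, of M] by linarith
  qed
  have "(\<lambda>N. kern_moment TYPE('n) M * (CARD('n) * C) + 2 * (\<integral>x. \<bar>smooth N f x - f x\<bar> \<partial>torus))
      \<longlonglongrightarrow> kern_moment TYPE('n) M * (CARD('n) * C) + 2 * 0"
    by (intro tendsto_intros smooth_tendsto_L1 f)
  then show ?thesis using le by (intro LIMSEQ_le_const) auto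
qed

text \<open>Smoothing of a high order is uniformly close to the identity on the bounded set and
  depends on finitely many coefficients. Once all coefficients converge, the sequence is Cauchy in
  L1.\<close>

lemma bv_compact:
  fixes f :: "nat \<Rightarrow> real ^ 'n \<Rightarrow> real" and C :: real
  assumes bv: "\<And>k. bv_bound C (f k)"
  obtains r g where "strict_mono r" "integrable torus g" "(\<lambda>k. \<integral>x. \<bar>f (r k) x - g x\<bar> \<partial>torus) \<longlonglongrightarrow> 0"
proof -
  have f: "integrable torus (f k)" and fC: "(\<integral>x. \<bar>f k x\<bar> \<partial>torus) \<le> C" for k
    using bv by (auto simp: bv_bound_def)
  have "0 \<le> (\<integral>x. \<bar>f 0 x\<bar> \<partial>torus)" by simp
  with fC[of 0] have C: "0 \<le> C" by linarith
  define sep where "sep N J a b \<longleftrightarrow> (\<forall>j<J::nat. test_fun (a j) \<and> test_fun (b j)) \<and>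
      (\<forall>x y :: real ^ 'n. kern N (x - y) = (\<Sum>j<J. a j x * b j y))" for N J a b
  have "\<exists>J a b. sep N J a b" for N
    unfolding sep_def by (rule kern_separableE[of N]) blast
  then obtain J a b where "\<And>N. sep N (J N) (a N) (b N)" by metis
  then have sep: "\<And>N j. j < J N \<Longrightarrow> test_fun (a N j)" "\<And>N j. j < J N \<Longrightarrow> test_fun (b N j)"
    "\<And>N x y. kern N (x - y :: real ^ 'n) = (\<Sum>j<J N. a N j x * b N j y)"
    by (auto simp: sep_def)
  \<comment> \<open>\<open>S\<close> indexes the coefficients for all orders of smoothing. It is
    countable, so a single diagonal subsequence makes every coefficient converge.\<close>
  define S where "S = (SIGMA N:UNIV. {..<J N})"
  define c where "c k = (\<lambda>(N, j). \<integral>x. b N j x * f k x \<partial>torus)" for k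
  have "\<exists>D>0. \<forall>x\<in>cbox 0 1. \<bar>b N j x\<bar> \<le> D" if "(N, j) \<in> S" for N j
  proof -
    have "continuous_on UNIV (b N j)" using that by (auto simp: S_def intro: test_fun_continuous_on sep)
    then obtain D where "0 < D" "\<And>x. x \<in> cbox 0 1 \<Longrightarrow> norm (b N j x) \<le> D"
      using continuous_torus_bounded by blast
    then show ?thesis by auto
  qed
  then have "\<forall>p\<in>S. \<exists>D>0. \<forall>x\<in>cbox 0 1. \<bar>b (fst p) (snd p) x\<bar> \<le> D" by auto
  from bchoice[OF this] obtain D where D': "\<forall>p\<in>S. 0 < D p \<and> (\<forall>x\<in>cbox 0 1. \<bar>b (fst p) (snd p) x\<bar> \<le> D p)"
    by blast
  have D: "D (N, j) > 0" "x \<in> cbox 0 1 \<Longrightarrow> \<bar>b N j x\<bar> \<le> D (N, j)" if "(N, j) \<in> S" for N j x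
    using D' that by force+
  \<comment> \<open>Each coefficient is divided by a bound of its test function, because the
    diagonal argument asks for one bound for all indices.\<close>
  have bound: "norm (c k p / D p) \<le> C" if "p \<in> S" for k p
  proof -
    obtain N j where p: "p = (N, j)" by fastforce
    have tb: "test_fun (b N j)" using that p sep by (auto simp: S_def)
    have ib: "integrable torus (\<lambda>x. b N j x * f k x)"
      by (intro integrable_continuous_mult(1) f test_fun_continuous_on tb)
    have "\<bar>c k p\<bar> \<le> (\<integral>x. \<bar>b N j x * f k x\<bar> \<partial>torus)"
      using integral_abs_bound[of torus "\<lambda>x. b N j x * f k x"] by (simp add: c_def p)
    also have "\<dots> \<le> (\<integral>x. D p * \<bar>f k x\<bar> \<partial>torus)"
      using D(2)[of N j] that p f[of k]
      by (intro integral_mono integrable_abs[OF ib]) (auto simp: abs_mult intro!: mult_right_mono)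
    also have "\<dots> \<le> D p * C" using fC[of k] D(1)[of N j] that p by (auto intro!: mult_left_mono)
    finally show ?thesis using D(1)[of N j] that p by (simp add: pos_divide_le_eq mult.commute)
  qed
  have "countable S" by simp
  with bound obtain r where r: "strict_mono r" "\<And>p. p \<in> S \<Longrightarrow> \<exists>l. (\<lambda>n. c (r n) p / D p) \<longlonglongrightarrow> l"
    using function_convergent_subsequence[OF \<open>countable S\<close>, of "\<lambda>k p. c k p / D p" C] by blast
  have conv: "Cauchy (\<lambda>n. c (r n) p)" if p: "p \<in> S" for p
  proof -
    obtain l where "(\<lambda>n. c (r n) p / D p) \<longlonglongrightarrow> l" using r(2)[OF p] by blast
    then have "(\<lambda>n. c (r n) p / D p * D p) \<longlonglongrightarrow> l * D p" by (intro tendsto_intros)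
    moreover have "c (r n) p / D p * D p = c (r n) p" for n using D(1) p by (cases p) force
    ultimately have "(\<lambda>n. c (r n) p) \<longlonglongrightarrow> l * D p" by simp
    then show ?thesis by (rule LIMSEQ_imp_Cauchy)
  qed
  have "\<exists>n0. \<forall>i\<ge>n0. \<forall>j\<ge>n0. (\<integral>x. norm (f (r i) x - f (r j) x) \<partial>torus) < e" if e: "0 < e" for e
  proof -
    have "(\<lambda>M. kern_moment TYPE('n) M * (CARD('n) * C)) \<longlonglongrightarrow> 0 * (CARD('n) * C)"
      by (intro tendsto_intros kern_moment_tendsto)
    then have "\<forall>\<^sub>F M in sequentially. kern_moment TYPE('n) M * (CARD('n) * C) < e/3"
      using e by (intro order_tendstoD(2)) auto
    then obtain M where M: "kern_moment TYPE('n) M * (CARD('n) * C) < e/3"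
      using eventually_happens'[OF sequentially_bot] by blast
    \<comment> \<open>If the coefficients are within \<open>e / (3 * (A + 1))\<close>, the smoothed
      functions are within \<open>e/3\<close> in L1. The added 1 keeps the quotient meaningful for
      \<open>A = 0\<close>.\<close>
    define A where "A = (\<Sum>l<J M. \<integral>x. \<bar>a M l x\<bar> \<partial>torus)"
    have A: "0 \<le> A" unfolding A_def by (intro sum_nonneg) simp
    have "\<exists>n0. \<forall>l<J M. \<forall>i\<ge>n0. \<forall>j\<ge>n0. \<bar>c (r i) (M, l) - c (r j) (M, l)\<bar> < e / (3 * (A + 1))"
    proof -
      have "\<exists>n0. \<forall>i\<ge>n0. \<forall>j\<ge>n0. \<bar>c (r i) (M, l) - c (r j) (M, l)\<bar> < e / (3 * (A + 1))" if "l < J M" for l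
        using CauchyD[OF conv[of "(M, l)"], of "e / (3 * (A + 1))"] that e A by (auto simp: S_def)
      then obtain n where n: "\<And>l i j. l < J M \<Longrightarrow> i \<ge> n l \<Longrightarrow> j \<ge> n l \<Longrightarrow> \<bar>c (r i) (M, l) - c (r j) (M, l)\<bar> < e / (3 * (A + 1))"
        by metis
      \<comment> \<open>The sum of the finitely many thresholds is a threshold for all of
        them.\<close>
      show ?thesis
      proof (intro exI[of _ "\<Sum>l<J M. n l"] allI impI)
        fix l i j assume l: "l < J M" and ij: "(\<Sum>l<J M. n l) \<le> i" "(\<Sum>l<J M. n l) \<le> j"
        have "n l \<le> (\<Sum>l<J M. n l)" using l by (intro member_le_sum) auto
        with ij show "\<bar>c (r i) (M, l) - c (r j) (M, l)\<bar> < e / (3 * (A + 1))" by (intro n l) linarith+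
      qed
    qed
    then obtain n0 where n0: "\<And>l i j. l < J M \<Longrightarrow> i \<ge> n0 \<Longrightarrow> j \<ge> n0 \<Longrightarrow> \<bar>c (r i) (M, l) - c (r j) (M, l)\<bar> < e / (3 * (A + 1))"
      by blast
    have "(\<integral>x. norm (f (r i) x - f (r j) x) \<partial>torus) < e" if ij: "i \<ge> n0" "j \<ge> n0" for i j
    proof -
      have ism: "integrable torus (smooth M (f k))" for k by (intro integrable_test_fun test_fun_smooth f)
      have sm: "smooth M (f k) x = (\<Sum>l<J M. a M l x * c k (M, l))" for k x
        using smooth_sum[OF sep(3) sep(2) f, of M k] by (simp add: c_def)
      have ia: "integrable torus (\<lambda>x. \<bar>a M l x\<bar>)" if "l < J M" for l
        by (intro integrable_abs integrable_test_fun sep that)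
      have "\<bar>smooth M (f (r i)) x - smooth M (f (r j)) x\<bar> \<le> (\<Sum>l<J M. \<bar>a M l x\<bar> * (e / (3 * (A + 1))))" for x
      proof -
        have "smooth M (f (r i)) x - smooth M (f (r j)) x = (\<Sum>l<J M. a M l x * (c (r i) (M, l) - c (r j) (M, l)))"
          by (simp add: sm sum_subtractf right_diff_distrib)
        also have "\<bar>\<dots>\<bar> \<le> (\<Sum>l<J M. \<bar>a M l x * (c (r i) (M, l) - c (r j) (M, l))\<bar>)" by (rule sum_abs)
        also have "\<dots> \<le> (\<Sum>l<J M. \<bar>a M l x\<bar> * (e / (3 * (A + 1))))"
          unfolding abs_mult using n0 ij by (intro sum_mono mult_left_mono[OF less_imp_le[OF n0]]) auto
        finally show ?thesis .
      qed
      then have "(\<integral>x. \<bar>smooth M (f (r i)) x - smooth M (f (r j)) x\<bar> \<partial>torus) \<le>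
          (\<integral>x. (\<Sum>l<J M. \<bar>a M l x\<bar> * (e / (3 * (A + 1)))) \<partial>torus)"
        using ism ia by (intro integral_mono) auto
      also have "\<dots> = A * (e / (3 * (A + 1)))"
        unfolding A_def sum_distrib_right using ia by simp
      also have "\<dots> \<le> e/3" using A e by (simp add: field_simps)
      finally have 1: "(\<integral>x. \<bar>smooth M (f (r i)) x - smooth M (f (r j)) x\<bar> \<partial>torus) \<le> e/3" .
      have "(\<integral>x. norm (f (r i) x - f (r j) x) \<partial>torus) \<le>
        (\<integral>x. \<bar>smooth M (f (r i)) x - f (r i) x\<bar> + (\<bar>smooth M (f (r i)) x - smooth M (f (r j)) x\<bar> + \<bar>smooth M (f (r j)) x - f (r j) x\<bar>) \<partial>torus)"
        using ism f by (intro integral_mono) auto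
      also have "\<dots> = (\<integral>x. \<bar>smooth M (f (r i)) x - f (r i) x\<bar> \<partial>torus) +
         ((\<integral>x. \<bar>smooth M (f (r i)) x - smooth M (f (r j)) x\<bar> \<partial>torus) + (\<integral>x. \<bar>smooth M (f (r j)) x - f (r j) x\<bar> \<partial>torus))"
        using ism f by simp
      finally show ?thesis
        using 1 M bv_bound_smooth_rate[OF bv, of M "r i"] bv_bound_smooth_rate[OF bv, of M "r j"] by linarith
    qed
    then show ?thesis by blast
  qed
  note cauchy = this
  show thesis
  proof (rule L1_complete[of torus "\<lambda>k. f (r k)"])
    show "integrable torus (f (r k))" for k by (rule f)
    show "\<exists>n0. \<forall>i\<ge>n0. \<forall>j\<ge>n0. (\<integral>x. norm (f (r i) x - f (r j) x) \<partial>torus) < e" if "0 < e" for e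
      using that by (rule cauchy)
    fix g assume "integrable torus g" "(\<lambda>k. \<integral>x. norm (f (r k) x - g x) \<partial>torus) \<longlonglongrightarrow> 0"
    with r(1) show thesis by (intro that) auto
  qed
qed

section \<open>Convergence theorems\<close>

lemma LIMSEQ_null_comparison:
  fixes f :: "nat \<Rightarrow> 'a::real_normed_vector"
  assumes "\<And>n. norm (f n) \<le> g n" "g \<longlonglongrightarrow> 0"
  shows "f \<longlonglongrightarrow> 0"
  using assms(1) by (intro Lim_null_comparison[OF always_eventually assms(2)] allI)

lemma fatou_real:
  fixes h :: "nat \<Rightarrow> 'a \<Rightarrow> real"
  assumes [measurable]: "\<And>n. integrable M (h n)" "g \<in> borel_measurable M"
    and pos: "\<And>n. AE x in M. 0 \<le> h n x" and lim: "AE x in M. (\<lambda>n. h n x) \<longlonglongrightarrow> g x"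
    and K: "\<And>n. (\<integral>x. h n x \<partial>M) \<le> K"
  shows "integrable M g" "(\<integral>x. g x \<partial>M) \<le> K"
proof -
  have "AE x in M. \<forall>n. 0 \<le> h n x" using pos by (simp add: AE_all_countable)
  with lim have g0: "AE x in M. 0 \<le> g x"
    by eventually_elim (auto intro: LIMSEQ_le_const)
  have "0 \<le> (\<integral>x. h 0 x \<partial>M)" using pos by (intro integral_nonneg_AE)
  with K[of 0] have K0: "0 \<le> K" by linarith
  have "(\<integral>\<^sup>+x. ennreal (g x) \<partial>M) = (\<integral>\<^sup>+x. liminf (\<lambda>n. ennreal (h n x)) \<partial>M)"
    using lim by (intro nn_integral_cong_AE, eventually_elim) (auto intro!: lim_imp_Liminf[symmetric] tendsto_ennrealI)
  also have "\<dots> \<le> liminf (\<lambda>n. \<integral>\<^sup>+x. ennreal (h n x) \<partial>M)" by (rule nn_integral_liminf) simp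
  also have "\<dots> \<le> liminf (\<lambda>n. ennreal K)"
    using K by (intro Liminf_mono always_eventually allI) (simp add: nn_integral_eq_integral[OF assms(1) pos] ennreal_leI)
  also have "\<dots> = ennreal K" by (simp add: Liminf_const)
  finally have le: "(\<integral>\<^sup>+x. ennreal (g x) \<partial>M) \<le> ennreal K" .
  show i: "integrable M g"
    using le g0 by (intro integrableI_nonneg) (auto simp: less_top[symmetric] top_unique)
  show "(\<integral>x. g x \<partial>M) \<le> K"
    using le K0 by (simp add: nn_integral_eq_integral[OF i g0] ennreal_le_iff)
qed

lemma L1_AE_subseq:
  fixes f :: "nat \<Rightarrow> 'a \<Rightarrow> 'b::{banach, second_countable_topology}"
  assumes "\<And>n. integrable M (f n)" "integrable M g" "(\<lambda>n. \<integral>x. norm (f n x - g x) \<partial>M) \<longlonglongrightarrow> 0"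
  obtains r where "strict_mono r" "AE x in M. (\<lambda>n. f (r n) x) \<longlonglongrightarrow> g x"
proof -
  have "\<exists>r::nat\<Rightarrow>nat. strict_mono r \<and> (AE x in M. (\<lambda>n. f (r n) x - g x) \<longlonglongrightarrow> 0)"
    using assms by (intro tendsto_L1_AE_subseq[of M "\<lambda>n x. f n x - g x"]) auto
  then show thesis using that by (simp add: LIM_zero_iff) blast
qed

lemma L1_limit_integral:
  fixes f :: "nat \<Rightarrow> 'a \<Rightarrow> 'b::{banach, second_countable_topology}"
  assumes f: "\<And>n. integrable M (f n)" "integrable M g" and lim: "(\<lambda>n. \<integral>x. norm (f n x - g x) \<partial>M) \<longlonglongrightarrow> 0"
    and [measurable]: "b \<in> borel_measurable M" and b: "AE x in M. \<bar>b x\<bar> \<le> D"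
  shows "(\<lambda>n. \<integral>x. b x *\<^sub>R f n x \<partial>M) \<longlonglongrightarrow> (\<integral>x. b x *\<^sub>R g x \<partial>M)"
proof -
  have i: "integrable M (\<lambda>x. b x *\<^sub>R f n x)" "integrable M (\<lambda>x. b x *\<^sub>R g x)" for n
    using f b by (auto intro: integrable_bounded_scaleR)
  have "norm ((\<integral>x. b x *\<^sub>R f n x \<partial>M) - (\<integral>x. b x *\<^sub>R g x \<partial>M)) \<le> D * (\<integral>x. norm (f n x - g x) \<partial>M)" for n
  proof -
    have "norm ((\<integral>x. b x *\<^sub>R f n x \<partial>M) - (\<integral>x. b x *\<^sub>R g x \<partial>M)) = norm (\<integral>x. b x *\<^sub>R (f n x - g x) \<partial>M)"
      using i by (simp add: scaleR_diff_right)
    also have "\<dots> \<le> (\<integral>x. norm (b x *\<^sub>R (f n x - g x)) \<partial>M)" by (rule integral_norm_bound)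
    also have "\<dots> \<le> (\<integral>x. D * norm (f n x - g x) \<partial>M)"
    proof (rule integral_mono_AE)
      show "integrable M (\<lambda>x. norm (b x *\<^sub>R (f n x - g x)))"
        using f b by (intro integrable_norm integrable_bounded_scaleR[where D = D]) auto
      show "integrable M (\<lambda>x. D * norm (f n x - g x))" using f by simp
      show "AE x in M. norm (b x *\<^sub>R (f n x - g x)) \<le> D * norm (f n x - g x)"
        using b by eventually_elim (auto intro: mult_right_mono)
    qed
    finally show ?thesis by simp
  qed
  moreover have "(\<lambda>n. D * (\<integral>x. norm (f n x - g x) \<partial>M)) \<longlonglongrightarrow> 0"
    using tendsto_mult_left[OF lim, of D] by simp
  ultimately have "(\<lambda>n. (\<integral>x. b x *\<^sub>R f n x \<partial>M) - (\<integral>x. b x *\<^sub>R g x \<partial>M)) \<longlonglongrightarrow> 0"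
    by (rule LIMSEQ_null_comparison)
  then show ?thesis by (rule LIM_zero_cancel)
qed

text \<open>The sequence is uniformly integrable because the part of \<open>f k\<close>
  above a large constant is at most a small multiple of an \<open>L\<^sup>1\<close>-bounded sequence.\<close>

lemma vitali_convergence:
  fixes f :: "nat \<Rightarrow> 'a \<Rightarrow> 'b::{banach, second_countable_topology}"
  assumes "finite_measure M"
    and f: "\<And>k. integrable M (f k)" and g[measurable]: "g \<in> borel_measurable M"
    and lim: "AE x in M. (\<lambda>k. f k x) \<longlonglongrightarrow> g x"
    and h: "\<And>k. integrable M (h k)" "\<And>k. AE x in M. 0 \<le> h k x" "\<And>k. (\<integral>x. h k x \<partial>M) \<le> C"
    and ui: "\<And>\<delta>. 0 < \<delta> \<Longrightarrow> \<exists>R. \<forall>k. AE x in M. norm (f k x) \<le> R + \<delta> * h k x"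
  shows "integrable M g" "(\<lambda>k. \<integral>x. norm (f k x - g x) \<partial>M) \<longlonglongrightarrow> 0"
proof -
  interpret finite_measure M by fact
  have [measurable]: "f k \<in> borel_measurable M" "h k \<in> borel_measurable M" for k using f h by auto
  obtain R where R: "\<And>k. AE x in M. norm (f k x) \<le> R + 1 * h k x" using ui[of 1] by auto
  have "integrable M (\<lambda>x. norm (g x))"
  proof (rule fatou_real(1)[where h = "\<lambda>k x. norm (f k x)"])
    show "AE x in M. (\<lambda>k. norm (f k x)) \<longlonglongrightarrow> norm (g x)"
      using lim by eventually_elim (rule tendsto_norm)
    fix k
    have "(\<integral>x. norm (f k x) \<partial>M) \<le> (\<integral>x. R + 1 * h k x \<partial>M)"
      using f h R by (intro integral_mono_AE) auto
    also have "\<dots> \<le> measure M (space M) * R + C" using h by simp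
    finally show "(\<integral>x. norm (f k x) \<partial>M) \<le> measure M (space M) * R + C" .
  qed (use f in auto)
  then show ig: "integrable M g" by (simp add: integrable_norm_iff)
  have "0 \<le> (\<integral>x. h 0 x \<partial>M)" using h by (intro integral_nonneg_AE)
  with h(3)[of 0] have C: "0 \<le> C" by linarith
  show "(\<lambda>k. \<integral>x. norm (f k x - g x) \<partial>M) \<longlonglongrightarrow> 0"
  proof (rule LIMSEQ_I)
    fix e :: real assume e: "0 < e"
    \<comment> \<open>Chosen so that \<open>\<delta> * C\<close> is at most \<open>e/2\<close>, also
      when \<open>C = 0\<close>.\<close>
    define \<delta> where "\<delta> = e / (2 * (C + 1))"
    have \<delta>: "0 < \<delta>" using e C by (auto simp: \<delta>_def)
    have \<delta>2: "\<delta> * C \<le> e/2" using e C by (auto simp: \<delta>_def field_simps)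
    obtain R where R: "\<And>k. AE x in M. norm (f k x) \<le> R + \<delta> * h k x" using ui[OF \<delta>] by auto
    \<comment> \<open>The part of the distance not covered by \<open>\<delta> * h k\<close>. It is
      dominated by an integrable function independent of \<open>k\<close>, so dominated convergence
      applies; the covered part contributes at most \<open>e/2\<close>.\<close>
    define p where "p k x = max 0 (norm (f k x - g x) - \<delta> * h k x)" for k x
    have [measurable]: "p k \<in> borel_measurable M" for k unfolding p_def by measurable
    have "(\<lambda>k. \<integral>x. p k x \<partial>M) \<longlonglongrightarrow> (\<integral>x. 0 \<partial>M)"
    proof (rule integral_dominated_convergence[where w = "\<lambda>x. \<bar>R\<bar> + norm (g x)"])
      have "AE x in M. \<forall>k. 0 \<le> h k x" using h(2) by (simp add: AE_all_countable)
      with lim show "AE x in M. (\<lambda>k. p k x) \<longlonglongrightarrow> 0"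
      proof eventually_elim
        case (elim x)
        have "(\<lambda>k. norm (f k x - g x)) \<longlonglongrightarrow> 0" using elim(1) by (simp add: LIM_zero_iff tendsto_norm_zero)
        moreover have "norm (p k x) \<le> norm (f k x - g x)" for k
          using elim(2)[rule_format, of k] \<delta> by (simp add: p_def)
        ultimately show ?case by (intro LIMSEQ_null_comparison[of "\<lambda>k. p k x"])
      qed
      show "AE x in M. norm (p k x) \<le> \<bar>R\<bar> + norm (g x)" for k
        using R[of k]
      proof eventually_elim
        case (elim x)
        then show ?case using norm_triangle_ineq4[of "f k x" "g x"] by (auto simp: p_def)
      qed
    qed (use ig in auto)
    then have "\<forall>\<^sub>F k in sequentially. (\<integral>x. p k x \<partial>M) < e/2"
      using e by (intro order_tendstoD(2)) auto
    then obtain n0 where n0: "\<And>k. k \<ge> n0 \<Longrightarrow> (\<integral>x. p k x \<partial>M) < e/2" by (auto simp: eventually_sequentially)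
    have "norm ((\<integral>x. norm (f k x - g x) \<partial>M) - 0) < e" if "k \<ge> n0" for k
    proof -
      have ip: "integrable M (p k)"
      proof (rule Bochner_Integration.integrable_bound)
        show "integrable M (\<lambda>x. \<bar>R\<bar> + norm (g x))" using ig by simp
        show "AE x in M. norm (p k x) \<le> norm (\<bar>R\<bar> + norm (g x))"
          using R[of k]
        proof eventually_elim
          case (elim x)
          then show ?case using norm_triangle_ineq4[of "f k x" "g x"] by (auto simp: p_def)
        qed
      qed simp
      have "(\<integral>x. norm (f k x - g x) \<partial>M) \<le> (\<integral>x. p k x + \<delta> * h k x \<partial>M)"
        using f ig ip h by (intro integral_mono) (auto simp: p_def)
      also have "\<dots> = (\<integral>x. p k x \<partial>M) + \<delta> * (\<integral>x. h k x \<partial>M)" using ip h by simp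
      also have "\<delta> * (\<integral>x. h k x \<partial>M) \<le> \<delta> * C" using h(3) \<delta> by (intro mult_left_mono) auto
      finally show ?thesis using n0[OF that] \<delta>2 by simp
    qed
    then show "\<exists>no. \<forall>n\<ge>no. norm ((\<integral>x. norm (f n x - g x) \<partial>M) - 0) < e" by blast
  qed
qed

text \<open>Elements of almost minimal \<open>L\<^sup>2\<close>-norm in decreasing midpoint-convex sets form a Cauchy
  sequence by the parallelogram law; this replaces weak compactness of bounded sets of \<open>L\<^sup>2\<close>.\<close>

lemma midpoint_convex_L2:
  fixes S :: "nat \<Rightarrow> ('a \<Rightarrow> 'b::euclidean_space) set"
  assumes "prob_space M"
    and dec: "\<And>n k. n \<le> k \<Longrightarrow> S k \<subseteq> S n" and ne: "\<And>n. S n \<noteq> {}"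
    and mid: "\<And>n p p'. p \<in> S n \<Longrightarrow> p' \<in> S n \<Longrightarrow> (\<lambda>x. (1/2) *\<^sub>R (p x + p' x)) \<in> S n"
    and S: "\<And>n p. p \<in> S n \<Longrightarrow> p \<in> borel_measurable M" "\<And>n p. p \<in> S n \<Longrightarrow> integrable M (\<lambda>x. (norm (p x))\<^sup>2)"
      "\<And>n p. p \<in> S n \<Longrightarrow> (\<integral>x. (norm (p x))\<^sup>2 \<partial>M) \<le> K"
  obtains p f where "\<And>n. p n \<in> S n" "integrable M f" "(\<lambda>n. \<integral>x. norm (p n x - f x) \<partial>M) \<longlonglongrightarrow> 0"
    "\<And>n. integrable M (p n)" "integrable M (\<lambda>x. (norm (f x))\<^sup>2)" "(\<integral>x. (norm (f x))\<^sup>2 \<partial>M) \<le> K"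
proof -
  interpret prob_space M by fact
  define E where "E p = (\<integral>x. (norm (p x :: 'b))\<^sup>2 \<partial>M)" for p
  have E0: "0 \<le> E p" for p unfolding E_def by simp
  define a where "a n = Inf (E ` S n)" for n
  have bdd: "bdd_below (E ` S n)" for n using E0 by (intro bdd_belowI2[of _ 0])
  have a_le: "a n \<le> E p" if "p \<in> S n" for n p
    unfolding a_def using that bdd by (intro cInf_lower) auto
  have inc: "incseq a"
  proof (rule incseq_SucI)
    show "a n \<le> a (Suc n)" for n
      unfolding a_def using dec[of n "Suc n"] ne bdd by (intro cInf_superset_mono) auto
  qed
  have "a n \<le> K" for n
  proof -
    obtain p where "p \<in> S n" using ne by blast
    then show ?thesis using a_le[of p n] S(3)[of p n] by (simp add: E_def)
  qed
  then obtain L where L: "a \<longlonglongrightarrow> L" using incseq_convergent[OF inc] by metis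
  define d where "d n = 1 / real (Suc n)" for n
  have d: "0 < d n" "d \<longlonglongrightarrow> 0" for n
    unfolding d_def by (simp, rule LIMSEQ_Suc[OF lim_const_over_n])
  have "\<exists>p\<in>S n. E p < a n + d n" for n
  proof -
    have "\<exists>y\<in>E ` S n. y < a n + d n"
      by (rule cInf_lessD) (use ne d(1) in \<open>auto simp: a_def\<close>)
    then show ?thesis by blast
  qed
  then obtain p where p: "\<And>n. p n \<in> S n" "\<And>n. E (p n) < a n + d n" by metis
  have pm[measurable]: "p n \<in> borel_measurable M" and pi: "integrable M (\<lambda>x. (norm (p n x))\<^sup>2)" for n
    using S(1,2)[OF p(1)] by auto
  have ip: "integrable M (p n)" for n
  proof -
    have "integrable M (\<lambda>x. norm (p n x))"
      by (rule square_integrable_imp_integrable[OF _ pi]) simp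
    then show ?thesis by (simp add: integrable_norm_iff)
  qed
  have sq: "integrable M (\<lambda>x. (norm (p n x - p k x))\<^sup>2)" for n k
  proof (rule Bochner_Integration.integrable_bound)
    show "integrable M (\<lambda>x. 2 * (norm (p n x))\<^sup>2 + 2 * (norm (p k x))\<^sup>2)" using pi by simp
    show "AE x in M. norm ((norm (p n x - p k x))\<^sup>2) \<le> norm (2 * (norm (p n x))\<^sup>2 + 2 * (norm (p k x))\<^sup>2)"
    proof (rule AE_I2)
      fix x
      have "(norm (p n x - p k x))\<^sup>2 + (norm (p n x + p k x))\<^sup>2 = 2 * (norm (p n x))\<^sup>2 + 2 * (norm (p k x))\<^sup>2"
        by (simp add: power2_norm_eq_inner inner_add inner_diff algebra_simps)
      then have "(norm (p n x - p k x))\<^sup>2 \<le> 2 * (norm (p n x))\<^sup>2 + 2 * (norm (p k x))\<^sup>2"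
        using zero_le_power2[of "norm (p n x + p k x)"] by linarith
      then show "norm ((norm (p n x - p k x))\<^sup>2) \<le> norm (2 * (norm (p n x))\<^sup>2 + 2 * (norm (p k x))\<^sup>2)"
        by simp
    qed
  qed simp
  \<comment> \<open>The midpoint lies in \<open>S n\<close>, the larger of the two sets, so its
    energy is at least \<open>a n\<close>. The energies of \<open>p n\<close> and \<open>p k\<close>
    exceed the infima \<open>a n\<close> and \<open>a k\<close> by less than \<open>d n\<close> and
    \<open>d k\<close>.\<close>
  have par: "(\<integral>x. (norm (p n x - p k x))\<^sup>2 \<partial>M) \<le> 2 * (a k - a n) + 4 * d n" if nk: "n \<le> k" for n k
  proof -
    let ?m = "\<lambda>x. (1/2) *\<^sub>R (p n x + p k x)"
    have "p k \<in> S n" using p(1) dec[OF nk] by blast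
    then have m: "?m \<in> S n" using mid p(1) by blast
    have "(norm (p n x - p k x))\<^sup>2 = 2 * (norm (p n x))\<^sup>2 + 2 * (norm (p k x))\<^sup>2 - 4 * (norm (?m x))\<^sup>2" for x
      by (simp add: power2_norm_eq_inner inner_add inner_diff algebra_simps)
    then have "(\<integral>x. (norm (p n x - p k x))\<^sup>2 \<partial>M) = 2 * E (p n) + 2 * E (p k) - 4 * E ?m"
      using pi S(2)[OF m] unfolding E_def by simp
    also have "\<dots> \<le> 2 * (a n + d n) + 2 * (a k + d k) - 4 * a n"
      using a_le[OF m] p(2)[of n] p(2)[of k] by argo
    also have "d k \<le> d n" unfolding d_def using nk by (intro divide_left_mono) auto
    finally show ?thesis by (simp add: algebra_simps)
  qed
  have cauchy: "\<exists>N. \<forall>i\<ge>N. \<forall>j\<ge>N. (\<integral>x. norm (p i x - p j x) \<partial>M) < e" if e: "0 < e" for e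
  proof -
    have "(\<lambda>n. 2 * (L - a n) + 4 * d n) \<longlonglongrightarrow> 2 * (L - L) + 4 * 0"
      by (intro tendsto_intros L d)
    then have "\<forall>\<^sub>F n in sequentially. 2 * (L - a n) + 4 * d n < e\<^sup>2"
      using e by (intro order_tendstoD(2)) auto
    then obtain N where N: "\<And>n. n \<ge> N \<Longrightarrow> 2 * (L - a n) + 4 * d n < e\<^sup>2" by (auto simp: eventually_sequentially)
    have "(\<integral>x. norm (p i x - p j x) \<partial>M) < e" if ij: "i \<ge> N" "i \<le> j" for i j
    proof -
      have "a j \<le> L" using incseq_le[OF inc L] .
      then have lt: "(\<integral>x. (norm (p i x - p j x))\<^sup>2 \<partial>M) < e\<^sup>2" using order_le_less_trans[OF par[OF ij(2)], of "e\<^sup>2"] N[OF ij(1)] by argo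
      \<comment> \<open>From L2 to L1 by the elementary inequality
        \<open>t \<le> e/2 + t\<^sup>2 / (2 * e)\<close>: the squared L2 distance is below
        \<open>e\<^sup>2\<close>.\<close>
      have "(\<integral>x. norm (p i x - p j x) \<partial>M) \<le> (\<integral>x. e / 2 + (1 / (2 * e)) * (norm (p i x - p j x))\<^sup>2 \<partial>M)"
      proof (rule integral_mono)
        show "norm (p i x - p j x) \<le> e / 2 + (1 / (2 * e)) * (norm (p i x - p j x))\<^sup>2" for x
        proof -
          have "0 \<le> (norm (p i x - p j x) - e)\<^sup>2" by simp
          then have "2 * e * norm (p i x - p j x) \<le> e\<^sup>2 + (norm (p i x - p j x))\<^sup>2"
            by (simp add: power2_diff mult_ac add.commute)
          then show ?thesis using e by (simp add: field_simps power2_eq_square)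
        qed
      qed (use ip sq in auto)
      also have "\<dots> = e / 2 + (1 / (2 * e)) * (\<integral>x. (norm (p i x - p j x))\<^sup>2 \<partial>M)"
        using sq by (simp add: prob_space)
      also have "\<dots> < e / 2 + (1 / (2 * e)) * e\<^sup>2"
        using lt e by (intro add_strict_left_mono mult_strict_left_mono) auto
      also have "\<dots> = e" using e by (simp add: power2_eq_square)
      finally show ?thesis .
    qed
    note half = this
    have "(\<integral>x. norm (p i x - p j x) \<partial>M) < e" if "i \<ge> N" "j \<ge> N" for i j
    proof (cases "i \<le> j")
      case False
      then show ?thesis using half[of j i] that by (subst norm_minus_commute) simp
    qed (use half that in blast)
    then show ?thesis by blast
  qed
  obtain f where f: "integrable M f" "(\<lambda>n. \<integral>x. norm (p n x - f x) \<partial>M) \<longlonglongrightarrow> 0"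
    by (rule L1_complete[OF ip cauchy]) (assumption | rule that, assumption+)+
  have [measurable]: "f \<in> borel_measurable M" using f by simp
  obtain r where r: "strict_mono r" "AE x in M. (\<lambda>n. p (r n) x) \<longlonglongrightarrow> f x"
    by (rule L1_AE_subseq[OF ip f]) (rule that, assumption+)
  have "AE x in M. (\<lambda>n. (norm (p (r n) x))\<^sup>2) \<longlonglongrightarrow> (norm (f x))\<^sup>2"
    using r(2) by eventually_elim (intro tendsto_intros)
  from fatou_real[OF pi[of "r _"] _ _ this, of K] S(3)[OF p(1)] 
  have "integrable M (\<lambda>x. (norm (f x))\<^sup>2)" "(\<integral>x. (norm (f x))\<^sup>2 \<partial>M) \<le> K" by auto
  with p(1) f ip show thesis by (intro that)
qed

section \<open>Weak gradients and Sobolev functions\<close>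

lemma integral_vec_nth:
  fixes f :: "'a \<Rightarrow> real ^ 'n"
  assumes "integrable M f"
  shows "(\<integral>x. f x \<partial>M) $ i = (\<integral>x. f x $ i \<partial>M)" "integrable M (\<lambda>x. f x $ i)"
  using integral_bounded_linear[OF bounded_linear_vec_nth assms] 
    integrable_bounded_linear[OF bounded_linear_vec_nth assms] by simp_all

text \<open>Coordinates may be taken under a Bochner integral of an integrable field; the proof
  consists in this integrability, from boundedness of \<open>\<phi>\<close> and
  \<open>grad \<phi>\<close> on the cube.\<close>

lemma has_weak_grad_iff:
  "has_weak_grad f G \<longleftrightarrow> integrable torus f \<and> integrable torus G \<and>
     (\<forall>\<phi> i. test_fun \<phi> \<longrightarrow> (\<integral>x. f x * partial_deriv i \<phi> x \<partial>torus) = - (\<integral>x. G x $ i * \<phi> x \<partial>torus))"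
proof -
  have "(\<integral>x. f x *\<^sub>R grad \<phi> x \<partial>torus) = - (\<integral>x. \<phi> x *\<^sub>R G x \<partial>torus) \<longleftrightarrow>
      (\<forall>i. (\<integral>x. f x * partial_deriv i \<phi> x \<partial>torus) = - (\<integral>x. G x $ i * \<phi> x \<partial>torus))"
    if f: "integrable torus f" and G: "integrable torus G" and \<phi>: "test_fun \<phi>" for \<phi>
  proof -
    have 1: "integrable torus (\<lambda>x. \<phi> x *\<^sub>R G x)"
      by (intro integrable_continuous_scaleR G test_fun_continuous_on \<phi>)
    obtain D where D: "0 < D" "\<And>x. x \<in> cbox 0 1 \<Longrightarrow> norm (grad \<phi> x) \<le> D"
      using continuous_torus_bounded[OF continuous_on_grad[OF \<phi>]] by blast
    have [measurable]: "grad \<phi> \<in> borel_measurable torus" "f \<in> borel_measurable torus"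
      using f by (auto intro: borel_measurable_torus_continuous continuous_on_grad \<phi>)
    have 2: "integrable torus (\<lambda>x. f x *\<^sub>R grad \<phi> x)"
    proof (rule Bochner_Integration.integrable_bound)
      show "integrable torus (\<lambda>x. D * f x)" using f by simp
      show "AE x in torus. norm (f x *\<^sub>R grad \<phi> x) \<le> norm (D * f x)"
      proof (rule AE_I2)
        fix x :: "real ^ 'a" assume "x \<in> space torus"
        then have "\<bar>f x\<bar> * norm (grad \<phi> x) \<le> \<bar>f x\<bar> * D" using D(2) by (intro mult_left_mono) auto
        then show "norm (f x *\<^sub>R grad \<phi> x) \<le> norm (D * f x)"
          using D(1) by (simp add: abs_mult mult.commute)
      qed
    qed simp
    have "(\<integral>x. f x *\<^sub>R grad \<phi> x \<partial>torus) $ i = (\<integral>x. f x * partial_deriv i \<phi> x \<partial>torus)"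
      "(\<integral>x. \<phi> x *\<^sub>R G x \<partial>torus) $ i = (\<integral>x. G x $ i * \<phi> x \<partial>torus)" for i
      by (simp_all add: integral_vec_nth(1)[OF 1] integral_vec_nth(1)[OF 2])
        (simp_all add: grad_def mult.commute)
    then show ?thesis by (simp add: vec_eq_iff)
  qed
  then show ?thesis unfolding has_weak_grad_def by blast
qed

lemma has_weak_gradD:
  assumes "has_weak_grad f G"
  shows "integrable torus f" "integrable torus G" "integrable torus (\<lambda>x. G x $ i)"
    "test_fun \<phi> \<Longrightarrow> (\<integral>x. f x * partial_deriv i \<phi> x \<partial>torus) = - (\<integral>x. G x $ i * \<phi> x \<partial>torus)"
  using assms integral_vec_nth(2)[of torus G i] by (simp_all add: has_weak_grad_iff)

lemma integrable_mult_test: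
  "integrable torus (f :: real ^ 'n \<Rightarrow> real) \<Longrightarrow> test_fun \<phi> \<Longrightarrow> integrable torus (\<lambda>x. f x * \<phi> x)"
  by (intro integrable_continuous_mult(2) test_fun_continuous_on)

lemma has_weak_grad_lincomb:
  fixes f h :: "real ^ 'n \<Rightarrow> real"
  assumes "has_weak_grad f G" "has_weak_grad h K"
  shows "has_weak_grad (\<lambda>x. a * f x + b * h x) (\<lambda>x. a *\<^sub>R G x + b *\<^sub>R K x)"
  unfolding has_weak_grad_iff
proof (intro conjI allI impI)
  show "integrable torus (\<lambda>x. a * f x + b * h x)" "integrable torus (\<lambda>x. a *\<^sub>R G x + b *\<^sub>R K x)"
    using has_weak_gradD(1,2)[OF assms(1)] has_weak_gradD(1,2)[OF assms(2)] by simp_all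
  fix \<phi> :: "real ^ 'n \<Rightarrow> real" and i assume t: "test_fun \<phi>"
  note td = test_fun_partial_deriv[OF t, of i]
  have "integrable torus (\<lambda>x. f x * partial_deriv i \<phi> x)" "integrable torus (\<lambda>x. h x * partial_deriv i \<phi> x)"
    "integrable torus (\<lambda>x. G x $ i * \<phi> x)" "integrable torus (\<lambda>x. K x $ i * \<phi> x)"
    using has_weak_gradD(1,3)[OF assms(1)] has_weak_gradD(1,3)[OF assms(2)]
    by (auto intro: integrable_mult_test t td)
  then show "(\<integral>x. (a * f x + b * h x) * partial_deriv i \<phi> x \<partial>torus) =
      - (\<integral>x. (a *\<^sub>R G x + b *\<^sub>R K x) $ i * \<phi> x \<partial>torus)"
    using has_weak_gradD(4)[OF assms(1) t, of i] has_weak_gradD(4)[OF assms(2) t, of i]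
    by (simp add: distrib_right mult.assoc)
qed

lemma has_weak_grad_unique:
  assumes "has_weak_grad f G" "has_weak_grad f K"
  shows "AE x in torus. G x = K x"
proof -
  have "AE x in torus. G x $ i - K x $ i = 0" for i
  proof (rule fundamental_lemma)
    show "integrable torus (\<lambda>x. G x $ i - K x $ i)"
      using has_weak_gradD(3)[OF assms(1)] has_weak_gradD(3)[OF assms(2)] by simp
    fix \<phi> :: "real ^ 'a \<Rightarrow> real" assume t: "test_fun \<phi>"
    have "integrable torus (\<lambda>x. G x $ i * \<phi> x)" "integrable torus (\<lambda>x. K x $ i * \<phi> x)"
      using has_weak_gradD(3)[OF assms(1)] has_weak_gradD(3)[OF assms(2)]
      by (auto intro: integrable_mult_test t)
    then show "(\<integral>x. (G x $ i - K x $ i) * \<phi> x \<partial>torus) = 0"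
      using has_weak_gradD(4)[OF assms(1) t, of i] has_weak_gradD(4)[OF assms(2) t, of i]
      by (simp add: left_diff_distrib)
  qed
  then have "AE x in torus. \<forall>i. G x $ i - K x $ i = 0" by (simp add: AE_all_countable)
  then show ?thesis by eventually_elim (simp add: vec_eq_iff)
qed

text \<open>Translation does not change the integral of \<open>\<phi>\<close>, so the translation
  estimate with \<open>q\<close> the identity says that the integral of
  \<open>grad \<phi> \<bullet> z\<close> is nonnegative. Opposite directions \<open>z\<close> give
  equality.\<close>

lemma integral_partial_deriv:
  assumes "test_fun \<phi>" shows "(\<integral>x. partial_deriv i \<phi> x \<partial>torus) = 0"
proof -
  have *: "0 \<le> (\<integral>x. grad \<phi> x \<bullet> z \<partial>torus)" for z
  proof -
    have "(\<integral>x. \<phi> (x + z) - \<phi> x \<partial>torus) = (\<integral>x. \<phi> (x + z) \<partial>torus) - (\<integral>x. \<phi> x \<partial>torus)"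
    proof (intro Bochner_Integration.integral_diff integrable_torus_continuous)
      show "continuous_on (cbox 0 1) (\<lambda>x. \<phi> (x + z))"
        by (intro continuous_on_compose2[OF test_fun_continuous_on[OF assms, of UNIV]] continuous_intros) auto
    qed (rule test_fun_continuous_on[OF assms])
    also have "\<dots> = 0"
      using periodic_integral_shift[OF test_fun_continuous_on[OF assms] test_fun_periodic[OF assms], of z] by simp
    finally show ?thesis
      using translation_estimate[OF assms, of "\<lambda>t. t" z] by (auto simp: convex_on_def)
  qed
  have "grad \<phi> x \<bullet> axis i 1 = partial_deriv i \<phi> x" for x by (simp add: inner_axis grad_def)
  with *[of "axis i 1"] *[of "- axis i 1"] show ?thesis by simp
qed

text \<open>Constants vanish against derivatives of periodic functions. Equality is stated for the
  predicates, so that the choice in \<open>weak_grad\<close> yields the very same function and not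
  only the same class.\<close>

lemma has_weak_grad_diff_const:
  "has_weak_grad (\<lambda>x. f x - c) = has_weak_grad f"
proof -
  have *: "has_weak_grad (\<lambda>x. f x - c) G" if G: "has_weak_grad f G" for f :: "real ^ 'a \<Rightarrow> real" and G c
    unfolding has_weak_grad_iff
  proof (intro conjI allI impI)
    show "integrable torus (\<lambda>x. f x - c)" "integrable torus G" using has_weak_gradD(1,2)[OF G] by simp_all
    fix \<phi> :: "real ^ 'a \<Rightarrow> real" and i assume t: "test_fun \<phi>"
    note td = test_fun_partial_deriv[OF t, of i]
    have "integrable torus (\<lambda>x. f x * partial_deriv i \<phi> x)" "integrable torus (\<lambda>x. c * partial_deriv i \<phi> x)"
      using has_weak_gradD(1)[OF G] integrable_test_fun[OF td] by (auto intro: integrable_mult_test td)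
    then show "(\<integral>x. (f x - c) * partial_deriv i \<phi> x \<partial>torus) = - (\<integral>x. G x $ i * \<phi> x \<partial>torus)"
      using has_weak_gradD(4)[OF G t, of i] integral_partial_deriv[OF t, of i] by (simp add: left_diff_distrib)
  qed
  show ?thesis using *[of "\<lambda>x. f x - c" _ "- c"] * by fastforce
qed

lemma weak_grad_diff_const: "weak_grad (\<lambda>x. f x - c) = weak_grad f"
  by (simp add: weak_grad_def has_weak_grad_diff_const)

lemma has_weak_grad_weak_grad: "has_weak_grad f G \<Longrightarrow> has_weak_grad f (weak_grad f)"
  unfolding weak_grad_def by (rule someI[of "has_weak_grad f"])

section \<open>The Sobolev space and its norm\<close>

lemma W12D:
  assumes "f \<in> W12"
  shows "has_weak_grad f (weak_grad f)" "integrable torus (\<lambda>x. (f x)\<^sup>2)"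
    "integrable torus (\<lambda>x. (norm (weak_grad f x))\<^sup>2)" "integrable torus f" "integrable torus (weak_grad f)"
proof -
  obtain G where G: "has_weak_grad f G" "integrable torus (\<lambda>x. (norm (G x))\<^sup>2)"
    using assms by (auto simp: W12_def)
  show wg: "has_weak_grad f (weak_grad f)" using G(1) by (rule has_weak_grad_weak_grad)
  show "integrable torus (\<lambda>x. (f x)\<^sup>2)" using assms by (simp add: W12_def)
  show "integrable torus f" "integrable torus (weak_grad f)" using has_weak_gradD[OF wg] by auto
  then have [measurable]: "weak_grad f \<in> borel_measurable torus" by simp
  have [measurable]: "G \<in> borel_measurable torus" using has_weak_gradD(2)[OF G(1)] by simp
  have "AE x in torus. (norm (G x))\<^sup>2 = (norm (weak_grad f x))\<^sup>2"
    using has_weak_grad_unique[OF G(1) wg] by eventually_elim simp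
  then show "integrable torus (\<lambda>x. (norm (weak_grad f x))\<^sup>2)"
    using G(2) by (subst integrable_cong_AE[symmetric]) auto
qed

lemma W12I:
  assumes "has_weak_grad f G" "integrable torus (\<lambda>x. (f x)\<^sup>2)" "integrable torus (\<lambda>x. (norm (G x))\<^sup>2)"
  shows "f \<in> W12" "W12_norm f = sqrt ((\<integral>x. (f x)\<^sup>2 \<partial>torus) + (\<integral>x. (norm (G x))\<^sup>2 \<partial>torus))"
proof -
  show W: "f \<in> W12" using assms has_weak_gradD(1)[OF assms(1)] by (auto simp: W12_def)
  have [measurable]: "weak_grad f \<in> borel_measurable torus" "G \<in> borel_measurable torus"
    using W12D(5)[OF W] has_weak_gradD(2)[OF assms(1)] by auto
  have "AE x in torus. (norm (weak_grad f x))\<^sup>2 = (norm (G x))\<^sup>2"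
    using has_weak_grad_unique[OF W12D(1)[OF W] assms(1)] by eventually_elim simp
  then have "(\<integral>x. (norm (weak_grad f x))\<^sup>2 \<partial>torus) = (\<integral>x. (norm (G x))\<^sup>2 \<partial>torus)"
    by (intro integral_cong_AE) auto
  then show "W12_norm f = sqrt ((\<integral>x. (f x)\<^sup>2 \<partial>torus) + (\<integral>x. (norm (G x))\<^sup>2 \<partial>torus))"
    by (simp add: W12_norm_def)
qed

lemma W12_norm_square:
  "(W12_norm f)\<^sup>2 = (\<integral>x. (f x)\<^sup>2 \<partial>torus) + (\<integral>x. (norm (weak_grad f x))\<^sup>2 \<partial>torus)"
  unfolding W12_norm_def by (intro real_sqrt_pow2 add_nonneg_nonneg) simp_all

lemma W12_norm_nonneg: "0 \<le> W12_norm f"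
  by (simp add: W12_norm_def)

lemma W12_norm_leD:
  assumes "W12_norm f \<le> C"
  shows "(\<integral>x. (f x)\<^sup>2 \<partial>torus) \<le> C\<^sup>2" "(\<integral>x. (norm (weak_grad f x))\<^sup>2 \<partial>torus) \<le> C\<^sup>2"
proof -
  have "(W12_norm f)\<^sup>2 \<le> C\<^sup>2" using assms W12_norm_nonneg by (intro power_mono)
  moreover have "0 \<le> (\<integral>x. (f x)\<^sup>2 \<partial>torus)" "0 \<le> (\<integral>x. (norm (weak_grad f x))\<^sup>2 \<partial>torus)" by simp_all
  ultimately show "(\<integral>x. (f x)\<^sup>2 \<partial>torus) \<le> C\<^sup>2" "(\<integral>x. (norm (weak_grad f x))\<^sup>2 \<partial>torus) \<le> C\<^sup>2"
    unfolding W12_norm_square by linarith+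
qed

text \<open>Cauchy-Schwarz from a nonnegative quadratic polynomial in \<open>t\<close>, evaluated at
  its minimum point \<open>I / B\<close>. For \<open>B = 0\<close> it is affine and would take the
  value \<open>-1\<close> at \<open>(A + 1) / (2 * I)\<close> unless \<open>I = 0\<close>.\<close>

lemma discriminant_bound:
  fixes A B I :: real
  assumes "\<And>t. 0 \<le> A - 2 * t * I + t\<^sup>2 * B" "0 \<le> A" "0 \<le> B"
  shows "\<bar>I\<bar> \<le> sqrt A * sqrt B"
proof (cases "B = 0")
  case True
  have "I = 0"
  proof (rule ccontr)
    assume "I \<noteq> 0"
    then show False using assms(1)[of "(A + 1) / (2 * I)"] True by simp
  qed
  then show ?thesis using True by simp
next
  case False
  then have "0 < B" using assms by simp
  then have "I\<^sup>2 \<le> A * B"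
    using assms(1)[of "I / B"] by (simp add: field_simps power2_eq_square)
  then have "sqrt (I\<^sup>2) \<le> sqrt (A * B)" by (rule real_sqrt_le_mono)
  then show ?thesis by (simp add: real_sqrt_mult)
qed

lemma integrable_inner_L2:
  fixes F G :: "'a \<Rightarrow> 'b::euclidean_space"
  assumes [measurable]: "F \<in> borel_measurable M" "G \<in> borel_measurable M"
    and "integrable M (\<lambda>x. (norm (F x))\<^sup>2)" "integrable M (\<lambda>x. (norm (G x))\<^sup>2)"
  shows "integrable M (\<lambda>x. F x \<bullet> G x)"
proof (rule Bochner_Integration.integrable_bound)
  show "integrable M (\<lambda>x. (norm (F x))\<^sup>2 + (norm (G x))\<^sup>2)" using assms by simp
  show "AE x in M. norm (F x \<bullet> G x) \<le> norm ((norm (F x))\<^sup>2 + (norm (G x))\<^sup>2)"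
  proof (rule AE_I2)
    fix x
    have "\<bar>F x \<bullet> G x\<bar> \<le> norm (F x) * norm (G x)" by (rule Cauchy_Schwarz_ineq2)
    also have "\<dots> \<le> (norm (F x))\<^sup>2 + (norm (G x))\<^sup>2"
      using sum_squares_bound[of "norm (F x)" "norm (G x)"]
        mult_nonneg_nonneg[OF norm_ge_zero norm_ge_zero, of "F x" "G x"] by linarith
    finally show "norm (F x \<bullet> G x) \<le> norm ((norm (F x))\<^sup>2 + (norm (G x))\<^sup>2)" by simp
  qed
qed simp

lemma integrable_mult_L2:
  fixes f g :: "'a \<Rightarrow> real"
  assumes "f \<in> borel_measurable M" "g \<in> borel_measurable M"
    and "integrable M (\<lambda>x. (f x)\<^sup>2)" "integrable M (\<lambda>x. (g x)\<^sup>2)"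
  shows "integrable M (\<lambda>x. f x * g x)"
  using integrable_inner_L2[of f M g] assms by simp

text \<open>These functionals extract what weak convergence in the Sobolev space is needed for:
  \<open>\<psi> = 0\<close> tests the gradients, \<open>\<psi> = 1\<close> with
  \<open>\<Theta> = 0\<close> the mean, and \<open>\<psi> = u\<close> with
  \<open>\<Theta> = weak_grad u\<close> is the inner product with \<open>u\<close>.\<close>

lemma W12_bounded_functional:
  fixes \<psi> :: "real ^ 'n \<Rightarrow> real" and \<Theta> :: "real ^ 'n \<Rightarrow> real ^ 'n"
  assumes [measurable]: "\<psi> \<in> borel_measurable torus" "\<Theta> \<in> borel_measurable torus"
    and \<psi>: "integrable torus (\<lambda>x. (\<psi> x)\<^sup>2)" and \<Theta>: "integrable torus (\<lambda>x. (norm (\<Theta> x))\<^sup>2)"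
  defines "\<Lambda> \<equiv> \<lambda>f. (\<integral>x. f x * \<psi> x \<partial>torus) + (\<integral>x. weak_grad f x \<bullet> \<Theta> x \<partial>torus)"
  shows "bounded_functional W12 W12_norm \<Lambda>"
    and "f \<in> W12 \<Longrightarrow> \<bar>\<Lambda> f\<bar> \<le> W12_norm f * sqrt ((\<integral>x. (\<psi> x)\<^sup>2 \<partial>torus) + (\<integral>x. (norm (\<Theta> x))\<^sup>2 \<partial>torus))"
proof -
  have m: "f \<in> borel_measurable torus" "weak_grad f \<in> borel_measurable torus" if "f \<in> W12" for f :: "real ^ 'n \<Rightarrow> real"
    using W12D(4,5)[OF that] by simp_all
  have i: "integrable torus (\<lambda>x. f x * \<psi> x)" "integrable torus (\<lambda>x. weak_grad f x \<bullet> \<Theta> x)" if "f \<in> W12" for f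
    using m[OF that] W12D(2,3)[OF that] \<psi> \<Theta> by (auto intro!: integrable_mult_L2 integrable_inner_L2)
  have lin: "\<Lambda> (\<lambda>x. a * f x + b * h x) = a * \<Lambda> f + b * \<Lambda> h" if f: "f \<in> W12" and h: "h \<in> W12" for a b f h
  proof -
    have wg: "has_weak_grad (\<lambda>x. a * f x + b * h x) (\<lambda>x. a *\<^sub>R weak_grad f x + b *\<^sub>R weak_grad h x)"
      by (rule has_weak_grad_lincomb[OF W12D(1)[OF f] W12D(1)[OF h]])
    then have wg': "has_weak_grad (\<lambda>x. a * f x + b * h x) (weak_grad (\<lambda>x. a * f x + b * h x))"
      by (rule has_weak_grad_weak_grad)
    have [measurable]: "weak_grad (\<lambda>x. a * f x + b * h x) \<in> borel_measurable torus"
      using has_weak_gradD(2)[OF wg'] by simp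
    note [measurable] = m[OF f] m[OF h]
    \<comment> \<open>\<open>weak_grad\<close> is a choice of representative and hence linear only
      almost everywhere.\<close>
    have "(\<integral>x. weak_grad (\<lambda>x. a * f x + b * h x) x \<bullet> \<Theta> x \<partial>torus) =
        (\<integral>x. a * (weak_grad f x \<bullet> \<Theta> x) + b * (weak_grad h x \<bullet> \<Theta> x) \<partial>torus)"
    proof (rule integral_cong_AE)
      show "AE x in torus. weak_grad (\<lambda>x. a * f x + b * h x) x \<bullet> \<Theta> x =
          a * (weak_grad f x \<bullet> \<Theta> x) + b * (weak_grad h x \<bullet> \<Theta> x)"
        using has_weak_grad_unique[OF wg' wg] by eventually_elim (simp add: inner_add_left)
    qed simp_all
    also have "\<dots> = a * (\<integral>x. weak_grad f x \<bullet> \<Theta> x \<partial>torus) + b * (\<integral>x. weak_grad h x \<bullet> \<Theta> x \<partial>torus)"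
      using i[OF f] i[OF h] by simp
    finally show ?thesis
      using i[OF f] i[OF h] by (simp add: \<Lambda>_def distrib_right distrib_left mult.assoc)
  qed
  show bd: "\<bar>\<Lambda> f\<bar> \<le> W12_norm f * sqrt ((\<integral>x. (\<psi> x)\<^sup>2 \<partial>torus) + (\<integral>x. (norm (\<Theta> x))\<^sup>2 \<partial>torus))"
    if f: "f \<in> W12" for f
    unfolding W12_norm_def
  proof (rule discriminant_bound)
    note [measurable] = m[OF f]
    fix t :: real
    have e1: "(f x)\<^sup>2 - 2 * t * (f x * \<psi> x) + t\<^sup>2 * (\<psi> x)\<^sup>2 = (f x - t * \<psi> x)\<^sup>2" for x
      by (simp add: power2_eq_square algebra_simps)
    have e2: "(norm (weak_grad f x))\<^sup>2 - 2 * t * (weak_grad f x \<bullet> \<Theta> x) + t\<^sup>2 * (norm (\<Theta> x))\<^sup>2 =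
        (norm (weak_grad f x - t *\<^sub>R \<Theta> x))\<^sup>2" for x
      by (simp only: power2_norm_eq_inner)
        (simp add: inner_diff_left inner_diff_right inner_commute power2_eq_square algebra_simps)
    have "0 \<le> (\<integral>x. (f x)\<^sup>2 - 2 * t * (f x * \<psi> x) + t\<^sup>2 * (\<psi> x)\<^sup>2 \<partial>torus) +
       (\<integral>x. (norm (weak_grad f x))\<^sup>2 - 2 * t * (weak_grad f x \<bullet> \<Theta> x) + t\<^sup>2 * (norm (\<Theta> x))\<^sup>2 \<partial>torus)"
      unfolding e1 e2 by (intro add_nonneg_nonneg) simp_all
    also have "\<dots> = (\<integral>x. (f x)\<^sup>2 \<partial>torus) + (\<integral>x. (norm (weak_grad f x))\<^sup>2 \<partial>torus) - 2 * t * \<Lambda> f +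
        t\<^sup>2 * ((\<integral>x. (\<psi> x)\<^sup>2 \<partial>torus) + (\<integral>x. (norm (\<Theta> x))\<^sup>2 \<partial>torus))"
    proof -
      have "(\<integral>x. (f x)\<^sup>2 - 2 * t * (f x * \<psi> x) + t\<^sup>2 * (\<psi> x)\<^sup>2 \<partial>torus) =
          (\<integral>x. (f x)\<^sup>2 \<partial>torus) - 2 * t * (\<integral>x. f x * \<psi> x \<partial>torus) + t\<^sup>2 * (\<integral>x. (\<psi> x)\<^sup>2 \<partial>torus)"
        using i[OF f] W12D(2,3)[OF f] \<psi> by simp
      moreover have "(\<integral>x. (norm (weak_grad f x))\<^sup>2 - 2 * t * (weak_grad f x \<bullet> \<Theta> x) + t\<^sup>2 * (norm (\<Theta> x))\<^sup>2 \<partial>torus) =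
          (\<integral>x. (norm (weak_grad f x))\<^sup>2 \<partial>torus) - 2 * t * (\<integral>x. weak_grad f x \<bullet> \<Theta> x \<partial>torus) + t\<^sup>2 * (\<integral>x. (norm (\<Theta> x))\<^sup>2 \<partial>torus)"
        using i[OF f] W12D(2,3)[OF f] \<Theta> by simp
      ultimately show ?thesis by (simp only: \<Lambda>_def distrib_left)
    qed
    finally show "0 \<le> (\<integral>x. (f x)\<^sup>2 \<partial>torus) + (\<integral>x. (norm (weak_grad f x))\<^sup>2 \<partial>torus) - 2 * t * \<Lambda> f +
        t\<^sup>2 * ((\<integral>x. (\<psi> x)\<^sup>2 \<partial>torus) + (\<integral>x. (norm (\<Theta> x))\<^sup>2 \<partial>torus))" .
  qed (intro add_nonneg_nonneg, simp_all)+
  show "bounded_functional W12 W12_norm \<Lambda>"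
    unfolding bounded_functional_def
  proof (intro conjI ballI allI exI)
    show "\<Lambda> (\<lambda>x. f x + h x) = \<Lambda> f + \<Lambda> h" if "f \<in> W12" "h \<in> W12" for f h
      using lin[OF that, of 1 1] by simp
    show "\<Lambda> (\<lambda>x. c * f x) = c * \<Lambda> f" if "f \<in> W12" for f c
      using lin[OF that that, of c 0] by simp
    show "\<bar>\<Lambda> f\<bar> \<le> sqrt ((\<integral>x. (\<psi> x)\<^sup>2 \<partial>torus) + (\<integral>x. (norm (\<Theta> x))\<^sup>2 \<partial>torus)) * W12_norm f" if "f \<in> W12" for f
      using bd[OF that] by (simp add: mult.commute)
  qed
qed

lemma weakly_tendstoD:
  "weakly_tendsto X N f l F \<Longrightarrow> bounded_functional X N \<Lambda> \<Longrightarrow> ((\<lambda>e. \<Lambda> (f e)) \<longlongrightarrow> \<Lambda> l) F"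
  by (simp add: weakly_tendsto_def)

text \<open>The inner product with \<open>u\<close> itself converges to the squared norm of
  \<open>u\<close> and is eventually at most \<open>C\<close> times the norm of
  \<open>u\<close>.\<close>

lemma W12_norm_weak_limit_le:
  fixes u :: "real ^ 'n \<Rightarrow> real"
  assumes conv: "weakly_tendsto W12 W12_norm f u F" and C: "\<forall>\<^sub>F e in F. W12_norm (f e) \<le> C" and "F \<noteq> bot"
  shows "W12_norm u \<le> C"
proof -
  have u: "u \<in> W12" using conv by (simp add: weakly_tendsto_def)
  define \<Lambda> where "\<Lambda> f = (\<integral>x. f x * u x \<partial>torus) + (\<integral>x. weak_grad f x \<bullet> weak_grad u x \<partial>torus)" for f :: "real ^ 'n \<Rightarrow> real"
  have *: "u \<in> borel_measurable torus" "weak_grad u \<in> borel_measurable torus" using W12D(4,5)[OF u] by simp_all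
  note fn = W12_bounded_functional[OF * W12D(2,3)[OF u]]
  have "((\<lambda>e. \<Lambda> (f e)) \<longlongrightarrow> \<Lambda> u) F"
    using weakly_tendstoD[OF conv fn(1)] by (simp add: \<Lambda>_def)
  moreover have "\<forall>\<^sub>F e in F. f e \<in> W12" using conv by (simp add: weakly_tendsto_def)
  with C have "\<forall>\<^sub>F e in F. \<Lambda> (f e) \<le> C * W12_norm u"
  proof eventually_elim
    case (elim e)
    have "\<Lambda> (f e) \<le> W12_norm (f e) * W12_norm u"
      using fn(2)[OF elim(2)] by (simp add: \<Lambda>_def W12_norm_def[of u])
    also have "\<dots> \<le> C * W12_norm u" using elim(1) W12_norm_nonneg by (intro mult_right_mono)
    finally show ?case .
  qed
  ultimately have "\<Lambda> u \<le> C * W12_norm u" using \<open>F \<noteq> bot\<close> by (intro tendsto_upperbound)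
  moreover have "\<Lambda> u = (W12_norm u)\<^sup>2"
    unfolding W12_norm_square \<Lambda>_def power2_norm_eq_inner by (simp add: power2_eq_square)
  then have "\<Lambda> u = W12_norm u * W12_norm u" by (simp add: power2_eq_square)
  moreover have "0 \<le> C"
  proof -
    obtain e where "W12_norm (f e) \<le> C" using eventually_happens'[OF \<open>F \<noteq> bot\<close> C] by blast
    then show ?thesis using W12_norm_nonneg order_trans by blast
  qed
  ultimately show ?thesis using W12_norm_nonneg[of u] by (cases "W12_norm u = 0") auto
qed

lemma L1_bounded_functional:
  assumes [measurable]: "b \<in> borel_measurable torus" and b: "\<And>x. \<bar>b x\<bar> \<le> D"
  shows "bounded_functional L1 L1_norm (\<lambda>f. \<integral>x. b x * f x \<partial>torus)"
proof -
  have i: "integrable torus (\<lambda>x. b x * f x)" if "integrable torus f" for f :: "real ^ 'a \<Rightarrow> real"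
    using integrable_bounded_scaleR[of torus f b D] b that by simp
  have "\<bar>\<integral>x. b x * f x \<partial>torus\<bar> \<le> D * L1_norm f" if f: "f \<in> L1" for f
  proof -
    have f': "integrable torus f" using f by (simp add: L1_def)
    have "\<bar>\<integral>x. b x * f x \<partial>torus\<bar> \<le> (\<integral>x. \<bar>b x * f x\<bar> \<partial>torus)" by (rule integral_abs_bound)
    also have "\<dots> \<le> (\<integral>x. D * \<bar>f x\<bar> \<partial>torus)"
      using f' b by (intro integral_mono integrable_abs[OF i]) (auto simp: abs_mult intro!: mult_right_mono)
    finally show ?thesis by (simp add: L1_norm_def)
  qed
  then show ?thesis
    unfolding bounded_functional_def
    by (intro conjI ballI allI exI[of _ D]) (auto simp: L1_def i distrib_left mult.left_commute)
qed

lemma has_weak_grad_L1_limit: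
  assumes wg: "\<And>n. has_weak_grad (f n) (G n)" and g: "integrable torus g" "integrable torus K"
    and lim: "(\<lambda>n. \<integral>x. norm (f n x - g x) \<partial>torus) \<longlonglongrightarrow> 0" "(\<lambda>n. \<integral>x. norm (G n x - K x) \<partial>torus) \<longlonglongrightarrow> 0"
  shows "has_weak_grad g K"
  unfolding has_weak_grad_iff
proof (intro conjI allI impI g)
  fix \<phi> :: "real ^ 'a \<Rightarrow> real" and i assume t: "test_fun \<phi>"
  note td = test_fun_partial_deriv[OF t, of i]
  have test: "(\<lambda>n. \<integral>x. \<psi> x *\<^sub>R h n x \<partial>torus) \<longlonglongrightarrow> (\<integral>x. \<psi> x *\<^sub>R k x \<partial>torus)"
    if "test_fun \<psi>" "\<And>n. integrable torus (h n)" "integrable torus k" "(\<lambda>n. \<integral>x. norm (h n x - k x) \<partial>torus) \<longlonglongrightarrow> 0"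
    for \<psi> :: "real ^ 'a \<Rightarrow> real" and h :: "nat \<Rightarrow> real ^ 'a \<Rightarrow> 'b::{banach, second_countable_topology}" and k
  proof -
    have c: "continuous_on UNIV \<psi>" using that by (intro test_fun_continuous_on)
    obtain D where D: "\<And>x. x \<in> cbox 0 1 \<Longrightarrow> norm (\<psi> x) \<le> D" using continuous_torus_bounded[OF c] by blast
    show ?thesis
      by (rule L1_limit_integral[where D = D]) (use that D borel_measurable_torus_continuous[OF c] in auto)
  qed
  have 1: "(\<lambda>n. \<integral>x. f n x * partial_deriv i \<phi> x \<partial>torus) \<longlonglongrightarrow> (\<integral>x. g x * partial_deriv i \<phi> x \<partial>torus)"
    using test[OF td, of f g] has_weak_gradD(1)[OF wg] g lim by (simp add: mult.commute)
  have 2: "(\<lambda>n. \<integral>x. \<phi> x *\<^sub>R G n x \<partial>torus) \<longlonglongrightarrow> (\<integral>x. \<phi> x *\<^sub>R K x \<partial>torus)"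
    using test[OF t, of G K] has_weak_gradD(2)[OF wg] g lim by simp
  have iG: "integrable torus (\<lambda>x. \<phi> x *\<^sub>R G n x)" "integrable torus (\<lambda>x. \<phi> x *\<^sub>R K x)" for n
    using has_weak_gradD(2)[OF wg] g by (auto intro: integrable_continuous_scaleR test_fun_continuous_on t)
  have "(\<lambda>n. (\<integral>x. \<phi> x *\<^sub>R G n x \<partial>torus) $ i) \<longlonglongrightarrow> (\<integral>x. \<phi> x *\<^sub>R K x \<partial>torus) $ i"
    by (intro tendsto_vec_nth 2)
  then have "(\<lambda>n. \<integral>x. G n x $ i * \<phi> x \<partial>torus) \<longlonglongrightarrow> (\<integral>x. K x $ i * \<phi> x \<partial>torus)"
    by (simp add: integral_vec_nth[OF iG(1)] integral_vec_nth[OF iG(2)] mult.commute)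
  from tendsto_minus[OF this] have "(\<lambda>n. \<integral>x. f n x * partial_deriv i \<phi> x \<partial>torus) \<longlonglongrightarrow> - (\<integral>x. K x $ i * \<phi> x \<partial>torus)"
    by (simp add: has_weak_gradD(4)[OF wg t])
  with 1 show "(\<integral>x. g x * partial_deriv i \<phi> x \<partial>torus) = - (\<integral>x. K x $ i * \<phi> x \<partial>torus)"
    by (rule LIMSEQ_unique)
qed

text \<open>No weakly convergent subsequence of gradients is extracted. Instead, elements of nearly
  minimal norm in the sets of admissible pairs close to \<open>g\<close> converge strongly, and the
  relation \<open>has_weak_grad\<close> is closed under L1 limits.\<close>

lemma W12_L1_limit:
  fixes f :: "nat \<Rightarrow> real ^ 'n \<Rightarrow> real"
  assumes f: "\<And>n. f n \<in> W12" "\<And>n. W12_norm (f n) \<le> C" and g: "integrable torus g"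
    and lim: "(\<lambda>n. \<integral>x. norm (f n x - g x) \<partial>torus) \<longlonglongrightarrow> 0"
  shows "g \<in> W12" "W12_norm g \<le> C"
proof -
  have C: "0 \<le> C" using f(2)[of 0] W12_norm_nonneg[of "f 0"] by linarith
  \<comment> \<open>Function and gradient form one map into a product space, whose Euclidean norm
    reproduces the Sobolev norm. The last condition pins the functions to \<open>g\<close> in the
    limit.\<close>
  define S :: "nat \<Rightarrow> (real ^ 'n \<Rightarrow> real \<times> (real ^ 'n)) set" where
    "S n = {p. has_weak_grad (\<lambda>x. fst (p x)) (\<lambda>x. snd (p x)) \<and> integrable torus (\<lambda>x. (norm (p x))\<^sup>2) \<and>
       (\<integral>x. (norm (p x))\<^sup>2 \<partial>torus) \<le> C\<^sup>2 \<and> (\<integral>x. norm (fst (p x) - g x) \<partial>torus) \<le> 1 / real (Suc n)}" for n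
  have ip: "integrable torus p" if "p \<in> S n" for n p
  proof -
    have "has_weak_grad (\<lambda>x. fst (p x)) (\<lambda>x. snd (p x))" using that by (simp add: S_def)
    from has_weak_gradD(1,2)[OF this]
    have f: "integrable torus (\<lambda>x. fst (p x))" "integrable torus (\<lambda>x. snd (p x))" .
    have "integrable torus (\<lambda>x. (fst (p x), snd (p x)))"
    proof (rule Bochner_Integration.integrable_bound)
      show "integrable torus (\<lambda>x. norm (fst (p x)) + norm (snd (p x)))" using f by simp
      show "(\<lambda>x. (fst (p x), snd (p x))) \<in> borel_measurable torus"
        using f by (intro borel_measurable_Pair) auto
      show "AE x in torus. norm (fst (p x), snd (p x)) \<le> norm (norm (fst (p x)) + norm (snd (p x)))"
      proof (rule AE_I2)
        show "norm (fst (p x), snd (p x)) \<le> norm (norm (fst (p x)) + norm (snd (p x)))" for x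
          using norm_Pair_le[of "fst (p x)" "snd (p x)"] by simp
      qed
    qed
    then show ?thesis by simp
  qed
  have ig: "integrable torus (\<lambda>x. fst (p x) - g x)" if "p \<in> S n" for n p
  proof -
    have "has_weak_grad (\<lambda>x. fst (p x)) (\<lambda>x. snd (p x))" using that by (simp add: S_def)
    from has_weak_gradD(1)[OF this] g show ?thesis by simp
  qed
  obtain p k where p: "\<And>n. p n \<in> S n" and k: "integrable torus k" "(\<lambda>n. \<integral>x. norm (p n x - k x) \<partial>torus) \<longlonglongrightarrow> 0"
    "\<And>n. integrable torus (p n)" "integrable torus (\<lambda>x. (norm (k x))\<^sup>2)" "(\<integral>x. (norm (k x))\<^sup>2 \<partial>torus) \<le> C\<^sup>2"
  proof (rule midpoint_convex_L2[OF torus_prob_space, of S "C\<^sup>2"])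
    fix n k :: nat assume nk: "n \<le> k"
    have "1 / real (Suc k) \<le> 1 / real (Suc n)" using nk by (intro divide_left_mono) auto
    then show "S k \<subseteq> S n" unfolding S_def by (auto simp del: of_nat_Suc intro: order_trans)
  next
    fix n
    obtain j where j: "(\<integral>x. norm (f j x - g x) \<partial>torus) < 1 / real (Suc n)"
      using eventually_happens'[OF sequentially_bot order_tendstoD(2)[OF lim, of "1 / real (Suc n)"]] by auto
    have sq: "(norm (f j x, weak_grad (f j) x))\<^sup>2 = (f j x)\<^sup>2 + (norm (weak_grad (f j) x))\<^sup>2" for x
      by (simp add: norm_Pair)
    have "(\<lambda>x. (f j x, weak_grad (f j) x)) \<in> S n"
      unfolding S_def mem_Collect_eq fst_conv snd_conv sq
      using W12D[OF f(1)[of j]] j power_mono[OF f(2)[of j] W12_norm_nonneg, of 2] by (simp add: W12_norm_square)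
    then show "S n \<noteq> {}" by blast
  next
    fix n p p' assume p: "p \<in> S n" "p' \<in> S n"
    let ?m = "\<lambda>x. (1/2) *\<^sub>R (p x + p' x)"
    have wg: "has_weak_grad (\<lambda>x. (1/2) * fst (p x) + (1/2) * fst (p' x)) (\<lambda>x. (1/2) *\<^sub>R snd (p x) + (1/2) *\<^sub>R snd (p' x))"
      using p by (intro has_weak_grad_lincomb) (auto simp: S_def)
    have le: "(norm (?m x))\<^sup>2 \<le> (1/2) * (norm (p x))\<^sup>2 + (1/2) * (norm (p' x))\<^sup>2" for x
    proof -
      have "(norm (?m x))\<^sup>2 = (1/2) * (norm (p x))\<^sup>2 + (1/2) * (norm (p' x))\<^sup>2 - (1/4) * (norm (p x - p' x))\<^sup>2"
        by (simp add: power2_norm_eq_inner inner_add inner_diff algebra_simps)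
      then show ?thesis by simp
    qed
    have i: "integrable torus (\<lambda>x. (norm (p x))\<^sup>2)" "integrable torus (\<lambda>x. (norm (p' x))\<^sup>2)"
      using p by (auto simp: S_def)
    have [measurable]: "p \<in> borel_measurable torus" "p' \<in> borel_measurable torus" using ip[OF p(1)] ip[OF p(2)] by auto
    have im: "integrable torus (\<lambda>x. (norm (?m x))\<^sup>2)"
    proof (rule Bochner_Integration.integrable_bound)
      show "integrable torus (\<lambda>x. (1/2) * (norm (p x))\<^sup>2 + (1/2) * (norm (p' x))\<^sup>2)" using i by simp
      show "AE x in torus. norm ((norm (?m x))\<^sup>2) \<le> norm ((1/2) * (norm (p x))\<^sup>2 + (1/2) * (norm (p' x))\<^sup>2)"
        using le by (intro AE_I2) (simp add: order_trans)
    qed simp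
    have "(\<integral>x. (norm (?m x))\<^sup>2 \<partial>torus) \<le> (\<integral>x. (1/2) * (norm (p x))\<^sup>2 + (1/2) * (norm (p' x))\<^sup>2 \<partial>torus)"
      using i im le by (intro integral_mono) auto
    also have "\<dots> \<le> C\<^sup>2" using i p by (simp add: S_def)
    finally have 1: "(\<integral>x. (norm (?m x))\<^sup>2 \<partial>torus) \<le> C\<^sup>2" .
    have "(\<integral>x. norm (fst (?m x) - g x) \<partial>torus) \<le>
        (\<integral>x. (1/2) * norm (fst (p x) - g x) + (1/2) * norm (fst (p' x) - g x) \<partial>torus)"
    proof (rule integral_mono)
      show "integrable torus (\<lambda>x. norm (fst (?m x) - g x))"
        using has_weak_gradD(1)[OF wg] g by (simp add: distrib_left)
      show "integrable torus (\<lambda>x. (1/2) * norm (fst (p x) - g x) + (1/2) * norm (fst (p' x) - g x))"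
        using ig[OF p(1)] ig[OF p(2)] by simp
      show "norm (fst (?m x) - g x) \<le> (1/2) * norm (fst (p x) - g x) + (1/2) * norm (fst (p' x) - g x)" for x
        by (simp add: abs_if field_simps)
    qed
    also have "\<dots> = (1/2) * (\<integral>x. norm (fst (p x) - g x) \<partial>torus) + (1/2) * (\<integral>x. norm (fst (p' x) - g x) \<partial>torus)"
      using ig[OF p(1)] ig[OF p(2)] by simp
    also have "\<dots> \<le> (1/2) * (1 / real (Suc n)) + (1/2) * (1 / real (Suc n))"
      using p by (intro add_mono mult_left_mono) (auto simp: S_def)
    also have "\<dots> = 1 / real (Suc n)" by (rule trans[OF distrib_right[symmetric]]) simp
    finally have 2: "(\<integral>x. norm (fst (?m x) - g x) \<partial>torus) \<le> 1 / real (Suc n)" .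
    have eq: "(\<lambda>x. fst (?m x)) = (\<lambda>x. (1/2) * fst (p x) + (1/2) * fst (p' x))"
      "(\<lambda>x. snd (?m x)) = (\<lambda>x. (1/2) *\<^sub>R snd (p x) + (1/2) *\<^sub>R snd (p' x))"
      by (simp_all add: distrib_left scaleR_add_right)
    show "?m \<in> S n" unfolding S_def mem_Collect_eq
      by (intro conjI 1 2 im) (unfold eq, rule wg)
  next
    fix n p assume "p \<in> S n"
    then show "p \<in> borel_measurable torus" "integrable torus (\<lambda>x. (norm (p x))\<^sup>2)" "(\<integral>x. (norm (p x))\<^sup>2 \<partial>torus) \<le> C\<^sup>2"
      using ip by (auto simp: S_def)
  qed (rule that)
  have k1: "integrable torus (\<lambda>x. fst (k x))" "integrable torus (\<lambda>x. snd (k x))"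
    using integrable_bounded_linear[OF bounded_linear_fst k(1)] integrable_bounded_linear[OF bounded_linear_snd k(1)] by auto
  have i0: "integrable torus (\<lambda>x. norm (p n x - k x))" for n using k by simp
  have pw: "integrable torus (\<lambda>x. fst (p n x))" "integrable torus (\<lambda>x. snd (p n x))" for n
  proof -
    have "has_weak_grad (\<lambda>x. fst (p n x)) (\<lambda>x. snd (p n x))" using p[of n] by (simp add: S_def)
    from has_weak_gradD(1,2)[OF this]
    show "integrable torus (\<lambda>x. fst (p n x))" "integrable torus (\<lambda>x. snd (p n x))" .
  qed
  have l1: "(\<lambda>n. \<integral>x. norm (fst (p n x) - fst (k x)) \<partial>torus) \<longlonglongrightarrow> 0"
  proof (rule LIMSEQ_null_comparison[OF _ k(2)])
    show "norm (\<integral>x. norm (fst (p n x) - fst (k x)) \<partial>torus) \<le> (\<integral>x. norm (p n x - k x) \<partial>torus)" for n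
    proof -
      have "(\<integral>x. norm (fst (p n x) - fst (k x)) \<partial>torus) \<le> (\<integral>x. norm (p n x - k x) \<partial>torus)"
      proof (rule integral_mono[OF _ i0])
        show "integrable torus (\<lambda>x. norm (fst (p n x) - fst (k x)))" using pw k1 by simp
        show "norm (fst (p n x) - fst (k x)) \<le> norm (p n x - k x)" for x
          using dist_fst_le[of "p n x" "k x"] by (simp add: dist_norm)
      qed
      then show ?thesis by simp
    qed
  qed
  have l2: "(\<lambda>n. \<integral>x. norm (snd (p n x) - snd (k x)) \<partial>torus) \<longlonglongrightarrow> 0"
  proof (rule LIMSEQ_null_comparison[OF _ k(2)])
    show "norm (\<integral>x. norm (snd (p n x) - snd (k x)) \<partial>torus) \<le> (\<integral>x. norm (p n x - k x) \<partial>torus)" for n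
    proof -
      have "(\<integral>x. norm (snd (p n x) - snd (k x)) \<partial>torus) \<le> (\<integral>x. norm (p n x - k x) \<partial>torus)"
      proof (rule integral_mono[OF _ i0])
        show "integrable torus (\<lambda>x. norm (snd (p n x) - snd (k x)))" using pw k1 by simp
        show "norm (snd (p n x) - snd (k x)) \<le> norm (p n x - k x)" for x
          using dist_snd_le[of "p n x" "k x"] by (simp add: dist_norm)
      qed
      then show ?thesis by simp
    qed
  qed
  have "has_weak_grad (\<lambda>x. fst (k x)) (\<lambda>x. snd (k x))"
    using p by (intro has_weak_grad_L1_limit[OF _ k1 l1 l2]) (auto simp: S_def)
  \<comment> \<open>Membership in \<open>S n\<close> puts the first components within
    \<open>1 / real (Suc n)\<close> of \<open>g\<close> in L1, so their limit is
    \<open>g\<close>.\<close>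
  have eq: "AE x in torus. fst (k x) = g x"
  proof -
    have "(\<integral>x. norm (fst (k x) - g x) \<partial>torus) \<le> (\<integral>x. norm (fst (p n x) - fst (k x)) \<partial>torus) + 1 / real (Suc n)" for n
    proof -
      have "(\<integral>x. norm (fst (k x) - g x) \<partial>torus) \<le> (\<integral>x. norm (fst (p n x) - fst (k x)) + norm (fst (p n x) - g x) \<partial>torus)"
        using k1 g pw by (intro integral_mono) auto
      also have "\<dots> = (\<integral>x. norm (fst (p n x) - fst (k x)) \<partial>torus) + (\<integral>x. norm (fst (p n x) - g x) \<partial>torus)"
        using k1 g pw[of n] by (intro Bochner_Integration.integral_add) auto
      finally show ?thesis using p[of n] by (simp add: S_def)
    qed
    moreover have "(\<lambda>n. (\<integral>x. norm (fst (p n x) - fst (k x)) \<partial>torus) + 1 / real (Suc n)) \<longlonglongrightarrow> 0 + 0"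
      by (intro tendsto_add l1 LIMSEQ_Suc[OF lim_const_over_n])
    ultimately have "(\<integral>x. norm (fst (k x) - g x) \<partial>torus) \<le> 0"
      by (intro LIMSEQ_le_const[of _ 0]) auto
    moreover have "0 \<le> (\<integral>x. norm (fst (k x) - g x) \<partial>torus)" by simp
    ultimately have "(\<integral>x. norm (fst (k x) - g x) \<partial>torus) = 0" by linarith
    then have "AE x in torus. norm (fst (k x) - g x) = 0"
      using k1 g by (subst (asm) integral_nonneg_eq_0_iff_AE) auto
    then show ?thesis by eventually_elim simp
  qed
  note [measurable] = borel_measurable_integrable[OF g] borel_measurable_integrable[OF k(1)]
    borel_measurable_integrable[OF k1(1)] borel_measurable_integrable[OF k1(2)]
  have wgk: "has_weak_grad g (\<lambda>x. snd (k x))"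
    unfolding has_weak_grad_iff
  proof (intro conjI allI impI g k1)
    fix \<phi> :: "real ^ 'n \<Rightarrow> real" and i assume t: "test_fun \<phi>"
    have [measurable]: "partial_deriv i \<phi> \<in> borel_measurable torus"
      using integrable_test_fun[OF test_fun_partial_deriv[OF t]] by simp
    have "(\<integral>x. g x * partial_deriv i \<phi> x \<partial>torus) = (\<integral>x. fst (k x) * partial_deriv i \<phi> x \<partial>torus)"
      using eq by (intro integral_cong_AE) (auto elim: eventually_mono)
    then show "(\<integral>x. g x * partial_deriv i \<phi> x \<partial>torus) = - (\<integral>x. snd (k x) $ i * \<phi> x \<partial>torus)"
      using has_weak_gradD(4)[OF \<open>has_weak_grad (\<lambda>x. fst (k x)) (\<lambda>x. snd (k x))\<close> t, of i] by simp
  qed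
  have sq: "AE x in torus. (norm (k x))\<^sup>2 = (g x)\<^sup>2 + (norm (snd (k x)))\<^sup>2"
    using eq by eventually_elim (simp add: norm_prod_def)
  have i: "integrable torus (\<lambda>x. (g x)\<^sup>2)" "integrable torus (\<lambda>x. (norm (snd (k x)))\<^sup>2)"
  proof -
    have sqb: "norm a \<le> norm (a + b)" "norm b \<le> norm (a + b)" if "0 \<le> a" "0 \<le> b" for a b :: real
      using that by simp_all
    have "AE x in torus. norm ((g x)\<^sup>2) \<le> norm ((norm (k x))\<^sup>2)"
      using sq by eventually_elim (simp only: sqb zero_le_power2)
    then show "integrable torus (\<lambda>x. (g x)\<^sup>2)" by (rule Bochner_Integration.integrable_bound[OF k(4), rotated]) simp
    have "AE x in torus. norm ((norm (snd (k x)))\<^sup>2) \<le> norm ((norm (k x))\<^sup>2)"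
      using sq by eventually_elim (simp only: sqb zero_le_power2)
    then show "integrable torus (\<lambda>x. (norm (snd (k x)))\<^sup>2)"
      by (rule Bochner_Integration.integrable_bound[OF k(4), rotated]) simp
  qed
  have "(\<integral>x. (g x)\<^sup>2 \<partial>torus) + (\<integral>x. (norm (snd (k x)))\<^sup>2 \<partial>torus) = (\<integral>x. (g x)\<^sup>2 + (norm (snd (k x)))\<^sup>2 \<partial>torus)"
    using i by simp
  also have "\<dots> = (\<integral>x. (norm (k x))\<^sup>2 \<partial>torus)"
    proof (rule integral_cong_AE)
    show "AE x in torus. (g x)\<^sup>2 + (norm (snd (k x)))\<^sup>2 = (norm (k x))\<^sup>2"
      using sq by eventually_elim simp
  qed simp_all
  also have "\<dots> \<le> C\<^sup>2" by (rule k(5))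
  finally have "sqrt ((\<integral>x. (g x)\<^sup>2 \<partial>torus) + (\<integral>x. (norm (snd (k x)))\<^sup>2 \<partial>torus)) \<le> sqrt (C\<^sup>2)"
    by (rule real_sqrt_le_mono)
  then show "g \<in> W12" "W12_norm g \<le> C"
    using W12I[OF wgk i] C by simp_all
qed

section \<open>Higher integrability in low dimensions\<close>

lemma content_small_box:
  assumes "0 < (r :: real)" shows "measure lborel (cbox 0 (r *\<^sub>R 1 :: real ^ 'n)) = r ^ CARD('n)"
proof -
  have "cbox 0 (r *\<^sub>R 1 :: real ^ 'n) \<noteq> {}"
    using assms by (simp add: interval_ne_empty_cart)
  then show ?thesis by (simp add: content_cbox_cart)
qed

text \<open>\<open>A x\<close> is the mean of \<open>w\<close> over the cube of side
  \<open>r\<close> with upper corner \<open>x\<close>. The L2 norm of \<open>w\<close> bounds it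
  pointwise by a power of \<open>1 / r\<close>; the gradient bounds its L2 distance to
  \<open>w\<close> by a multiple of \<open>r\<close>. These are the two ends of the interpolation
  below.\<close>

lemma box_average:
  fixes w :: "real ^ 'n \<Rightarrow> real" and r C :: real
  assumes w: "test_fun w" and r: "0 < r" "r \<le> 1"
    and C: "(\<integral>x. (w x)\<^sup>2 \<partial>torus) \<le> C\<^sup>2" "(\<integral>x. (norm (grad w x))\<^sup>2 \<partial>torus) \<le> C\<^sup>2"
  obtains A where "continuous_on UNIV A" "\<And>x. (A x)\<^sup>2 * r ^ CARD('n) \<le> C\<^sup>2"
    "(\<integral>x. (A x - w x)\<^sup>2 \<partial>torus) \<le> CARD('n) * r\<^sup>2 * C\<^sup>2"
proof -
  let ?Q = "cbox 0 (r *\<^sub>R 1 :: real ^ 'n)"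
  define M where "M = lebesgue_on ?Q"
  define v where "v = r ^ CARD('n)"
  have v: "0 < v" using r by (simp add: v_def)
  have cw: "continuous_on UNIV w" by (rule test_fun_continuous_on[OF w])
  have i: "integrable M f" if "continuous_on UNIV f" for f :: "real ^ 'n \<Rightarrow> real"
    using that unfolding M_def by (intro continuous_imp_integrable) (auto intro: continuous_on_subset)
  have c: "continuous_on UNIV (\<lambda>z. w (x - z))" for x
    by (intro continuous_on_compose2[OF cw] continuous_intros) auto
  have sp: "space M = ?Q" by (simp add: M_def)
  have mM: "measure M ?Q = v"
  proof -
    have "measure M ?Q = measure lebesgue ?Q" unfolding M_def by (subst measure_restrict_space) auto
    also have "\<dots> = v" using content_small_box[OF r(1), where 'n = 'n] by (simp add: v_def)
    finally show ?thesis .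
  qed
  define A where "A x = (\<integral>z. (1 / v) * w (x - z) \<partial>M)" for x
  have const: "(\<integral>z. (c :: real) \<partial>M) = v * c" for c using mM by (simp add: sp)
  have A_diff: "A x - w x = (\<integral>z. (1 / v) * (w (x - z) - w x) \<partial>M)" for x
  proof -
    have "(\<integral>z. (1 / v) * (w (x - z) - w x) \<partial>M) = (\<integral>z. (1 / v) * w (x - z) - (1 / v) * w x \<partial>M)"
      by (simp add: right_diff_distrib)
    also have "\<dots> = A x - (\<integral>z. (1 / v) * w x \<partial>M)"
      unfolding A_def
      by (intro Bochner_Integration.integral_diff i continuous_on_mult[OF continuous_on_const c] continuous_on_const)
    finally show ?thesis using const[of "(1 / v) * w x"] v by simp
  qed
  show thesis
  proof (rule that[of A])
    have "continuous_on UNIV (\<lambda>x. integral ?Q (\<lambda>z. (1 / v) * w (x - z)))"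
      by (intro integral_continuous_on_param)
        (use v in \<open>auto simp: case_prod_beta' intro!: continuous_intros continuous_on_compose2[OF cw]\<close>)
    moreover have "A x = integral ?Q (\<lambda>z. (1 / v) * w (x - z))" for x
      unfolding A_def M_def
      by (intro integral_torus_eq) (use v in \<open>auto intro!: continuous_intros continuous_on_compose2[OF cw]\<close>)
    ultimately show "continuous_on UNIV A" by simp
  next
    fix x
    define a where "a z = w (x - z)" for z
    have ca: "continuous_on UNIV a" unfolding a_def by (rule c)
    have A: "A x = (1 / v) * (\<integral>z. a z \<partial>M)" by (simp add: A_def a_def)
    \<comment> \<open>Expanding this nonnegative variance bounds the square of the mean by the mean
      of the square.\<close>
    have "0 \<le> (\<integral>z. (a z - A x)\<^sup>2 \<partial>M)" by simp
    also have "(\<lambda>z. (a z - A x)\<^sup>2) = (\<lambda>z. (a z)\<^sup>2 - 2 * A x * a z + (A x)\<^sup>2)"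
      by (simp add: fun_eq_iff power2_diff mult_ac)
    also have "(\<integral>z. (a z)\<^sup>2 - 2 * A x * a z + (A x)\<^sup>2 \<partial>M) = (\<integral>z. (a z)\<^sup>2 \<partial>M) - 2 * A x * (\<integral>z. a z \<partial>M) + v * (A x)\<^sup>2"
      using i[OF ca] i[OF continuous_on_power[OF ca, of 2]] i[OF continuous_on_const, of "(A x)\<^sup>2"] const[of "(A x)\<^sup>2"]
      by simp
    also have "(\<integral>z. a z \<partial>M) = v * A x" using A v by simp
    finally have 1: "(A x)\<^sup>2 * v \<le> (\<integral>z. (a z)\<^sup>2 \<partial>M)" by (simp add: power2_eq_square algebra_simps)
    \<comment> \<open>Here \<open>r \<le> 1\<close> enters: the small cube fits into one period
      cell, so its integral is at most that over the torus.\<close>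
    have sub: "?Q \<subseteq> cbox 0 1"
    proof
      fix y :: "real ^ 'n" assume "y \<in> ?Q"
      then have "0 \<le> y $ i \<and> y $ i \<le> r" for i by (simp add: mem_box_cart)
      then have "0 \<le> y $ i \<and> y $ i \<le> 1" for i using r(2) order_trans by blast
      then show "y \<in> cbox 0 1" by (simp add: mem_box_cart)
    qed
    have "(\<integral>z. (a z)\<^sup>2 \<partial>M) = integral ?Q (\<lambda>z. (a z)\<^sup>2)"
      unfolding M_def by (intro integral_torus_eq continuous_on_power continuous_on_subset[OF ca]) auto
    also have "\<dots> \<le> integral (cbox 0 1) (\<lambda>z. (a z)\<^sup>2)"
      by (intro integral_subset_le sub integrable_continuous continuous_on_power continuous_on_subset[OF ca]) auto
    also have "\<dots> = (\<integral>z. (a z)\<^sup>2 \<partial>torus)"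
      by (intro integral_torus_eq[symmetric] continuous_on_power continuous_on_subset[OF ca]) auto
    also have "\<dots> = (\<integral>z. (w z)\<^sup>2 \<partial>torus)"
      unfolding a_def using test_fun_periodic[OF w]
      by (intro periodic_integral_reflect[of "\<lambda>z. (w z)\<^sup>2"] continuous_on_power cw) (auto simp: periodic_def)
    finally show "(A x)\<^sup>2 * r ^ CARD('n) \<le> C\<^sup>2" using 1 C(1) by (simp add: v_def)
  next
    let ?G = "\<integral>x. (norm (grad w x))\<^sup>2 \<partial>torus"
    have cg: "continuous_on UNIV (grad w)" by (rule continuous_on_grad[OF w])
    have "(\<integral>x. (\<integral>z. (1 / v) * (w (x - z) - w x) \<partial>M)\<^sup>2 \<partial>torus) \<le> (\<integral>z. (1 / v) * ((norm (- z))\<^sup>2 * ?G) \<partial>M)"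
      unfolding M_def
    proof (rule averaging_estimate[OF w, where q = "\<lambda>t. t\<^sup>2" and h = "\<lambda>z. (norm z)\<^sup>2 * ?G" and \<rho> = "\<lambda>z. 1 / v"])
      show "convex_on UNIV (\<lambda>t::real. t\<^sup>2)" by (rule convex_power2)
      show "(\<integral>z. 1 / v \<partial>lebesgue_on ?Q) = 1" using const[of "1 / v"] v by (simp add: M_def)
      fix z :: "real ^ 'n"
      have "(\<integral>x. (grad w x \<bullet> z)\<^sup>2 \<partial>torus) \<le> (\<integral>x. (norm z)\<^sup>2 * (norm (grad w x))\<^sup>2 \<partial>torus)"
      proof (rule integral_mono)
        show "(grad w x \<bullet> z)\<^sup>2 \<le> (norm z)\<^sup>2 * (norm (grad w x))\<^sup>2" for x
          using Cauchy_Schwarz_ineq[of "grad w x" z] by (simp add: power2_norm_eq_inner mult.commute)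
      qed (intro integrable_torus_continuous continuous_intros continuous_on_subset[OF cg], simp)+
      then show "(\<integral>x. (grad w x \<bullet> z)\<^sup>2 \<partial>torus) \<le> (norm z)\<^sup>2 * ?G" by simp
    qed (use v in \<open>auto intro!: continuous_intros\<close>)
    also have "\<dots> \<le> (\<integral>z. (1 / v) * (CARD('n) * r\<^sup>2 * C\<^sup>2) \<partial>M)"
    proof (rule integral_mono)
      show "integrable M (\<lambda>z. (1 / v) * ((norm (- z))\<^sup>2 * ?G))" by (intro i continuous_intros)
      show "integrable M (\<lambda>z. (1 / v) * (CARD('n) * r\<^sup>2 * C\<^sup>2))" by (intro i continuous_intros)
      fix z assume "z \<in> space M"
      then have z: "0 \<le> z $ j" "z $ j \<le> r" for j by (auto simp: sp mem_box_cart)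
      have "(norm z)\<^sup>2 = (\<Sum>j\<in>UNIV. (z $ j)\<^sup>2)"
        unfolding power2_norm_eq_inner inner_vec_def by (simp add: power2_eq_square)
      also have "\<dots> \<le> (\<Sum>j\<in>(UNIV :: 'n set). r\<^sup>2)" using z by (intro sum_mono power_mono) auto
      finally have "(norm z)\<^sup>2 \<le> CARD('n) * r\<^sup>2" by simp
      then show "(1 / v) * ((norm (- z))\<^sup>2 * ?G) \<le> (1 / v) * (CARD('n) * r\<^sup>2 * C\<^sup>2)"
        using v C(2) by (intro mult_left_mono mult_mono) auto
    qed
    also have "\<dots> = CARD('n) * r\<^sup>2 * C\<^sup>2" using const[of "(1 / v) * (CARD('n) * r\<^sup>2 * C\<^sup>2)"] v by simp
    finally show "(\<integral>x. (A x - w x)\<^sup>2 \<partial>torus) \<le> CARD('n) * r\<^sup>2 * C\<^sup>2" by (simp only: A_diff)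
  qed
qed

text \<open>The first summand bounds the part where the function is at most \<open>2 * C\<close>;
  the second is a geometric series over dyadic heights. Here \<open>3/4 = 11/4 - 2\<close>, the 5 is
  the largest dimension, and the ratio has exponent \<open>3/4 - 4/5 = -1/20\<close>.\<close>

definition sobolev_const :: "real \<Rightarrow> real" where
  "sobolev_const C = (2 * C) powr (11/4) + 
     4 * 2 powr (11/4) * (2 * C) powr (3/4) * (5 * C\<^sup>2) * (1 / (1 - 2 powr (- (1/20))))"

text \<open>At a point where \<open>w\<close> exceeds \<open>2 ^ j * (2 * C)\<close> in modulus, it
  differs from its average at scale \<open>r j\<close> by at least half that height, because the
  average is at most \<open>2 ^ j * C\<close>. The L2 norms of these differences decay, and the
  weighted sum over \<open>j\<close> converges. With an exponent \<open>q\<close> the terms behave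
  like 2 to the power \<open>j * (q - 2 - 4/n)\<close>, which for \<open>n \<le> 5\<close> requires
  \<open>q < 14/5\<close>. The application needs \<open>q \<ge> 8/3\<close>, and \<open>11/4\<close>
  lies between.\<close>

lemma sobolev_test_fun:
  fixes w :: "real ^ 'n \<Rightarrow> real"
  assumes w: "test_fun w" and n: "CARD('n) \<le> 5" and C0: "0 < C"
    and C: "(\<integral>x. (w x)\<^sup>2 \<partial>torus) \<le> C\<^sup>2" "(\<integral>x. (norm (grad w x))\<^sup>2 \<partial>torus) \<le> C\<^sup>2"
  shows "(\<integral>x. \<bar>w x\<bar> powr (11/4) \<partial>torus) \<le> sobolev_const C"
proof -
  have cw: "continuous_on UNIV w" by (rule test_fun_continuous_on[OF w])
  \<comment> \<open>The scale at which the pointwise bound on the average grows exactly like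
    \<open>2 ^ j\<close>.\<close>
  define r where "r j = 2 powr (- 2 * real j / CARD('n))" for j
  have r: "0 < r j" "r j \<le> 1" for j
    using powr_mono[of "- 2 * real j / CARD('n)" 0 2] by (auto simp: r_def)
  have "\<forall>j. \<exists>A. continuous_on UNIV A \<and> (\<forall>x. (A x)\<^sup>2 * r j ^ CARD('n) \<le> C\<^sup>2) \<and>
      (\<integral>x. (A x - w x)\<^sup>2 \<partial>torus) \<le> CARD('n) * (r j)\<^sup>2 * C\<^sup>2"
  proof
    show "\<exists>A. continuous_on UNIV A \<and> (\<forall>x. (A x)\<^sup>2 * r j ^ CARD('n) \<le> C\<^sup>2) \<and>
      (\<integral>x. (A x - w x)\<^sup>2 \<partial>torus) \<le> CARD('n) * (r j)\<^sup>2 * C\<^sup>2" for j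
      by (rule box_average[OF w r[of j] C]) blast
  qed
  from choice[OF this] obtain A where A: "\<And>j. continuous_on UNIV (A j)" "\<And>j x. (A j x)\<^sup>2 * r j ^ CARD('n) \<le> C\<^sup>2"
    "\<And>j. (\<integral>x. (A j x - w x)\<^sup>2 \<partial>torus) \<le> CARD('n) * (r j)\<^sup>2 * C\<^sup>2" by blast
  have rn: "r j ^ CARD('n) = (1 / 2 ^ j)\<^sup>2" for j
  proof -
    have "r j ^ CARD('n) = 2 powr (- 2 * real j / CARD('n) * CARD('n))"
      by (simp add: r_def powr_power)
    also have "\<dots> = 2 powr (- (2 * real j))" by simp
    also have "\<dots> = 1 / 2 ^ (2 * j)"
      using powr_realpow[of 2 "2 * j"] by (simp add: powr_minus_divide)
    also have "\<dots> = (1 / 2 ^ j)\<^sup>2" by (simp add: power_divide power_even_eq)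
    finally show ?thesis .
  qed
  have Ale: "\<bar>A j x\<bar> \<le> 2 ^ j * C" for j x
  proof -
    have "(A j x)\<^sup>2 \<le> (2 ^ j * C)\<^sup>2"
      using A(2)[of j x] unfolding rn by (simp add: power_divide power_mult_distrib field_simps)
    then have "\<bar>A j x\<bar> \<le> \<bar>2 ^ j * C\<bar>" by (simp add: abs_le_square_iff)
    then show ?thesis using C0 by simp
  qed
  obtain D where D: "0 < D" "\<And>x. x \<in> cbox 0 1 \<Longrightarrow> norm (w x) \<le> D"
    using continuous_torus_bounded[OF cw] by blast
  \<comment> \<open>Enough dyadic levels to reach the maximum of \<open>w\<close>. \<open>J\<close>
    depends on \<open>w\<close>, but the final bound does not depend on \<open>J\<close>.\<close>
  obtain J :: nat where "D / (2 * C) < 2 ^ J" using real_arch_pow[of 2 "D / (2 * C)"] by auto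
  then have J: "D \<le> 2 ^ J * (2 * C)" using C0 by (simp add: field_simps)
  \<comment> \<open>With \<open>l = 2 ^ j * (2 * C)\<close> and a value of \<open>w\<close> between
    \<open>l\<close> and \<open>2 * l\<close>, the power \<open>11/4\<close> is at most 2 to the
    \<open>11/4\<close> times \<open>l powr (3/4) * l\<^sup>2\<close>, and \<open>l\<^sup>2\<close>
    is at most 4 times the squared difference from the average.\<close>
  define c where "c j = 4 * 2 powr (11/4) * (2 ^ j * (2 * C)) powr (3/4)" for j
  have c: "0 \<le> c j" for j by (simp add: c_def)
  have pw: "\<bar>w x\<bar> powr (11/4) \<le> (2 * C) powr (11/4) + (\<Sum>j<J. c j * (A j x - w x)\<^sup>2)" if x: "x \<in> cbox 0 1" for x
  proof (cases "\<bar>w x\<bar> \<le> 2 * C")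
    case True
    then have "\<bar>w x\<bar> powr (11/4) \<le> (2 * C) powr (11/4)" by (intro powr_mono2) auto
    moreover have "0 \<le> (\<Sum>j<J. c j * (A j x - w x)\<^sup>2)" using c by (intro sum_nonneg) auto
    ultimately show ?thesis by linarith
  next
    case False
    define P where "P j \<longleftrightarrow> \<bar>w x\<bar> \<le> 2 ^ j * (2 * C)" for j :: nat
    have PJ: "P J" using D(2)[OF x] J by (simp add: P_def)
    have nP0: "\<not> P 0" using False by (simp add: P_def)
    \<comment> \<open>\<open>Suc k\<close> is the first dyadic level not below the value at
      \<open>x\<close>; it is not the zeroth, since that value exceeds \<open>2 * C\<close>.\<close>
    obtain k where k: "\<not> P k" "P (Suc k)" "k < J"
    proof -
      define k where "k = (LEAST j. P j)"
      have "P k" unfolding k_def by (rule LeastI[of P, OF PJ])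
      then have "k \<noteq> 0" using nP0 by metis
      then obtain k' where k': "k = Suc k'" by (cases k) auto
      have "\<not> P k'" using not_less_Least[of k' P] k' by (simp add: k_def)
      moreover have "k \<le> J" unfolding k_def by (rule Least_le[of P, OF PJ])
      ultimately show ?thesis using that[of k'] k' \<open>P k\<close> by simp
    qed
    let ?l = "2 ^ k * (2 * C)"
    have l: "0 < ?l" using C0 by simp
    have lw: "?l < \<bar>w x\<bar>" "\<bar>w x\<bar> \<le> 2 * ?l" using k by (auto simp: P_def)
    have "?l / 2 \<le> \<bar>A k x - w x\<bar>" using Ale[of k x] lw by linarith
    then have "(?l / 2)\<^sup>2 \<le> \<bar>A k x - w x\<bar>\<^sup>2" using l by (intro power_mono) linarith+
    have gen: "1 \<le> 4 / L\<^sup>2 * d\<^sup>2" if "0 < L" "(L / 2)\<^sup>2 \<le> \<bar>d\<bar>\<^sup>2" for L d :: real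
      using that by (simp add: field_simps power_divide)
    have sq: "1 \<le> 4 / ?l\<^sup>2 * (A k x - w x)\<^sup>2" by (rule gen) fact+
    have "\<bar>w x\<bar> powr (11/4) \<le> (2 * ?l) powr (11/4)" using lw by (intro powr_mono2) auto
    also have "\<dots> = 2 powr (11/4) * ?l powr (11/4) * 1"
      using powr_mult[of 2 ?l "11/4"] l by (simp only: mult_1_right)
    also have "\<dots> \<le> 2 powr (11/4) * ?l powr (11/4) * (4 / ?l\<^sup>2 * (A k x - w x)\<^sup>2)"
      using sq by (intro mult_left_mono) auto
    also have "?l powr (11/4) = ?l powr (3/4) * ?l\<^sup>2"
      using l powr_add[of ?l "3/4" 2] by (simp add: powr_numeral)
    also have "2 powr (11/4) * (?l powr (3/4) * ?l\<^sup>2) * (4 / ?l\<^sup>2 * (A k x - w x)\<^sup>2) = c k * (A k x - w x)\<^sup>2"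
      using l by (simp add: c_def)
    also have "\<dots> \<le> (\<Sum>j<J. c j * (A j x - w x)\<^sup>2)"
      using k(3) c by (intro member_le_sum) auto
    finally have "\<bar>w x\<bar> powr (11/4) \<le> (\<Sum>j<J. c j * (A j x - w x)\<^sup>2)" .
    moreover have "0 \<le> (2 * C) powr (11/4)" by simp
    ultimately show ?thesis by linarith
  qed
  have iA: "integrable torus (\<lambda>x. (A j x - w x)\<^sup>2)" for j
    by (intro integrable_torus_continuous continuous_intros continuous_on_subset[OF A(1)] continuous_on_subset[OF cw]) auto
  have "(\<integral>x. \<bar>w x\<bar> powr (11/4) \<partial>torus) \<le> (\<integral>x. (2 * C) powr (11/4) + (\<Sum>j<J. c j * (A j x - w x)\<^sup>2) \<partial>torus)"
  proof (rule integral_mono)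
    show "integrable torus (\<lambda>x. \<bar>w x\<bar> powr (11/4))"
      by (intro integrable_torus_continuous continuous_on_powr' continuous_intros continuous_on_subset[OF cw]) auto
    show "integrable torus (\<lambda>x. (2 * C) powr (11/4) + (\<Sum>j<J. c j * (A j x - w x)\<^sup>2))" using iA by simp
  qed (use pw in simp)
  also have "\<dots> = (2 * C) powr (11/4) + (\<Sum>j<J. c j * (\<integral>x. (A j x - w x)\<^sup>2 \<partial>torus))"
    using iA torus.prob_space[where 'n = 'n] by simp
  also have "\<dots> \<le> (2 * C) powr (11/4) + (\<Sum>j<J. 4 * 2 powr (11/4) * (2 * C) powr (3/4) * (5 * C\<^sup>2) * (2 powr (- (1/20))) ^ j)"
  proof (intro add_left_mono sum_mono)
    fix j
    have ceq: "c j = 4 * 2 powr (11/4) * ((2 powr (3/4 * real j)) * (2 * C) powr (3/4))"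
    proof -
      have "(2 ^ j * (2 * C)) powr (3/4) = (2 powr real j) powr (3/4) * (2 * C) powr (3/4)"
        using powr_realpow[of 2 j] by (simp only: powr_mult[of "2 ^ j" "2 * C"])
      then show ?thesis unfolding c_def by (simp only: powr_powr mult.commute)
    qed
    \<comment> \<open>Growth \<open>3/4\<close> of the weights against decay \<open>4/5\<close> of
      the squared scales in the worst dimension 5 leaves a convergent geometric series.\<close>
    have geo: "2 powr (3/4 * real j) * 2 powr (- (4/5) * real j) = (2 powr (- (1/20))) ^ j"
      by (simp add: powr_power flip: powr_add)
    have "c j * (\<integral>x. (A j x - w x)\<^sup>2 \<partial>torus) \<le> c j * (CARD('n) * (r j)\<^sup>2 * C\<^sup>2)"
      by (intro mult_left_mono A c)
    also have "\<dots> \<le> c j * (5 * 2 powr (- (4/5) * real j) * C\<^sup>2)"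
    proof (intro mult_left_mono mult_mono mult_right_mono c)
      have "(r j)\<^sup>2 = 2 powr (- (4 / CARD('n)) * real j)"
        by (simp add: r_def power2_eq_square flip: powr_add)
      also have "\<dots> \<le> 2 powr (- (4/5) * real j)"
      proof (intro powr_mono mult_right_mono)
        have "4 / 5 \<le> 4 / real CARD('n)" using n by (intro divide_left_mono) auto
        then show "- (4 / real CARD('n)) \<le> - (4/5)" by simp
      qed auto
      finally show "(r j)\<^sup>2 \<le> 2 powr (- (4/5) * real j)" .
    qed (use n in auto)
    also have "c j * (5 * 2 powr (- (4/5) * real j) * C\<^sup>2) =
        4 * 2 powr (11/4) * (2 * C) powr (3/4) * (5 * C\<^sup>2) * (2 powr (3/4 * real j) * 2 powr (- (4/5) * real j))"
      unfolding ceq by (simp only: mult_ac)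
    also note geo
    finally show "c j * (\<integral>x. (A j x - w x)\<^sup>2 \<partial>torus) \<le>
        4 * 2 powr (11/4) * (2 * C) powr (3/4) * (5 * C\<^sup>2) * (2 powr (- (1/20))) ^ j" .
  qed
  also have "\<dots> \<le> sobolev_const C"
  proof -
    define q where "q = 2 powr (- (1/20) :: real)"
    have q: "0 < q" "q < 1" using powr_less_mono[of "- (1/20)" 0 "2::real"] by (auto simp: q_def)
    have "(\<Sum>j<J. q ^ j) = (1 - q ^ J) / (1 - q)" using q by (simp add: sum_gp_strict)
    also have "\<dots> \<le> 1 / (1 - q)" using q by (intro divide_right_mono) auto
    finally show ?thesis
      unfolding sobolev_const_def sum_distrib_left[symmetric] q_def[symmetric]
      by (intro add_left_mono mult_left_mono) auto
  qed
  finally show ?thesis .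
qed

text \<open>Smoothing does not increase the L2 norms of a function and its weak gradient, so the
  bound for test functions is uniform along the smoothings; Fatou's lemma passes it to the
  limit.\<close>

lemma sobolev_W12:
  fixes f :: "real ^ 'n \<Rightarrow> real"
  assumes f: "f \<in> W12" "W12_norm f \<le> C" and n: "CARD('n) \<le> 5" and C0: "0 < C"
  shows "integrable torus (\<lambda>x. \<bar>f x\<bar> powr (11/4))" "(\<integral>x. \<bar>f x\<bar> powr (11/4) \<partial>torus) \<le> sobolev_const C"
proof -
  note W = W12D[OF f(1)]
  note wg = has_weak_gradD[OF W(1)]
  define w where "w N = smooth N f" for N
  have tw: "test_fun (w N)" for N unfolding w_def by (intro test_fun_smooth W)
  have iG: "integrable torus (\<lambda>x. (weak_grad f x $ i)\<^sup>2)" for i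
  proof (rule Bochner_Integration.integrable_bound[OF W(3)])
    show "(\<lambda>x. (weak_grad f x $ i)\<^sup>2) \<in> borel_measurable torus" using wg(3)[of i] by simp
    show "AE x in torus. norm ((weak_grad f x $ i)\<^sup>2) \<le> norm ((norm (weak_grad f x))\<^sup>2)"
      using component_le_norm_cart by (intro AE_I2) (simp add: abs_le_square_iff[symmetric])
  qed
  have norm_sum: "(norm y)\<^sup>2 = (\<Sum>i\<in>UNIV. (y $ i)\<^sup>2)" for y :: "real ^ 'n"
    unfolding power2_norm_eq_inner inner_vec_def by (simp add: power2_eq_square)
  have b: "(\<integral>x. \<bar>w N x\<bar> powr (11/4) \<partial>torus) \<le> sobolev_const C" for N
  proof (rule sobolev_test_fun[OF tw n C0])
    have "(\<integral>x. (w N x)\<^sup>2 \<partial>torus) \<le> (\<integral>x. (f x)\<^sup>2 \<partial>torus)"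
      unfolding w_def by (intro smooth_L2_contraction W)
    then show "(\<integral>x. (w N x)\<^sup>2 \<partial>torus) \<le> C\<^sup>2" using W12_norm_leD(1)[OF f(2)] by linarith
    have pd: "partial_deriv i (w N) x = smooth N (\<lambda>x. weak_grad f x $ i) x" for i x
      unfolding w_def by (intro partial_deriv_smooth_weak W wg(4))
    have it: "integrable torus (\<lambda>x. (smooth N (\<lambda>x. weak_grad f x $ i) x)\<^sup>2)" for i
      unfolding power2_eq_square by (intro integrable_test_fun test_fun_mult test_fun_smooth wg(3))
    have "(\<integral>x. (norm (grad (w N) x))\<^sup>2 \<partial>torus) = (\<Sum>i\<in>UNIV. (\<integral>x. (smooth N (\<lambda>x. weak_grad f x $ i) x)\<^sup>2 \<partial>torus))"
      using it by (simp add: norm_sum grad_def pd)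
    also have "\<dots> \<le> (\<Sum>i\<in>UNIV. (\<integral>x. (weak_grad f x $ i)\<^sup>2 \<partial>torus))"
      by (intro sum_mono smooth_L2_contraction wg(3) iG)
    also have "\<dots> = (\<integral>x. (norm (weak_grad f x))\<^sup>2 \<partial>torus)" using iG by (simp add: norm_sum)
    finally show "(\<integral>x. (norm (grad (w N) x))\<^sup>2 \<partial>torus) \<le> C\<^sup>2" using W12_norm_leD(2)[OF f(2)] by linarith
  qed
  have ca: "continuous_on UNIV (\<lambda>x. \<bar>w N x\<bar> powr (11/4))" for N
    by (intro continuous_on_powr' continuous_intros test_fun_continuous_on tw) auto
  have "(\<lambda>N. \<integral>x. norm (w N x - f x) \<partial>torus) \<longlonglongrightarrow> 0"
    using smooth_tendsto_L1[OF W(4)] by (simp add: w_def)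
  from L1_AE_subseq[OF integrable_test_fun[OF tw] W(4) this]
  obtain s where s: "strict_mono s" "AE x in torus. (\<lambda>n. w (s n) x) \<longlonglongrightarrow> f x" by metis
  have lim: "AE x in torus. (\<lambda>n. \<bar>w (s n) x\<bar> powr (11/4)) \<longlonglongrightarrow> \<bar>f x\<bar> powr (11/4)"
    using s(2) by eventually_elim (intro tendsto_powr' tendsto_intros; simp)
  have i: "integrable torus (\<lambda>x. \<bar>w (s n) x\<bar> powr (11/4))" for n
    by (intro integrable_torus_continuous continuous_on_subset[OF ca]) auto
  note [measurable] = borel_measurable_integrable[OF W(4)]
  have m: "(\<lambda>x. \<bar>f x\<bar> powr (11/4)) \<in> borel_measurable torus" by measurable
  show "integrable torus (\<lambda>x. \<bar>f x\<bar> powr (11/4))" "(\<integral>x. \<bar>f x\<bar> powr (11/4) \<partial>torus) \<le> sobolev_const C"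
    using fatou_real[OF i m _ lim b] by simp_all
qed

section \<open>The coupling and bounds on solutions\<close>

text \<open>Beyond the point \<open>T\<close> with \<open>\<delta> * T powr (b - a) = 1\<close> the
  higher power dominates, and below it the lower power is bounded. This supplies the small multiples
  required for uniform integrability.\<close>

lemma powr_le_epsilon_powr:
  fixes a b \<delta> :: real
  assumes "0 < a" "a < b" "0 < \<delta>"
  obtains R where "0 \<le> R" "\<And>t. 0 \<le> t \<Longrightarrow> t powr a \<le> R + \<delta> * t powr b"
proof -
  define T where "T = (1 / \<delta>) powr (1 / (b - a))"
  have T: "0 < T" "T powr (b - a) = 1 / \<delta>" using assms by (simp_all add: T_def powr_powr)
  show thesis
  proof (rule that[of "T powr a"])
    fix t :: real assume t: "0 \<le> t"
    show "t powr a \<le> T powr a + \<delta> * t powr b"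
    proof (cases "t \<le> T")
      case True
      then have "t powr a \<le> T powr a" using t assms by (intro powr_mono2) auto
      moreover have "0 \<le> \<delta> * t powr b" using assms by simp
      ultimately show ?thesis by linarith
    next
      case False
      then have "T powr (b - a) \<le> t powr (b - a)" using T assms by (intro powr_mono2) auto
      then have "1 \<le> \<delta> * t powr (b - a)" using T assms by (simp add: field_simps)
      then have "t powr a * 1 \<le> t powr a * (\<delta> * t powr (b - a))" by (intro mult_left_mono) auto
      also have "\<dots> = \<delta> * (t powr a * t powr (b - a))" by (simp add: mult_ac)
      also have "t powr a * t powr (b - a) = t powr b" using powr_add[of t a "b - a"] by simp
      finally have "t powr a \<le> \<delta> * t powr b" by simp
      moreover have "0 \<le> T powr a" by simp
      ultimately show ?thesis by linarith
    qed
  qed simp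
qed

lemma coupling_growth:
  fixes g :: "real \<Rightarrow> ereal" and \<alpha> c2 :: real
  defines "gr \<equiv> \<lambda>s. real_of_ereal (g s)"
  assumes codom: "\<And>s. 0 \<le> s \<Longrightarrow> g s \<noteq> \<infinity>" and mono: "strict_mono_on {0..} g"
    and zero: "(g \<longlongrightarrow> g 0) (at_right 0)"
    and diff: "\<And>s. 0 < s \<Longrightarrow> gr differentiable (at s)"
    and params: "0 < c2" "0 < \<alpha>"
    and deriv: "\<And>s. 0 < s \<Longrightarrow> deriv gr s \<le> c2 * s powr (\<alpha> - 1)"
  obtains A B where "0 \<le> A" "0 \<le> B" "\<And>s. 0 \<le> s \<Longrightarrow> \<bar>gr s\<bar> \<le> A + B * s powr \<alpha>"
    "\<And>s. 0 \<le> s \<Longrightarrow> g s = ereal (gr s)" "continuous_on {0..} gr"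
proof -
  have pos: "g s = ereal (gr s)" if "0 < s" for s
  proof -
    have "g 0 < g s" using mono that by (auto simp: strict_mono_on_def)
    then show ?thesis using codom[of s] that unfolding gr_def by (cases "g s") auto
  qed
  \<comment> \<open>The subtracted term is the antiderivative of the bound on the derivative, so
    \<open>\<phi>\<close> is nonincreasing.\<close>
  define \<phi> where "\<phi> s = gr s - c2 / \<alpha> * s powr \<alpha>" for s
  have dec: "\<phi> b \<le> \<phi> a" if "0 < a" "a \<le> b" for a b
  proof (rule DERIV_nonpos_imp_nonincreasing[OF that(2)])
    fix s assume "a \<le> s" "s \<le> b"
    then have s: "0 < s" using that by simp
    have "DERIV gr s :> deriv gr s"
      using diff[OF s] DERIV_deriv_iff_real_differentiable by blast
    then have "DERIV \<phi> s :> deriv gr s - c2 / \<alpha> * (\<alpha> * s powr (\<alpha> - 1))"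
      unfolding \<phi>_def using s by (auto intro!: derivative_eq_intros)
    moreover have "deriv gr s - c2 / \<alpha> * (\<alpha> * s powr (\<alpha> - 1)) \<le> 0"
      using deriv[OF s] params by simp
    ultimately show "\<exists>y. DERIV \<phi> s :> y \<and> y \<le> 0" by blast
  qed
  have ge: "gr 1 - c2 / \<alpha> \<le> gr s" if "0 < s" "s \<le> 1" for s
  proof -
    have "0 \<le> c2 / \<alpha> * s powr \<alpha>" using params by simp
    then show ?thesis using dec[of s 1] that unfolding \<phi>_def by simp
  qed
  \<comment> \<open>Right continuity carries the lower bound to 0; this is where the value negative
    infinity is excluded.\<close>
  have "ereal (gr 1 - c2 / \<alpha>) \<le> g 0"
  proof (rule tendsto_lowerbound[OF zero])
    show "\<forall>\<^sub>F s in at_right 0. ereal (gr 1 - c2 / \<alpha>) \<le> g s"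
      using eventually_at_right_less[of 0] eventually_at_right[of 0 "1::real"]
      by (intro eventually_at_rightI[of 0 1]) (auto simp: pos ge)
  qed simp
  then have g0: "g 0 = ereal (gr 0)" using codom[of 0] unfolding gr_def by (cases "g 0") auto
  have fin: "g s = ereal (gr s)" if "0 \<le> s" for s
    using that pos[of s] g0 by (cases "s = 0") auto
  have le0: "gr 0 \<le> gr s" if "0 \<le> s" for s
  proof (cases "s = 0")
    case False
    then have "g 0 < g s" using mono that by (auto simp: strict_mono_on_def)
    then show ?thesis using fin[of s] fin[of 0] that by simp
  qed simp
  have up: "gr s \<le> \<bar>gr 1\<bar> + c2 / \<alpha> * s powr \<alpha>" if "0 \<le> s" for s
  proof (cases "s \<le> 1")
    case True
    have "gr s \<le> gr 1"
    proof (cases "s = 1")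
      case False
      then have "g s < g 1" using mono that True by (auto simp: strict_mono_on_def)
      then show ?thesis using fin[of s] fin[of 1] that by simp
    qed simp
    moreover have "0 \<le> c2 / \<alpha> * s powr \<alpha>" using params by simp
    ultimately show ?thesis by linarith
  next
    case False
    have "0 \<le> c2 / \<alpha>" using params by simp
    then show ?thesis using dec[of 1 s] False unfolding \<phi>_def by simp
  qed
  have c: "continuous_on {0..} gr"
    unfolding continuous_on_def
  proof
    fix s :: real assume "s \<in> {0..}"
    then consider "s = 0" | "0 < s" by fastforce
    then show "(gr \<longlongrightarrow> gr s) (at s within {0..})"
    proof cases
      case 1
      have "((\<lambda>s. real_of_ereal (g s)) \<longlongrightarrow> gr 0) (at_right 0)"
        using zero unfolding g0 by (rule lim_real_of_ereal)
      then have "(gr \<longlongrightarrow> gr 0) (at_right 0)" by (simp add: gr_def)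
      then show ?thesis using 1 by (simp add: at_within_Ici_at_right)
    next
      case 2
      then have "isCont gr s" using diff differentiable_imp_continuous_within by blast
      then show ?thesis by (simp add: continuous_at tendsto_within_subset[of _ _ s UNIV])
    qed
  qed
  show thesis
  proof (rule that[of "\<bar>gr 0\<bar> + \<bar>gr 1\<bar>" "c2 / \<alpha>"])
    fix s :: real assume "0 \<le> s"
    moreover have "0 \<le> c2 / \<alpha> * s powr \<alpha>" using params by simp
    ultimately show "\<bar>gr s\<bar> \<le> \<bar>gr 0\<bar> + \<bar>gr 1\<bar> + c2 / \<alpha> * s powr \<alpha>"
      using le0[of s] up[of s] by linarith
  qed (use params fin c in auto)
qed

lemma bv_bound_mono: "bv_bound C f \<Longrightarrow> C \<le> D \<Longrightarrow> bv_bound D f"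
  unfolding bv_bound_def by (meson order_trans)

lemma measure_torus: "measure (torus :: (real ^ 'n) measure) (cbox 0 1) = 1"
  using torus.prob_space[where 'n = 'n] by simp

lemma W12_bv_bound:
  assumes f: "f \<in> W12" "W12_norm f \<le> C"
  shows "bv_bound (1 + C\<^sup>2) f"
proof -
  note W = W12D[OF f(1)] and n = W12_norm_leD[OF f(2)]
  note wg = has_weak_gradD[OF W(1)]
  \<comment> \<open>Turns L2 bounds into L1 bounds on a space of measure 1, at the price of the
    constant \<open>1 + C\<^sup>2\<close>.\<close>
  have sq: "t \<le> 1 + t\<^sup>2" for t :: real
  proof (cases "t \<le> 1")
    case True
    then show ?thesis using zero_le_power2[of t] by linarith
  next
    case False
    then show ?thesis using self_le_power[of t 2] by simp
  qed
  have "(\<integral>x. \<bar>f x\<bar> \<partial>torus) \<le> (\<integral>x. 1 + (f x)\<^sup>2 \<partial>torus)"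
    using W sq[of "\<bar>f _\<bar>"] by (intro integral_mono) auto
  also have "\<dots> \<le> 1 + C\<^sup>2" using W n by (simp add: measure_torus)
  finally have 1: "(\<integral>x. \<bar>f x\<bar> \<partial>torus) \<le> 1 + C\<^sup>2" .
  have 2: "\<bar>\<integral>x. f x * partial_deriv i \<phi> x \<partial>torus\<bar> \<le> 1 + C\<^sup>2"
    if t: "test_fun \<phi>" and b: "\<And>x. \<bar>\<phi> x\<bar> \<le> 1" for i \<phi>
  proof -
    have i: "integrable torus (\<lambda>x. weak_grad f x $ i * \<phi> x)" by (intro integrable_mult_test wg(3) t)
    have "\<bar>\<integral>x. f x * partial_deriv i \<phi> x \<partial>torus\<bar> = \<bar>\<integral>x. weak_grad f x $ i * \<phi> x \<partial>torus\<bar>"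
      by (simp add: wg(4)[OF t])
    also have "\<dots> \<le> (\<integral>x. \<bar>weak_grad f x $ i * \<phi> x\<bar> \<partial>torus)" by (rule integral_abs_bound)
    also have "\<dots> \<le> (\<integral>x. 1 + (norm (weak_grad f x))\<^sup>2 \<partial>torus)"
    proof (rule integral_mono[OF integrable_abs[OF i]])
      show "integrable torus (\<lambda>x. 1 + (norm (weak_grad f x))\<^sup>2)" using W by simp
      fix x
      have "\<bar>weak_grad f x $ i * \<phi> x\<bar> \<le> norm (weak_grad f x) * 1"
        unfolding abs_mult using b component_le_norm_cart by (intro mult_mono) auto
      then show "\<bar>weak_grad f x $ i * \<phi> x\<bar> \<le> 1 + (norm (weak_grad f x))\<^sup>2"
        using sq[of "norm (weak_grad f x)"] by linarith
    qed
    also have "\<dots> \<le> 1 + C\<^sup>2" using W n by (simp add: measure_torus)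
    finally show ?thesis .
  qed
  show ?thesis unfolding bv_bound_def using W(4) 1 2 by blast
qed

text \<open>The total variation is tested with matrix fields having a single nonzero entry.\<close>

lemma BV_bv_bound:
  fixes F :: "real ^ 'n \<Rightarrow> real ^ 'n"
  assumes F: "F \<in> BV" "BV_norm F \<le> ereal C"
  shows "bv_bound C (\<lambda>x. F x $ i)"
proof -
  have i: "integrable torus F" using F by (simp add: BV_def)
  note ic = integral_vec_nth(2)[OF i]
  have "0 \<le> (\<integral>x. norm (F x) \<partial>torus)" by simp
  have tv: "(\<integral>x. (\<Sum>i\<in>UNIV. F x $ i * divergence (\<lambda>y. \<Phi> y $ i) x) \<partial>torus) \<le> C - (\<integral>x. norm (F x) \<partial>torus)"
    if "\<forall>i j. test_fun (\<lambda>x. \<Phi> x $ i $ j)" "\<forall>x. norm (\<Phi> x) \<le> 1" for \<Phi> :: "real ^ 'n \<Rightarrow> real ^ 'n ^ 'n"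
  proof -
    have "ereal (\<integral>x. (\<Sum>i\<in>UNIV. F x $ i * divergence (\<lambda>y. \<Phi> y $ i) x) \<partial>torus) \<le> total_variation F"
      unfolding total_variation_def by (rule SUP_upper) (use that in auto)
    then have "ereal (\<integral>x. norm (F x) \<partial>torus) + ereal (\<integral>x. (\<Sum>i\<in>UNIV. F x $ i * divergence (\<lambda>y. \<Phi> y $ i) x) \<partial>torus) \<le> ereal C"
      using F(2) unfolding BV_norm_def by (meson add_left_mono order_trans)
    then show ?thesis by simp
  qed
  have le: "(\<integral>x. F x $ i * partial_deriv j \<phi> x \<partial>torus) \<le> C - (\<integral>x. norm (F x) \<partial>torus)"
    if t: "test_fun \<phi>" and b: "\<And>x. \<bar>\<phi> x\<bar> \<le> 1" for j \<phi>
  proof -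
    \<comment> \<open>Only the entry in row \<open>i\<close> and column \<open>j\<close> is nonzero:
      row \<open>i\<close> has divergence \<open>partial_deriv j \<phi>\<close>, and the Frobenius
      norm is the modulus of \<open>\<phi>\<close>.\<close>
    define \<Phi> where "\<Phi> x = \<phi> x *\<^sub>R (axis i (axis j 1) :: real ^ 'n ^ 'n)" for x
    have comp: "\<Phi> x $ a $ b = (if a = i \<and> b = j then \<phi> x else 0)" for x a b
      by (simp add: \<Phi>_def axis_def)
    have tz: "test_fun (\<lambda>x. 0 :: real)" by (rule test_fun_const)
    have 1: "\<forall>a b. test_fun (\<lambda>x. \<Phi> x $ a $ b)"
    proof (intro allI)
      show "test_fun (\<lambda>x. \<Phi> x $ a $ b)" for a b
        unfolding comp by (cases "a = i \<and> b = j") (use t tz in auto)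
    qed
    have 2: "\<forall>x. norm (\<Phi> x) \<le> 1" using b by (simp add: \<Phi>_def norm_eq_sqrt_inner[of "axis i _"] inner_axis_axis)
    have d: "divergence (\<lambda>y. \<Phi> y $ a) x = (if a = i then partial_deriv j \<phi> x else 0)" for a x
    proof -
      have "partial_deriv b (\<lambda>y. \<Phi> y $ a $ b) x = (if a = i \<and> b = j then partial_deriv j \<phi> x else 0)" for b
        unfolding comp by (auto simp: partial_deriv_const)
      then show ?thesis by (simp add: divergence_def)
    qed
    have "(\<Sum>a\<in>UNIV. F x $ a * divergence (\<lambda>y. \<Phi> y $ a) x) = F x $ i * partial_deriv j \<phi> x" for x
      unfolding d by (simp add: sum.remove[of UNIV i])
    then show ?thesis using tv[OF 1 2] by simp
  qed
  have abs: "\<bar>\<integral>x. F x $ i * partial_deriv j \<phi> x \<partial>torus\<bar> \<le> C" if t: "test_fun \<phi>" and b: "\<And>x. \<bar>\<phi> x\<bar> \<le> 1" for j \<phi>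
  proof -
    \<comment> \<open>The supremum in \<open>total_variation\<close> is one-sided; testing with the
      negative of \<open>\<phi>\<close> gives the absolute value.\<close>
    have tm: "test_fun (\<lambda>x. - 1 * \<phi> x)" by (intro test_fun_mult test_fun_const t)
    have "partial_deriv j (\<lambda>x. - 1 * \<phi> x) = (\<lambda>x. - 1 * partial_deriv j \<phi> x + partial_deriv j (\<lambda>x. - 1) x * \<phi> x)"
      by (intro partial_deriv_mult test_fun_differentiable test_fun_const t)
    then have "partial_deriv j (\<lambda>x. - 1 * \<phi> x) = (\<lambda>x. - partial_deriv j \<phi> x)" by (simp add: partial_deriv_const)
    then have "- (\<integral>x. F x $ i * partial_deriv j \<phi> x \<partial>torus) \<le> C - (\<integral>x. norm (F x) \<partial>torus)"
      using le[OF tm, of j] b by simp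
    then show ?thesis using le[OF t b, of j] \<open>0 \<le> (\<integral>x. norm (F x) \<partial>torus)\<close> by linarith
  qed
  have "(\<integral>x. \<bar>F x $ i\<bar> \<partial>torus) \<le> (\<integral>x. norm (F x) \<partial>torus)"
    using ic i component_le_norm_cart by (intro integral_mono) auto
  \<comment> \<open>The zero test function shows that the total variation is nonnegative, so
    \<open>C\<close> bounds the L1 norm alone.\<close>
  also have "\<dots> \<le> C"
    using le[OF test_fun_const[of 0]] by (simp add: partial_deriv_const)
  finally show ?thesis unfolding bv_bound_def using ic abs by blast
qed

text \<open>Subsequences are extracted for one index after the other. \<open>Q\<close> survives
  passage to a subsequence, so finitely many extractions suffice.\<close>

lemma bv_compact_family:
  fixes f :: "'i::finite \<Rightarrow> nat \<Rightarrow> real ^ 'n \<Rightarrow> real" and C :: real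
  assumes bv: "\<And>i k. bv_bound C (f i k)"
  obtains r g where "strict_mono r" "\<And>i. integrable torus (g i)"
    "\<And>i. (\<lambda>k. \<integral>x. \<bar>f i (r k) x - g i x\<bar> \<partial>torus) \<longlonglongrightarrow> 0"
    "\<And>i. AE x in torus. (\<lambda>k. f i (r k) x) \<longlonglongrightarrow> g i x"
proof -
  define Q where "Q i r \<longleftrightarrow> (\<exists>g. integrable torus g \<and> (\<lambda>k. \<integral>x. \<bar>f i (r k) x - g x\<bar> \<partial>torus) \<longlonglongrightarrow> 0 \<and>
      (AE x in torus. (\<lambda>k. f i (r k) x) \<longlonglongrightarrow> g x))" for i and r :: "nat \<Rightarrow> nat"
  have sub: "Q i (r \<circ> s)" if Q: "Q i r" and s: "strict_mono s" for i r s
  proof -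
    obtain g where g: "integrable torus g" "(\<lambda>k. \<integral>x. \<bar>f i (r k) x - g x\<bar> \<partial>torus) \<longlonglongrightarrow> 0"
      "AE x in torus. (\<lambda>k. f i (r k) x) \<longlonglongrightarrow> g x" using Q by (auto simp: Q_def)
    have "AE x in torus. (\<lambda>k. f i ((r \<circ> s) k) x) \<longlonglongrightarrow> g x"
      using g(3) by eventually_elim (use LIMSEQ_subseq_LIMSEQ[OF _ s] in \<open>force simp: o_def\<close>)
    moreover have "(\<lambda>k. \<integral>x. \<bar>f i ((r \<circ> s) k) x - g x\<bar> \<partial>torus) \<longlonglongrightarrow> 0"
      using LIMSEQ_subseq_LIMSEQ[OF g(2) s] by (simp add: o_def)
    ultimately show ?thesis using g(1) by (auto simp: Q_def)
  qed
  have ex: "\<exists>s. strict_mono s \<and> Q i (r \<circ> s)" for i and r :: "nat \<Rightarrow> nat"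
  proof -
    have if': "integrable torus (f i k)" for k using bv[of i k] by (simp add: bv_bound_def)
    obtain s g where s: "strict_mono s" "integrable torus g" "(\<lambda>k. \<integral>x. \<bar>f i (r (s k)) x - g x\<bar> \<partial>torus) \<longlonglongrightarrow> 0"
      by (rule bv_compact[of C "\<lambda>k. f i (r k)", OF bv]) (rule that, assumption+)
    have s3: "(\<lambda>k. \<integral>x. norm (f i (r (s k)) x - g x) \<partial>torus) \<longlonglongrightarrow> 0" using s(3) by simp
    obtain t where t: "strict_mono t" "AE x in torus. (\<lambda>k. f i (r (s (t k))) x) \<longlonglongrightarrow> g x"
      by (rule L1_AE_subseq[OF if' s(2) s3]) (rule that, assumption+)
    have "Q i (r \<circ> (s \<circ> t))"
      unfolding Q_def using s t LIMSEQ_subseq_LIMSEQ[OF s(3) t(1)] by (intro exI[of _ g]) (simp add: o_def)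
    then show ?thesis using s t strict_mono_o by blast
  qed
  have "\<exists>r. strict_mono r \<and> (\<forall>i\<in>I. Q i r)" if "finite I" for I
    using that
  proof induction
    case empty
    show ?case using strict_mono_id by auto
  next
    case (insert i I)
    then obtain r where r: "strict_mono r" "\<forall>i\<in>I. Q i r" by blast
    obtain s where s: "strict_mono s" "Q i (r \<circ> s)" using ex by blast
    show ?case using r s sub strict_mono_o[OF r(1) s(1)] by blast
  qed
  from this[of UNIV] obtain r where r: "strict_mono r" "\<And>i. Q i r" by auto
  then have "\<forall>i. \<exists>g. integrable torus g \<and> (\<lambda>k. \<integral>x. \<bar>f i (r k) x - g x\<bar> \<partial>torus) \<longlonglongrightarrow> 0 \<and>
      (AE x in torus. (\<lambda>k. f i (r k) x) \<longlonglongrightarrow> g x)" by (simp add: Q_def)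
  from choice[OF this] obtain g where "\<forall>i. integrable torus (g i) \<and> (\<lambda>k. \<integral>x. \<bar>f i (r k) x - g i x\<bar> \<partial>torus) \<longlonglongrightarrow> 0 \<and>
      (AE x in torus. (\<lambda>k. f i (r k) x) \<longlonglongrightarrow> g i x)" by blast
  with r(1) show thesis by (intro that[of r g]) blast+
qed

section \<open>The limit of a vanishing discount\<close>

lemma integrable_bounded_inner:
  fixes f b :: "'a \<Rightarrow> 'b::euclidean_space"
  assumes "integrable M f" and [measurable]: "b \<in> borel_measurable M" and b: "AE x in M. norm (b x) \<le> D"
  shows "integrable M (\<lambda>x. f x \<bullet> b x)"
proof (rule Bochner_Integration.integrable_bound)
  show "integrable M (\<lambda>x. D * norm (f x))" using assms by simp
  show "(\<lambda>x. f x \<bullet> b x) \<in> borel_measurable M" using assms(1) by measurable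
  show "AE x in M. norm (f x \<bullet> b x) \<le> norm (D * norm (f x))"
    using b
  proof eventually_elim
    case (elim x)
    have "\<bar>f x \<bullet> b x\<bar> \<le> norm (f x) * norm (b x)" by (rule Cauchy_Schwarz_ineq2)
    also have "\<dots> \<le> norm (f x) * D" using elim by (intro mult_left_mono) auto
    finally show ?case by (simp add: mult.commute)
  qed
qed

lemma L1_limit_inner:
  fixes f :: "nat \<Rightarrow> 'a \<Rightarrow> 'b::euclidean_space"
  assumes f: "\<And>n. integrable M (f n)" "integrable M g" and lim: "(\<lambda>n. \<integral>x. norm (f n x - g x) \<partial>M) \<longlonglongrightarrow> 0"
    and b: "b \<in> borel_measurable M" "AE x in M. norm (b x) \<le> D"
  shows "(\<lambda>n. \<integral>x. f n x \<bullet> b x \<partial>M) \<longlonglongrightarrow> (\<integral>x. g x \<bullet> b x \<partial>M)"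
proof -
  have i: "integrable M (\<lambda>x. f n x \<bullet> b x)" "integrable M (\<lambda>x. g x \<bullet> b x)" "integrable M (\<lambda>x. (f n x - g x) \<bullet> b x)" for n
    using f by (intro integrable_bounded_inner[OF _ b] Bochner_Integration.integrable_diff; simp)+
  have "norm ((\<integral>x. f n x \<bullet> b x \<partial>M) - (\<integral>x. g x \<bullet> b x \<partial>M)) \<le> D * (\<integral>x. norm (f n x - g x) \<partial>M)" for n
  proof -
    have "(\<integral>x. f n x \<bullet> b x \<partial>M) - (\<integral>x. g x \<bullet> b x \<partial>M) = (\<integral>x. (f n x - g x) \<bullet> b x \<partial>M)"
      using i by (simp add: inner_diff_left)
    then have "norm ((\<integral>x. f n x \<bullet> b x \<partial>M) - (\<integral>x. g x \<bullet> b x \<partial>M)) \<le> (\<integral>x. \<bar>(f n x - g x) \<bullet> b x\<bar> \<partial>M)"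
      using integral_abs_bound[of M "\<lambda>x. (f n x - g x) \<bullet> b x"] by simp
    also have "\<dots> \<le> (\<integral>x. D * norm (f n x - g x) \<partial>M)"
    proof (rule integral_mono_AE[OF integrable_abs[OF i(3)]])
      show "integrable M (\<lambda>x. D * norm (f n x - g x))" using f by simp
      show "AE x in M. \<bar>(f n x - g x) \<bullet> b x\<bar> \<le> D * norm (f n x - g x)"
        using b(2)
      proof eventually_elim
        case (elim x)
        have "\<bar>(f n x - g x) \<bullet> b x\<bar> \<le> norm (f n x - g x) * norm (b x)" by (rule Cauchy_Schwarz_ineq2)
        also have "\<dots> \<le> norm (f n x - g x) * D" using elim by (intro mult_left_mono) auto
        finally show ?case by (simp add: mult.commute)
      qed
    qed
    finally show ?thesis by simp
  qed
  moreover have "(\<lambda>n. D * (\<integral>x. norm (f n x - g x) \<partial>M)) \<longlonglongrightarrow> 0"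
    using tendsto_mult_left[OF lim, of D] by simp
  ultimately have "(\<lambda>n. (\<integral>x. f n x \<bullet> b x \<partial>M) - (\<integral>x. g x \<bullet> b x \<partial>M)) \<longlonglongrightarrow> 0"
    by (rule LIMSEQ_null_comparison)
  then show ?thesis by (rule LIM_zero_cancel)
qed

text \<open>Tested with the unit field in the direction of the difference. Where the functions
  agree, \<open>inverse 0 = 0\<close> makes that field vanish.\<close>

lemma AE_eq_by_duality:
  fixes f g :: "'a \<Rightarrow> 'b::euclidean_space"
  assumes f: "integrable M f" "integrable M g"
    and dual: "\<And>b. b \<in> borel_measurable M \<Longrightarrow> (\<And>x. norm (b x) \<le> 1) \<Longrightarrow> (\<integral>x. f x \<bullet> b x \<partial>M) = (\<integral>x. g x \<bullet> b x \<partial>M)"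
  shows "AE x in M. f x = g x"
proof -
  define b where "b x = inverse (norm (f x - g x)) *\<^sub>R (f x - g x)" for x
  note [measurable] = borel_measurable_integrable[OF f(1)] borel_measurable_integrable[OF f(2)]
  have bm: "b \<in> borel_measurable M" unfolding b_def by measurable
  have b1: "norm (b x) \<le> 1" for x by (cases "f x = g x") (simp_all add: b_def)
  have "(f x - g x) \<bullet> b x = norm (f x - g x)" for x
    by (cases "f x = g x") (simp_all add: b_def power2_norm_eq_inner[symmetric] power2_eq_square)
  then have "(\<integral>x. norm (f x - g x) \<partial>M) = (\<integral>x. (f x - g x) \<bullet> b x \<partial>M)" by simp
  also have "\<dots> = (\<integral>x. f x \<bullet> b x \<partial>M) - (\<integral>x. g x \<bullet> b x \<partial>M)"
    unfolding inner_diff_left using f b1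
    by (intro Bochner_Integration.integral_diff integrable_bounded_inner[where D = 1] bm) auto
  also have "\<dots> = 0" using dual[OF bm b1] by simp
  finally have "(\<integral>x. norm (f x - g x) \<partial>M) = 0" .
  then have "AE x in M. norm (f x - g x) = 0"
    using f by (subst (asm) integral_nonneg_eq_0_iff_AE) auto
  then show ?thesis by eventually_elim simp
qed

text \<open>The situation after all extractions of subsequences. Weak convergence is recorded only
  through tests, with bounded functions for the density and square-integrable fields for the
  gradient. \<open>\<eta>\<close> and \<open>F\<close> are strong limits that remain to be
  identified in terms of \<open>m\<close> and \<open>weak_grad u\<close>.\<close>

locale vanishing_discount =
  fixes V :: "real ^ 'n \<Rightarrow> real" and g :: "real \<Rightarrow> ereal" and gr :: "real \<Rightarrow> real"
    and \<alpha> C H A B p C2 :: real and \<epsilon> :: "nat \<Rightarrow> real"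
    and U M :: "nat \<Rightarrow> real ^ 'n \<Rightarrow> real" and u m \<eta> :: "real ^ 'n \<Rightarrow> real"
    and F :: "real ^ 'n \<Rightarrow> real ^ 'n"
  assumes alpha: "0 < \<alpha>" and C0: "0 < C" and V: "continuous_on UNIV V"
    and g_gr: "\<And>s. 0 \<le> s \<Longrightarrow> g s = ereal (gr s)" and gr_cont: "continuous_on {0..} gr"
    and AB: "0 \<le> A" "0 \<le> B" "\<And>s. 0 \<le> s \<Longrightarrow> \<bar>gr s\<bar> \<le> A + B * s powr \<alpha>"
    and eps: "\<And>k. 0 < \<epsilon> k" "\<And>k. \<epsilon> k \<le> 1" "\<epsilon> \<longlonglongrightarrow> 0"
    and sol: "\<And>k. regular_weak_discounted C \<alpha> V g (\<epsilon> k) (U k) (M k)"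
    and H_lim: "(\<lambda>k. \<epsilon> k * torus_mean (U k)) \<longlonglongrightarrow> - H"
    and m_int: "integrable torus m"
    and m_weak: "\<And>b. b \<in> borel_measurable torus \<Longrightarrow> (\<And>x. \<bar>b x\<bar> \<le> 1) \<Longrightarrow>
          (\<lambda>k. \<integral>x. b x * M k x \<partial>torus) \<longlonglongrightarrow> (\<integral>x. b x * m x \<partial>torus)"
    and u: "u \<in> W12" "W12_norm u \<le> C" "torus_mean u = 0"
    and u_weak: "\<And>\<Theta>. \<Theta> \<in> borel_measurable torus \<Longrightarrow> integrable torus (\<lambda>x. (norm (\<Theta> x))\<^sup>2) \<Longrightarrow>
          (\<lambda>k. \<integral>x. weak_grad (U k) x \<bullet> \<Theta> x \<partial>torus) \<longlonglongrightarrow> (\<integral>x. weak_grad u x \<bullet> \<Theta> x \<partial>torus)"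
    and eta: "integrable torus \<eta>" "(\<lambda>k. \<integral>x. \<bar>M k x powr ((\<alpha> + 1) / 2) - \<eta> x\<bar> \<partial>torus) \<longlonglongrightarrow> 0"
          "AE x in torus. (\<lambda>k. M k x powr ((\<alpha> + 1) / 2)) \<longlonglongrightarrow> \<eta> x"
    and F: "integrable torus F"
          "(\<lambda>k. \<integral>x. norm (M k x powr ((\<alpha> + 1) / 2) *\<^sub>R weak_grad (U k) x - F x) \<partial>torus) \<longlonglongrightarrow> 0"
          "AE x in torus. (\<lambda>k. M k x powr ((\<alpha> + 1) / 2) *\<^sub>R weak_grad (U k) x) \<longlonglongrightarrow> F x"
    and w0: "AE x in torus. (\<lambda>k. \<epsilon> k * (U k x - torus_mean (U k))) \<longlonglongrightarrow> 0"
    and p: "4/3 < p" "\<And>k. integrable torus (\<lambda>x. M k x powr p)" "\<And>k. (\<integral>x. M k x powr p \<partial>torus) \<le> C2"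
begin

abbreviation "h k x \<equiv> M k x powr ((\<alpha> + 1) / 2)"
abbreviation "G k \<equiv> weak_grad (U k)"
abbreviation "Du \<equiv> weak_grad u"
abbreviation "w k x \<equiv> U k x - torus_mean (U k)"

section \<open>Consequences of the uniform bounds along the sequence\<close>

lemma M_nonneg: "AE x in torus. 0 \<le> M k x" and M_int: "integrable torus (M k)"
  and M_one: "(\<integral>x. M k x \<partial>torus) = 1"
  and h_W12: "h k \<in> W12" "W12_norm (h k) \<le> C" and U_int: "integrable torus (U k)"
  and w_W12: "(\<lambda>x. w k x) \<in> W12" "W12_norm (\<lambda>x. w k x) \<le> C"
  and F_BV: "(\<lambda>x. h k x *\<^sub>R G k x) \<in> BV" "BV_norm (\<lambda>x. h k x *\<^sub>R G k x) \<le> ereal C"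
  and mean_le: "\<bar>\<epsilon> k * torus_mean (U k)\<bar> \<le> C"
  and transport: "transport_distr (\<epsilon> k) (\<epsilon> k) (U k) (M k)"
  using sol[of k] by (simp_all add: regular_weak_discounted_def regular_bounds_def)

lemma M_nonneg_all: "AE x in torus. \<forall>k. 0 \<le> M k x"
  using M_nonneg by (simp add: AE_all_countable)

lemma G_sq: "integrable torus (\<lambda>x. (norm (G k x))\<^sup>2)" "(\<integral>x. (norm (G k x))\<^sup>2 \<partial>torus) \<le> C\<^sup>2"
  and G_int: "integrable torus (G k)"
  using W12D(3,5)[OF w_W12(1)[of k]] W12_norm_leD(2)[OF w_W12(2)[of k]] by (simp_all add: weak_grad_diff_const)

lemma w_sq: "integrable torus (\<lambda>x. (w k x)\<^sup>2)" "(\<integral>x. (w k x)\<^sup>2 \<partial>torus) \<le> C\<^sup>2"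
  using W12D(2)[OF w_W12(1)[of k]] W12_norm_leD(1)[OF w_W12(2)[of k]] by simp_all

lemma Du_sq: "integrable torus (\<lambda>x. (norm (Du x))\<^sup>2)" and Du_int: "integrable torus Du"
  using W12D(3,5)[OF u(1)] by simp_all

lemma h_square: "(h k x)\<^sup>2 = M k x powr (\<alpha> + 1)"
  by (simp add: power2_eq_square flip: powr_add)

lemma M_pow: "integrable torus (\<lambda>x. M k x powr (\<alpha> + 1))" "(\<integral>x. M k x powr (\<alpha> + 1) \<partial>torus) \<le> C\<^sup>2"
  using W12D(2)[OF h_W12(1)[of k]] W12_norm_leD(1)[OF h_W12(2)[of k]] by (simp_all add: h_square)

lemma measurable_facts [measurable]:
  "M k \<in> borel_measurable torus" "U k \<in> borel_measurable torus" "G k \<in> borel_measurable torus"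
  "Du \<in> borel_measurable torus" "m \<in> borel_measurable torus" "\<eta> \<in> borel_measurable torus"
  "F \<in> borel_measurable torus" "V \<in> borel_measurable torus"
  using M_int U_int G_int Du_int m_int eta(1) F(1) borel_measurable_torus_continuous[OF V] by auto

lemma hamilton_jacobi:
  "AE x in torus. 0 < M k x \<longrightarrow> - \<epsilon> k * U k x - (norm (G k x))\<^sup>2 / 2 - V x + gr (M k x) = 0"
proof -
  have "AE x in torus. (ereal (- \<epsilon> k * U k x - (norm (G k x))\<^sup>2 / 2 - V x) + g (M k x)) * ereal (M k x) = 0"
    using sol[of k] by (simp add: regular_weak_discounted_def)
  then show ?thesis by eventually_elim (auto simp: g_gr)
qed

text \<open>Where the density is positive, complementarity expresses the squared gradient by the
  other terms. \<open>\<epsilon> k * U k x\<close> is split into the bounded mean part and the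
  oscillation \<open>w k\<close>, which is bounded in L2 and therefore stays in the
  estimate.\<close>

lemma grad_bound:
  obtains K where "0 < K"
    "\<And>k. AE x in torus. 0 < M k x \<longrightarrow> norm (G k x) \<le> sqrt (K * (1 + M k x powr \<alpha> + \<bar>\<epsilon> k * w k x\<bar>))"
proof -
  obtain D where D: "0 < D" "\<And>x. x \<in> cbox 0 1 \<Longrightarrow> norm (V x) \<le> D"
    using continuous_torus_bounded[OF V] by blast
  define K where "K = 2 * (C + D + A + B + 1)"
  have "AE x in torus. 0 < M k x \<longrightarrow> norm (G k x) \<le> sqrt (K * (1 + M k x powr \<alpha> + \<bar>\<epsilon> k * w k x\<bar>))" for k
    using hamilton_jacobi[of k] AE_space
  proof eventually_elim
    case (elim x)
    show ?case
    proof
      assume M: "0 < M k x"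
      then have "(norm (G k x))\<^sup>2 = 2 * (- (\<epsilon> k * w k x) - \<epsilon> k * torus_mean (U k) - V x + gr (M k x))"
        using elim(1) by (simp add: algebra_simps)
      also have "\<dots> \<le> 2 * (\<bar>\<epsilon> k * w k x\<bar> + C + D + (A + B * M k x powr \<alpha>))"
        using mean_le[of k] D(2)[of x] elim(2) AB(3)[of "M k x"] M by (auto simp: abs_le_iff)
      also have "\<dots> \<le> K * (1 + M k x powr \<alpha> + \<bar>\<epsilon> k * w k x\<bar>)"
      proof -
        have nn: "0 \<le> M k x powr \<alpha>" "0 \<le> \<bar>\<epsilon> k * w k x\<bar>" by simp_all
        have "0 \<le> (C + D + A + 1) * M k x powr \<alpha>" "0 \<le> (C + D + A + B) * \<bar>\<epsilon> k * w k x\<bar>" "0 \<le> B"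
          using AB C0 D by simp_all
        then show ?thesis by (simp add: K_def algebra_simps)
      qed
      finally show "norm (G k x) \<le> sqrt (K * (1 + M k x powr \<alpha> + \<bar>\<epsilon> k * w k x\<bar>))"
        by (rule real_le_rsqrt)
    qed
  qed
  moreover have "0 < K" using AB C0 D by (simp add: K_def)
  ultimately show thesis by (intro that)
qed

lemma exponents: "(\<alpha> + 1) / 2 * (2 / (\<alpha> + 1)) = 1" "2 / (\<alpha> + 1) * ((\<alpha> + 1) / 2) = 1"
  using alpha by simp_all

section \<open>Strong convergence of the densities\<close>

lemma powr_limit:
  assumes "(\<lambda>k. h k x) \<longlonglongrightarrow> \<eta> x" "\<forall>k. 0 \<le> M k x"
  shows "(\<lambda>k. M k x) \<longlonglongrightarrow> \<eta> x powr (2 / (\<alpha> + 1))"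
proof -
  have "(\<lambda>k. h k x powr (2 / (\<alpha> + 1))) \<longlonglongrightarrow> \<eta> x powr (2 / (\<alpha> + 1))"
    using assms alpha by (intro tendsto_powr' tendsto_const) auto
  moreover have "h k x powr (2 / (\<alpha> + 1)) = M k x" for k
    using assms(2) unfolding powr_powr exponents by simp
  ultimately show ?thesis by simp
qed

text \<open>The power \<open>\<alpha> + 1 > 1\<close> of the densities is bounded in L1; this makes
  the densities uniformly integrable and upgrades convergence almost everywhere to L1.\<close>

lemma M_L1_aux:
  "integrable torus (\<lambda>x. \<eta> x powr (2 / (\<alpha> + 1)))"
  "(\<lambda>k. \<integral>x. norm (M k x - \<eta> x powr (2 / (\<alpha> + 1))) \<partial>torus) \<longlonglongrightarrow> 0"
proof -
  have "\<exists>R. \<forall>k. AE x in torus. norm (M k x) \<le> R + \<delta> * M k x powr (\<alpha> + 1)" if \<delta>: "0 < \<delta>" for \<delta>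
  proof -
    obtain R where R: "0 \<le> R" "\<And>t. 0 \<le> t \<Longrightarrow> t powr 1 \<le> R + \<delta> * t powr (\<alpha> + 1)"
      using powr_le_epsilon_powr[of 1 "\<alpha> + 1" \<delta>] alpha \<delta> by auto
    have "AE x in torus. norm (M k x) \<le> R + \<delta> * M k x powr (\<alpha> + 1)" for k
      using M_nonneg[of k]
    proof eventually_elim
      case (elim x)
      then show ?case using R(2)[OF elim] by simp
    qed
    then show ?thesis by blast
  qed
  moreover have "AE x in torus. (\<lambda>k. M k x) \<longlonglongrightarrow> \<eta> x powr (2 / (\<alpha> + 1))"
    using eta(3) M_nonneg_all by eventually_elim (rule powr_limit)
  ultimately show "integrable torus (\<lambda>x. \<eta> x powr (2 / (\<alpha> + 1)))"
    "(\<lambda>k. \<integral>x. norm (M k x - \<eta> x powr (2 / (\<alpha> + 1))) \<partial>torus) \<longlonglongrightarrow> 0"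
    using vitali_convergence[of torus M "\<lambda>x. \<eta> x powr (2 / (\<alpha> + 1))" "\<lambda>k x. M k x powr (\<alpha> + 1)" "C\<^sup>2"]
      M_int M_pow torus.finite_measure_axioms by auto
qed

text \<open>Against bounded test functions, the strong L1 limit and the weak limit must
  agree.\<close>

lemma m_eq: "AE x in torus. m x = \<eta> x powr (2 / (\<alpha> + 1))"
proof (rule AE_eq_by_duality[OF m_int M_L1_aux(1)])
  fix b :: "real ^ 'n \<Rightarrow> real" assume b: "b \<in> borel_measurable torus" "\<And>x. norm (b x) \<le> 1"
  have "(\<lambda>k. \<integral>x. M k x \<bullet> b x \<partial>torus) \<longlonglongrightarrow> (\<integral>x. \<eta> x powr (2 / (\<alpha> + 1)) \<bullet> b x \<partial>torus)"
    using b by (intro L1_limit_inner[where D = 1] M_int M_L1_aux) auto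
  moreover have "(\<lambda>k. \<integral>x. M k x \<bullet> b x \<partial>torus) \<longlonglongrightarrow> (\<integral>x. m x \<bullet> b x \<partial>torus)"
    using m_weak[OF b(1)] b(2) by (simp add: mult.commute)
  ultimately show "(\<integral>x. m x \<bullet> b x \<partial>torus) = (\<integral>x. \<eta> x powr (2 / (\<alpha> + 1)) \<bullet> b x \<partial>torus)"
    using LIMSEQ_unique by blast
qed

lemma m_nonneg: "AE x in torus. 0 \<le> m x"
  using m_eq by eventually_elim simp

lemma M_lim: "AE x in torus. (\<lambda>k. M k x) \<longlonglongrightarrow> m x"
  using eta(3) M_nonneg_all m_eq by eventually_elim (simp add: powr_limit)

lemma M_L1: "(\<lambda>k. \<integral>x. norm (M k x - m x) \<partial>torus) \<longlonglongrightarrow> 0"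
proof -
  have "(\<integral>x. norm (M k x - m x) \<partial>torus) = (\<integral>x. norm (M k x - \<eta> x powr (2 / (\<alpha> + 1))) \<partial>torus)" for k
  proof (rule integral_cong_AE)
    show "AE x in torus. norm (M k x - m x) = norm (M k x - \<eta> x powr (2 / (\<alpha> + 1)))"
      using m_eq by eventually_elim simp
  qed measurable
  with M_L1_aux(2) show ?thesis by simp
qed

lemma m_one: "(\<integral>x. m x \<partial>torus) = 1"
proof -
  have "(\<lambda>k. \<integral>x. M k x \<bullet> 1 \<partial>torus) \<longlonglongrightarrow> (\<integral>x. m x \<bullet> 1 \<partial>torus)"
    by (intro L1_limit_inner[where D = 1] M_int m_int M_L1) auto
  then show ?thesis by (simp add: M_one LIMSEQ_const_iff)
qed

lemma eta_eq: "AE x in torus. m x powr ((\<alpha> + 1) / 2) = \<eta> x"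
  using m_eq eta(3)
proof eventually_elim
  case (elim x)
  have "0 \<le> \<eta> x" using elim(2) by (rule LIMSEQ_le_const) auto
  then show ?case unfolding elim(1) powr_powr exponents by simp
qed

lemma m_pow_W12: "(\<lambda>x. m x powr ((\<alpha> + 1) / 2)) \<in> W12" "W12_norm (\<lambda>x. m x powr ((\<alpha> + 1) / 2)) \<le> C"
proof -
  have i: "integrable torus (\<lambda>x. m x powr ((\<alpha> + 1) / 2))"
    using eta_eq by (subst integrable_cong_AE[OF _ _ eta_eq]) (auto intro: eta)
  have "(\<integral>x. norm (h k x - m x powr ((\<alpha> + 1) / 2)) \<partial>torus) = (\<integral>x. \<bar>h k x - \<eta> x\<bar> \<partial>torus)" for k
  proof (rule integral_cong_AE)
    show "AE x in torus. norm (h k x - m x powr ((\<alpha> + 1) / 2)) = \<bar>h k x - \<eta> x\<bar>"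
      using eta_eq by eventually_elim simp
  qed measurable
  with eta(2) have "(\<lambda>k. \<integral>x. norm (h k x - m x powr ((\<alpha> + 1) / 2)) \<partial>torus) \<longlonglongrightarrow> 0" by simp
  from W12_L1_limit[OF h_W12 i this]
  show "(\<lambda>x. m x powr ((\<alpha> + 1) / 2)) \<in> W12" "W12_norm (\<lambda>x. m x powr ((\<alpha> + 1) / 2)) \<le> C" .
qed

text \<open>Replaces convergence of the gradients at points where the density tends to 0: the
  gradient bound stays bounded there, and any positive power of the density sends the product to 0.
  At indices with \<open>M k x = 0\<close> no gradient bound is available, but the product is 0. It
  is applied with \<open>a = (\<alpha> + 1) / 2\<close> and \<open>a = 1\<close>.\<close>

lemma vanishing_bound:
  assumes a: "0 < a" and "(\<lambda>k. M k x) \<longlonglongrightarrow> 0" "\<forall>k. 0 \<le> M k x" "(\<lambda>k. \<epsilon> k * w k x) \<longlonglongrightarrow> 0"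
    and K: "\<forall>k. 0 < M k x \<longrightarrow> norm (G k x) \<le> sqrt (K * (1 + M k x powr \<alpha> + \<bar>\<epsilon> k * w k x\<bar>))"
  shows "(\<lambda>k. M k x powr a *\<^sub>R G k x) \<longlonglongrightarrow> 0"
proof (rule LIMSEQ_null_comparison)
  show "norm (M k x powr a *\<^sub>R G k x) \<le> M k x powr a * sqrt (K * (1 + M k x powr \<alpha> + \<bar>\<epsilon> k * w k x\<bar>))" for k
  proof (cases "0 < M k x")
    case True
    then show ?thesis using K by (auto intro: mult_left_mono)
  next
    case False
    then have "M k x = 0" using assms(3) by (auto simp: not_less intro: antisym)
    then show ?thesis by simp
  qed
  have "(\<lambda>k. M k x powr a * sqrt (K * (1 + M k x powr \<alpha> + \<bar>\<epsilon> k * w k x\<bar>))) \<longlonglongrightarrow>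
      0 powr a * sqrt (K * (1 + 0 powr \<alpha> + \<bar>0\<bar>))"
    using assms alpha by (intro tendsto_mult tendsto_real_sqrt tendsto_add tendsto_const tendsto_rabs tendsto_powr') auto
  then show "(\<lambda>k. M k x powr a * sqrt (K * (1 + M k x powr \<alpha> + \<bar>\<epsilon> k * w k x\<bar>))) \<longlonglongrightarrow> 0" by simp
qed

section \<open>Identification of the limit gradient and the limit flux\<close>

lemma gradient_limit: "AE x in torus. 0 < \<eta> x \<longrightarrow> (\<lambda>k. G k x) \<longlonglongrightarrow> (1 / \<eta> x) *\<^sub>R F x"
  using eta(3) F(3)
proof eventually_elim
  case (elim x)
  show ?case
  proof
    assume pos: "0 < \<eta> x"
    have "(\<lambda>k. (1 / h k x) *\<^sub>R (h k x *\<^sub>R G k x)) \<longlonglongrightarrow> (1 / \<eta> x) *\<^sub>R F x"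
      using pos by (intro tendsto_scaleR tendsto_divide tendsto_const elim) auto
    moreover have "\<forall>\<^sub>F k in sequentially. 0 < h k x" using order_tendstoD(1)[OF elim(1) pos] .
    then have "\<forall>\<^sub>F k in sequentially. (1 / h k x) *\<^sub>R (h k x *\<^sub>R G k x) = G k x"
      by eventually_elim auto
    ultimately show "(\<lambda>k. G k x) \<longlonglongrightarrow> (1 / \<eta> x) *\<^sub>R F x" by (rule Lim_transform_eventually)
  qed
qed

text \<open>On the set where \<open>\<eta>\<close> is positive the gradients converge pointwise, and
  being bounded in L2 they are uniformly integrable. So they converge in L1 on that set, and the
  limit must be the weak limit.\<close>

lemma gradient_eq: "AE x in torus. 0 < \<eta> x \<longrightarrow> (1 / \<eta> x) *\<^sub>R F x = Du x"
proof -
  \<comment> \<open>The indicator restricts everything to the set where a pointwise limit exists,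
    and it may be moved onto the test field.\<close>
  define ind where "ind x = (if 0 < \<eta> x then 1 else 0 :: real)" for x
  define P where "P x = ind x *\<^sub>R (1 / \<eta> x) *\<^sub>R F x" for x
  have [measurable]: "ind \<in> borel_measurable torus" unfolding ind_def by measurable
  have Pm[measurable]: "P \<in> borel_measurable torus" unfolding P_def by measurable
  have ind1: "\<bar>ind x\<bar> \<le> 1" for x by (simp add: ind_def)
  have fi: "integrable torus (\<lambda>x. ind x *\<^sub>R G k x)" for k
    using ind1 by (intro integrable_bounded_scaleR[where D = 1] G_int) auto
  have Dui: "integrable torus (\<lambda>x. ind x *\<^sub>R Du x)"
    using ind1 by (intro integrable_bounded_scaleR[where D = 1] Du_int) auto
  have lim: "AE x in torus. (\<lambda>k. ind x *\<^sub>R G k x) \<longlonglongrightarrow> P x"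
    using gradient_limit by eventually_elim (auto simp: ind_def P_def)
  have "\<exists>R. \<forall>k. AE x in torus. norm (ind x *\<^sub>R G k x) \<le> R + \<delta> * (norm (G k x))\<^sup>2" if \<delta>: "0 < \<delta>" for \<delta>
  proof -
    \<comment> \<open>A number \<open>t \<ge> 0\<close> is at most \<open>1 / \<delta>\<close> or at
      most \<open>\<delta> * t\<^sup>2\<close>.\<close>
    have "norm (ind x *\<^sub>R G k x) \<le> 1 / \<delta> + \<delta> * (norm (G k x))\<^sup>2" for k x
    proof -
      have "norm (ind x *\<^sub>R G k x) \<le> norm (G k x)" by (simp add: ind_def)
      also have "\<dots> \<le> 1 / \<delta> + \<delta> * (norm (G k x))\<^sup>2"
      proof (cases "norm (G k x) \<le> 1 / \<delta>")
        case True
        moreover have "0 \<le> \<delta> * (norm (G k x))\<^sup>2" using \<delta> by simp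
        ultimately show ?thesis by linarith
      next
        case False
        then have "1 * norm (G k x) \<le> (\<delta> * norm (G k x)) * norm (G k x)"
          using \<delta> by (intro mult_right_mono) (auto simp: field_simps)
        then have "norm (G k x) \<le> \<delta> * (norm (G k x))\<^sup>2" by (simp add: power2_eq_square mult.assoc)
        moreover have "0 < 1 / \<delta>" using \<delta> by simp
        ultimately show ?thesis by linarith
      qed
      finally show ?thesis .
    qed
    then show ?thesis by blast
  qed
  from vitali_convergence[OF torus.finite_measure_axioms fi Pm lim G_sq(1) _ G_sq(2) this]
  have P: "integrable torus P" "(\<lambda>k. \<integral>x. norm (ind x *\<^sub>R G k x - P x) \<partial>torus) \<longlonglongrightarrow> 0" by simp_all
  have "AE x in torus. P x = ind x *\<^sub>R Du x"
  proof (rule AE_eq_by_duality[OF P(1) Dui])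
    fix b :: "real ^ 'n \<Rightarrow> real ^ 'n" assume b: "b \<in> borel_measurable torus" "\<And>x. norm (b x) \<le> 1"
    note [measurable] = b(1)
    have "(\<lambda>k. \<integral>x. (ind x *\<^sub>R G k x) \<bullet> b x \<partial>torus) \<longlonglongrightarrow> (\<integral>x. P x \<bullet> b x \<partial>torus)"
      using b by (intro L1_limit_inner[where D = 1] fi P) auto
    moreover have "(\<lambda>k. \<integral>x. G k x \<bullet> (ind x *\<^sub>R b x) \<partial>torus) \<longlonglongrightarrow> (\<integral>x. Du x \<bullet> (ind x *\<^sub>R b x) \<partial>torus)"
    proof (rule u_weak)
      show "integrable torus (\<lambda>x. (norm (ind x *\<^sub>R b x))\<^sup>2)"
      proof (rule torus.integrable_const_bound[of _ 1])
        have "(norm (ind x *\<^sub>R b x))\<^sup>2 \<le> 1" for x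
          using b(2)[of x] by (auto simp: ind_def power_le_one)
        then show "AE x in torus. norm ((norm (ind x *\<^sub>R b x))\<^sup>2) \<le> 1" by simp
      qed measurable
    qed measurable
    ultimately show "(\<integral>x. P x \<bullet> b x \<partial>torus) = (\<integral>x. (ind x *\<^sub>R Du x) \<bullet> b x \<partial>torus)"
      by (simp add: LIMSEQ_unique)
  qed
  then show ?thesis by eventually_elim (auto simp: P_def ind_def)
qed

text \<open>Where \<open>\<eta>\<close> is positive this is the identification of the gradient;
  where it is 0 both sides vanish, the right one by the bound on the fluxes at vanishing
  density.\<close>

lemma F_eq: "AE x in torus. m x powr ((\<alpha> + 1) / 2) *\<^sub>R Du x = F x"
proof -
  obtain K where K: "0 < K" "\<And>k. AE x in torus. 0 < M k x \<longrightarrow> norm (G k x) \<le> sqrt (K * (1 + M k x powr \<alpha> + \<bar>\<epsilon> k * w k x\<bar>))"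
    using grad_bound by blast
  have "AE x in torus. \<forall>k. 0 < M k x \<longrightarrow> norm (G k x) \<le> sqrt (K * (1 + M k x powr \<alpha> + \<bar>\<epsilon> k * w k x\<bar>))"
    using K(2) by (simp add: AE_all_countable)
  then show ?thesis
    using gradient_eq eta_eq m_eq M_lim M_nonneg_all w0 F(3)
  proof eventually_elim
    case (elim x)
    show ?case
    proof (cases "0 < \<eta> x")
      case True
      then have "\<eta> x *\<^sub>R Du x = \<eta> x *\<^sub>R (1 / \<eta> x) *\<^sub>R F x" using elim(2) by simp
      then show ?thesis using True elim(3) by simp
    next
      case False
      have "0 \<le> \<eta> x" using elim(3)[symmetric] by simp
      with False have e0: "\<eta> x = 0" by simp
      then have "m x = 0" using elim(4) by simp
      then have "(\<lambda>k. h k x *\<^sub>R G k x) \<longlonglongrightarrow> 0"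
        using alpha elim(5) by (intro vanishing_bound[OF _ _ elim(6,7,1)]) auto
      then have "F x = 0" using elim(8) LIMSEQ_unique by blast
      then show ?thesis using e0 elim(3) by simp
    qed
  qed
qed

lemma gradient_tendsto: "AE x in torus. 0 < m x \<longrightarrow> (\<lambda>k. G k x) \<longlonglongrightarrow> Du x"
  using gradient_eq gradient_limit eta_eq
  by eventually_elim (metis powr_gt_zero less_irrefl)

section \<open>The limiting Hamilton-Jacobi equation and inequality\<close>

lemma ergodic_hamilton_jacobi:
  "AE x in torus. 0 < m x \<longrightarrow> H - (norm (Du x))\<^sup>2 / 2 - V x + gr (m x) = 0"
proof -
  have "AE x in torus. \<forall>k. 0 < M k x \<longrightarrow> - \<epsilon> k * U k x - (norm (G k x))\<^sup>2 / 2 - V x + gr (M k x) = 0"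
    using hamilton_jacobi by (simp add: AE_all_countable)
  then show ?thesis
    using gradient_tendsto M_lim w0
  proof eventually_elim
    case (elim x)
    show ?case
    proof
      assume pos: "0 < m x"
      have ev: "\<forall>\<^sub>F k in sequentially. 0 < M k x" using order_tendstoD(1)[OF elim(3) pos] .
      have "(\<lambda>k. gr (M k x)) \<longlonglongrightarrow> gr (m x)"
        using pos ev by (intro continuous_on_tendsto_compose[OF gr_cont elim(3)])
          (auto elim: eventually_mono)
      moreover have "(\<lambda>k. - (\<epsilon> k * w k x) - \<epsilon> k * torus_mean (U k)) \<longlonglongrightarrow> - 0 - - H"
        by (intro tendsto_intros elim H_lim)
      moreover have "(\<lambda>k. G k x) \<longlonglongrightarrow> Du x" using elim(2) pos by simp
      ultimately have "(\<lambda>k. (- (\<epsilon> k * w k x) - \<epsilon> k * torus_mean (U k)) - (norm (G k x))\<^sup>2 / 2 - V x + gr (M k x)) \<longlonglongrightarrow>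
          (- 0 - - H) - (norm (Du x))\<^sup>2 / 2 - V x + gr (m x)"
        by (intro tendsto_add[of _ "(- 0 - - H) - (norm (Du x))\<^sup>2 / 2 - V x"]
            tendsto_diff[of _ "(- 0 - - H) - (norm (Du x))\<^sup>2 / 2"] tendsto_diff[of _ "- 0 - - H"]
            tendsto_divide tendsto_power tendsto_norm tendsto_const) auto
      moreover have "\<forall>\<^sub>F k in sequentially. (- (\<epsilon> k * w k x) - \<epsilon> k * torus_mean (U k)) - (norm (G k x))\<^sup>2 / 2 - V x + gr (M k x) = 0"
        using ev by eventually_elim (use elim(1) in \<open>simp add: algebra_simps\<close>)
      ultimately have "(\<lambda>k. 0 :: real) \<longlonglongrightarrow> (- 0 - - H) - (norm (Du x))\<^sup>2 / 2 - V x + gr (m x)"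
        by (rule Lim_transform_eventually)
      then show "H - (norm (Du x))\<^sup>2 / 2 - V x + gr (m x) = 0" by (simp add: LIMSEQ_const_iff)
    qed
  qed
qed

text \<open>\<open>gr\<close> is continuous on the half-line only and the densities are nonnegative
  only almost everywhere. Composition with \<open>max 0\<close> gives a function that is continuous
  on the whole line and safe to compose.\<close>

lemma gr_max_continuous: "continuous_on UNIV (\<lambda>t. gr (max 0 t))"
  by (rule continuous_on_compose2[OF gr_cont]) (auto intro!: continuous_intros)

lemma gr_max_measurable [measurable]: "(\<lambda>t. gr (max 0 t)) \<in> borel_measurable borel"
  by (rule borel_measurable_continuous_onI[OF gr_max_continuous])

text \<open>Growth of order \<open>\<alpha>\<close> against a bound on the power
  \<open>\<alpha> + 1\<close>: the coupling terms are uniformly integrable.\<close>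

lemma gr_L1:
  "integrable torus (\<lambda>x. gr (max 0 (M k x)))" "integrable torus (\<lambda>x. gr (max 0 (m x)))"
  "(\<lambda>k. \<integral>x. norm (gr (max 0 (M k x)) - gr (max 0 (m x))) \<partial>torus) \<longlonglongrightarrow> 0"
proof -
  have ui: "\<exists>R. \<forall>k. AE x in torus. norm (gr (max 0 (M k x))) \<le> R + \<delta> * M k x powr (\<alpha> + 1)" if \<delta>: "0 < \<delta>" for \<delta>
  proof -
    obtain R where R: "0 \<le> R" "\<And>t. 0 \<le> t \<Longrightarrow> t powr \<alpha> \<le> R + \<delta> / (B + 1) * t powr (\<alpha> + 1)"
      using powr_le_epsilon_powr[of \<alpha> "\<alpha> + 1" "\<delta> / (B + 1)"] alpha \<delta> AB by auto
    have "AE x in torus. norm (gr (max 0 (M k x))) \<le> (A + B * R) + \<delta> * M k x powr (\<alpha> + 1)" for k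
      using M_nonneg[of k]
    proof eventually_elim
      case (elim x)
      have "norm (gr (max 0 (M k x))) \<le> A + B * M k x powr \<alpha>" using AB(3)[OF elim] elim by simp
      also have "\<dots> \<le> A + B * (R + \<delta> / (B + 1) * M k x powr (\<alpha> + 1))"
        using R(2)[OF elim] AB by (intro add_left_mono mult_left_mono) auto
      also have "\<dots> = A + B * R + B / (B + 1) * (\<delta> * M k x powr (\<alpha> + 1))" by (simp add: distrib_left)
      also have "\<dots> \<le> A + B * R + 1 * (\<delta> * M k x powr (\<alpha> + 1))"
        using AB \<delta> by (intro add_left_mono mult_right_mono) auto
      finally show ?case by simp
    qed
    then show ?thesis by blast
  qed
  show i: "integrable torus (\<lambda>x. gr (max 0 (M k x)))" for k
  proof -
    obtain R where R: "AE x in torus. norm (gr (max 0 (M k x))) \<le> R + 1 * M k x powr (\<alpha> + 1)" using ui[of 1] by auto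
    show ?thesis
    proof (rule Bochner_Integration.integrable_bound)
      show "integrable torus (\<lambda>x. R + 1 * M k x powr (\<alpha> + 1))" using M_pow by simp
      show "AE x in torus. norm (gr (max 0 (M k x))) \<le> norm (R + 1 * M k x powr (\<alpha> + 1))"
        using R by eventually_elim simp
    qed measurable
  qed
  have lim: "AE x in torus. (\<lambda>k. gr (max 0 (M k x))) \<longlonglongrightarrow> gr (max 0 (m x))"
    using M_lim by eventually_elim (intro continuous_on_tendsto_compose[OF gr_max_continuous], auto)
  have mm: "(\<lambda>x. gr (max 0 (m x))) \<in> borel_measurable torus" by measurable
  have pos: "AE x in torus. 0 \<le> M k x powr (\<alpha> + 1)" for k by simp
  from vitali_convergence[OF torus.finite_measure_axioms i mm lim M_pow(1) pos M_pow(2) ui]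
  show "integrable torus (\<lambda>x. gr (max 0 (m x)))"
    "(\<lambda>k. \<integral>x. norm (gr (max 0 (M k x)) - gr (max 0 (m x))) \<partial>torus) \<longlonglongrightarrow> 0" by simp_all
qed

lemma discount_term_limit:
  assumes t: "test_fun \<phi>"
  shows "(\<lambda>k. \<integral>x. \<epsilon> k * w k x * \<phi> x \<partial>torus) \<longlonglongrightarrow> 0"
proof -
  obtain D where D: "0 < D" "\<And>x. x \<in> cbox 0 1 \<Longrightarrow> norm (\<phi> x) \<le> D"
    using continuous_torus_bounded[OF test_fun_continuous_on[OF t]] by blast
  have bv: "integrable torus (\<lambda>x. w k x)" "(\<integral>x. \<bar>w k x\<bar> \<partial>torus) \<le> 1 + C\<^sup>2" for k
    using W12_bv_bound[OF w_W12[of k]] by (simp_all add: bv_bound_def)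
  show ?thesis
  proof (rule LIMSEQ_null_comparison)
    fix k
    have i: "integrable torus (\<lambda>x. \<epsilon> k * w k x * \<phi> x)" using integrable_mult_test[OF bv(1) t] by (simp add: mult.assoc)
    have "norm (\<integral>x. \<epsilon> k * w k x * \<phi> x \<partial>torus) \<le> (\<integral>x. \<bar>\<epsilon> k * w k x * \<phi> x\<bar> \<partial>torus)"
      using integral_abs_bound[of torus "\<lambda>x. \<epsilon> k * w k x * \<phi> x"] by simp
    also have "\<dots> \<le> (\<integral>x. (\<epsilon> k * D) * \<bar>w k x\<bar> \<partial>torus)"
    proof (rule integral_mono[OF integrable_abs[OF i]])
      show "integrable torus (\<lambda>x. (\<epsilon> k * D) * \<bar>w k x\<bar>)" using bv(1) by simp
      fix x :: "real ^ 'n" assume "x \<in> space torus"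
      then have "\<bar>\<phi> x\<bar> \<le> D" using D(2) by simp
      then have "(\<epsilon> k * \<bar>w k x\<bar>) * \<bar>\<phi> x\<bar> \<le> (\<epsilon> k * \<bar>w k x\<bar>) * D" using eps(1)[of k] by (intro mult_left_mono) auto
      then show "\<bar>\<epsilon> k * w k x * \<phi> x\<bar> \<le> (\<epsilon> k * D) * \<bar>w k x\<bar>"
        using eps(1)[of k] by (simp add: abs_mult mult_ac)
    qed
    also have "\<dots> = (\<epsilon> k * D) * (\<integral>x. \<bar>w k x\<bar> \<partial>torus)" by simp
    also have "\<dots> \<le> (\<epsilon> k * D) * (1 + C\<^sup>2)"
      using bv(2)[of k] eps(1)[of k] D(1) by (intro mult_left_mono) auto
    finally show "norm (\<integral>x. \<epsilon> k * w k x * \<phi> x \<partial>torus) \<le> (\<epsilon> k * D) * (1 + C\<^sup>2)" .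
  next
    show "(\<lambda>k. (\<epsilon> k * D) * (1 + C\<^sup>2)) \<longlonglongrightarrow> 0"
      using tendsto_mult_right[OF tendsto_mult_right[OF eps(3), of D], of "1 + C\<^sup>2"] by simp
  qed
qed

text \<open>The square of the gradient enters with a negative sign, so before the limit it is
  replaced by its tangent at \<open>Du\<close>: minus half the square of \<open>G k\<close> is at
  most \<open>- (G k \<bullet> Du)\<close> plus half the square of \<open>Du\<close>. The result is
  affine in \<open>G k\<close>, and weak convergence suffices.\<close>

lemma ergodic_nonneg_distr:
  "nonneg_distr (\<lambda>x. ereal (H - (norm (Du x))\<^sup>2 / 2 - V x) + g (m x))"
  unfolding nonneg_distr_def
proof (intro exI conjI allI impI)
  let ?h = "\<lambda>x. H - (norm (Du x))\<^sup>2 / 2 - V x + gr (max 0 (m x))"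
  have iV: "integrable torus V" by (intro integrable_torus_continuous continuous_on_subset[OF V]) simp
  show ih: "integrable torus ?h" using Du_sq iV gr_L1(2) by simp
  show "AE x in torus. ereal (H - (norm (Du x))\<^sup>2 / 2 - V x) + g (m x) = ereal (?h x)"
    using m_nonneg by eventually_elim (simp add: g_gr max_absorb2)
  fix \<phi> :: "real ^ 'n \<Rightarrow> real" assume \<phi>: "test_fun \<phi> \<and> (\<forall>x. 0 \<le> \<phi> x)"
  then have t: "test_fun \<phi>" and pos: "\<And>x. 0 \<le> \<phi> x" by auto
  have c\<phi>: "continuous_on UNIV \<phi>" by (rule test_fun_continuous_on[OF t])
  have [measurable]: "\<phi> \<in> borel_measurable torus" by (rule borel_measurable_torus_continuous[OF c\<phi>])
  obtain D where D: "0 < D" "\<And>x. x \<in> cbox 0 1 \<Longrightarrow> norm (\<phi> x) \<le> D"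
    using continuous_torus_bounded[OF c\<phi>] by blast
  have i\<phi>: "integrable torus \<phi>" by (rule integrable_test_fun[OF t])
  have wi: "integrable torus (\<lambda>x. w k x)" for k using W12D(4)[OF w_W12(1)] .
  \<comment> \<open>Makes \<open>\<phi> x *\<^sub>R Du x\<close> admissible as a test field for the
    weak convergence of the gradients.\<close>
  have sqi: "integrable torus (\<lambda>x. (norm (\<phi> x *\<^sub>R Du x))\<^sup>2)"
  proof -
    have "integrable torus (\<lambda>x. (\<phi> x * \<phi> x) * (norm (Du x))\<^sup>2)"
      by (intro integrable_continuous_mult(1) Du_sq continuous_on_mult c\<phi>)
    then show ?thesis by (simp add: power_mult_distrib power2_eq_square mult_ac abs_of_nonneg[OF pos])
  qed
  have iGD: "integrable torus (\<lambda>x. G k x \<bullet> (\<phi> x *\<^sub>R Du x))" for k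
    by (intro integrable_inner_L2 G_sq sqi) measurable
  have i1: "integrable torus (\<lambda>x. \<epsilon> k * w k x * \<phi> x)" for k
    using integrable_mult_test[OF wi t] by (simp add: mult.assoc)
  have i2: "integrable torus (\<lambda>x. V x * \<phi> x)" "integrable torus (\<lambda>x. gr (max 0 (M k x)) * \<phi> x)"
    "integrable torus (\<lambda>x. gr (max 0 (m x)) * \<phi> x)" "integrable torus (\<lambda>x. (norm (Du x))\<^sup>2 * \<phi> x)" for k
    by (intro integrable_mult_test iV gr_L1 Du_sq t)+
  \<comment> \<open>The upper bound for the tested inequality after linearisation at
    \<open>Du\<close>; each of its terms has a limit.\<close>
  define \<Lambda> where "\<Lambda> k = - (\<integral>x. \<epsilon> k * w k x * \<phi> x \<partial>torus) - \<epsilon> k * torus_mean (U k) * (\<integral>x. \<phi> x \<partial>torus)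
      - (\<integral>x. V x * \<phi> x \<partial>torus) + (\<integral>x. gr (max 0 (M k x)) * \<phi> x \<partial>torus)
      - (\<integral>x. G k x \<bullet> (\<phi> x *\<^sub>R Du x) \<partial>torus) + (\<integral>x. (norm (Du x))\<^sup>2 * \<phi> x \<partial>torus) / 2" for k
  have \<Lambda>0: "0 \<le> \<Lambda> k" for k
  proof -
    obtain f where f: "integrable torus f"
      "AE x in torus. ereal (- \<epsilon> k * U k x - (norm (G k x))\<^sup>2 / 2 - V x) + g (M k x) = ereal (f x)"
      "0 \<le> (\<integral>x. f x * \<phi> x \<partial>torus)"
      using sol[of k] \<phi> unfolding regular_weak_discounted_def nonneg_distr_def by blast
    let ?r = "\<lambda>x. - (\<epsilon> k * w k x * \<phi> x) - \<epsilon> k * torus_mean (U k) * \<phi> x - V x * \<phi> x + gr (max 0 (M k x)) * \<phi> x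
      - G k x \<bullet> (\<phi> x *\<^sub>R Du x) + ((norm (Du x))\<^sup>2 * \<phi> x) / 2"
    have "(\<integral>x. f x * \<phi> x \<partial>torus) \<le> (\<integral>x. ?r x \<partial>torus)"
    proof (rule integral_mono_AE)
      show "integrable torus (\<lambda>x. f x * \<phi> x)" by (rule integrable_mult_test[OF f(1) t])
      show "integrable torus ?r" using i1[of k] i2 iGD[of k] i\<phi> by simp
      show "AE x in torus. f x * \<phi> x \<le> ?r x"
        using f(2) M_nonneg[of k]
      proof eventually_elim
        case (elim x)
        have fx: "f x = - \<epsilon> k * U k x - (norm (G k x))\<^sup>2 / 2 - V x + gr (max 0 (M k x))"
          using elim by (simp add: g_gr max_absorb2)
        have "0 \<le> (norm (G k x - Du x))\<^sup>2" by simp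
        also have "\<dots> = (norm (G k x))\<^sup>2 - 2 * (G k x \<bullet> Du x) + (norm (Du x))\<^sup>2"
          unfolding power2_norm_eq_inner by (simp add: inner_diff_left inner_diff_right inner_commute)
        finally have "f x \<le> - (\<epsilon> k * w k x) - \<epsilon> k * torus_mean (U k) - V x + gr (max 0 (M k x))
            - G k x \<bullet> Du x + (norm (Du x))\<^sup>2 / 2"
          unfolding fx by (simp add: algebra_simps)
        then have "f x * \<phi> x \<le> (- (\<epsilon> k * w k x) - \<epsilon> k * torus_mean (U k) - V x + gr (max 0 (M k x))
            - G k x \<bullet> Du x + (norm (Du x))\<^sup>2 / 2) * \<phi> x" by (intro mult_right_mono pos)
        also have "\<dots> = ?r x" by (simp add: algebra_simps)
        finally show ?case .
      qed
    qed
    also have "\<dots> = \<Lambda> k" unfolding \<Lambda>_def using i1[of k] i2 iGD[of k] i\<phi> by simp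
    finally show ?thesis using f(3) by linarith
  qed
  have l1: "(\<lambda>k. \<integral>x. gr (max 0 (M k x)) * \<phi> x \<partial>torus) \<longlonglongrightarrow> (\<integral>x. gr (max 0 (m x)) * \<phi> x \<partial>torus)"
  proof -
    have "AE x in torus. norm (\<phi> x) \<le> D" using D by (intro AE_I2) simp
    from L1_limit_inner[OF gr_L1 _ this] show ?thesis by simp
  qed
  have l2: "(\<lambda>k. \<integral>x. G k x \<bullet> (\<phi> x *\<^sub>R Du x) \<partial>torus) \<longlonglongrightarrow> (\<integral>x. Du x \<bullet> (\<phi> x *\<^sub>R Du x) \<partial>torus)"
    by (rule u_weak[OF _ sqi]) measurable
  have "\<Lambda> \<longlonglongrightarrow> - 0 - (- H) * (\<integral>x. \<phi> x \<partial>torus) - (\<integral>x. V x * \<phi> x \<partial>torus) + (\<integral>x. gr (max 0 (m x)) * \<phi> x \<partial>torus)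
      - (\<integral>x. Du x \<bullet> (\<phi> x *\<^sub>R Du x) \<partial>torus) + (\<integral>x. (norm (Du x))\<^sup>2 * \<phi> x \<partial>torus) / 2"
    unfolding \<Lambda>_def
    by (intro tendsto_add tendsto_diff tendsto_minus tendsto_mult tendsto_const l1 l2 H_lim discount_term_limit t)
  then have "0 \<le> - 0 - (- H) * (\<integral>x. \<phi> x \<partial>torus) - (\<integral>x. V x * \<phi> x \<partial>torus) + (\<integral>x. gr (max 0 (m x)) * \<phi> x \<partial>torus)
      - (\<integral>x. Du x \<bullet> (\<phi> x *\<^sub>R Du x) \<partial>torus) + (\<integral>x. (norm (Du x))\<^sup>2 * \<phi> x \<partial>torus) / 2"
    using \<Lambda>0 by (intro LIMSEQ_le_const) auto
  also have "(\<integral>x. Du x \<bullet> (\<phi> x *\<^sub>R Du x) \<partial>torus) = (\<integral>x. (norm (Du x))\<^sup>2 * \<phi> x \<partial>torus)"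
    by (simp add: power2_norm_eq_inner mult.commute)
  finally have *: "0 \<le> H * (\<integral>x. \<phi> x \<partial>torus) - (\<integral>x. (norm (Du x))\<^sup>2 * \<phi> x \<partial>torus) / 2 - (\<integral>x. V x * \<phi> x \<partial>torus)
      + (\<integral>x. gr (max 0 (m x)) * \<phi> x \<partial>torus)" by simp
  have "(\<integral>x. ?h x * \<phi> x \<partial>torus) = (\<integral>x. H * \<phi> x - ((norm (Du x))\<^sup>2 * \<phi> x) / 2 - V x * \<phi> x + gr (max 0 (m x)) * \<phi> x \<partial>torus)"
    by (simp add: distrib_right left_diff_distrib)
  also have "\<dots> = H * (\<integral>x. \<phi> x \<partial>torus) - (\<integral>x. (norm (Du x))\<^sup>2 * \<phi> x \<partial>torus) / 2 - (\<integral>x. V x * \<phi> x \<partial>torus)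
      + (\<integral>x. gr (max 0 (m x)) * \<phi> x \<partial>torus)" using i2 i\<phi> by simp
  finally show "0 \<le> (\<integral>x. ?h x * \<phi> x \<partial>torus)" using * by simp
qed

text \<open>For a fixed test field the L1 norm and the test integral pass to the limit together, so
  their sum keeps the bound \<open>C\<close>; the supremum over test fields is taken
  afterwards.\<close>

lemma flux_BV:
  "(\<lambda>x. m x powr ((\<alpha> + 1) / 2) *\<^sub>R Du x) \<in> BV"
  "BV_norm (\<lambda>x. m x powr ((\<alpha> + 1) / 2) *\<^sub>R Du x) \<le> ereal C"
proof -
  let ?F = "\<lambda>x. m x powr ((\<alpha> + 1) / 2) *\<^sub>R Du x"
  let ?Fk = "\<lambda>k x. h k x *\<^sub>R G k x"
  have iF: "integrable torus ?F" by (subst integrable_cong_AE[OF _ _ F_eq]) (auto intro: F)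
  have iFk: "integrable torus (?Fk k)" for k using F_BV(1)[of k] by (simp add: BV_def)
  have L1: "(\<lambda>k. \<integral>x. norm (?Fk k x - ?F x) \<partial>torus) \<longlonglongrightarrow> 0"
  proof -
    have "(\<integral>x. norm (?Fk k x - ?F x) \<partial>torus) = (\<integral>x. norm (?Fk k x - F x) \<partial>torus)" for k
    proof (rule integral_cong_AE)
      show "AE x in torus. norm (?Fk k x - ?F x) = norm (?Fk k x - F x)" using F_eq by eventually_elim simp
    qed measurable
    with F(2) show ?thesis by simp
  qed
  have "(\<lambda>k. (\<integral>x. norm (?Fk k x) \<partial>torus) - (\<integral>x. norm (?F x) \<partial>torus)) \<longlonglongrightarrow> 0"
  proof (rule LIMSEQ_null_comparison[OF _ L1])
    fix k
    have "norm ((\<integral>x. norm (?Fk k x) \<partial>torus) - (\<integral>x. norm (?F x) \<partial>torus)) = norm (\<integral>x. norm (?Fk k x) - norm (?F x) \<partial>torus)"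
      by (simp only: Bochner_Integration.integral_diff[OF integrable_norm[OF iFk] integrable_norm[OF iF]])
    also have "\<dots> \<le> (\<integral>x. norm (norm (?Fk k x) - norm (?F x)) \<partial>torus)" by (rule integral_norm_bound)
    also have "\<dots> \<le> (\<integral>x. norm (?Fk k x - ?F x) \<partial>torus)"
    proof (rule integral_mono)
      show "integrable torus (\<lambda>x. norm (norm (?Fk k x) - norm (?F x)))"
        by (intro integrable_norm Bochner_Integration.integrable_diff iFk iF)
      show "integrable torus (\<lambda>x. norm (?Fk k x - ?F x))"
        by (intro integrable_norm Bochner_Integration.integrable_diff iFk iF)
      show "norm (norm (?Fk k x) - norm (?F x)) \<le> norm (?Fk k x - ?F x)" for x
        unfolding real_norm_def by (rule norm_triangle_ineq3)
    qed
    finally show "norm ((\<integral>x. norm (?Fk k x) \<partial>torus) - (\<integral>x. norm (?F x) \<partial>torus)) \<le> (\<integral>x. norm (?Fk k x - ?F x) \<partial>torus)" .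
  qed
  then have nlim: "(\<lambda>k. \<integral>x. norm (?Fk k x) \<partial>torus) \<longlonglongrightarrow> (\<integral>x. norm (?F x) \<partial>torus)" by (rule LIM_zero_cancel)
  have tv: "ereal (\<integral>x. (\<Sum>i\<in>UNIV. ?F x $ i * divergence (\<lambda>y. \<Phi> y $ i) x) \<partial>torus) \<le> ereal (C - (\<integral>x. norm (?F x) \<partial>torus))"
    if \<Phi>: "\<forall>i j. test_fun (\<lambda>x. \<Phi> x $ i $ j)" "\<forall>x. norm (\<Phi> x) \<le> 1" for \<Phi> :: "real ^ 'n \<Rightarrow> real ^ 'n ^ 'n"
  proof -
    define b where "b x = vec_lambda (\<lambda>i. divergence (\<lambda>y. \<Phi> y $ i) x)" for x
    have cb: "continuous_on UNIV b"
      unfolding b_def divergence_def using \<Phi>(1)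
      by (intro continuous_on_vec_lambda test_fun_continuous_on test_fun_sum test_fun_partial_deriv) blast
    obtain D where D: "0 < D" "\<And>x. x \<in> cbox 0 1 \<Longrightarrow> norm (b x) \<le> D" using continuous_torus_bounded[OF cb] by blast
    have eq: "(\<Sum>i\<in>UNIV. X $ i * divergence (\<lambda>y. \<Phi> y $ i) x) = X \<bullet> b x" for X x
      by (simp add: b_def inner_vec_def)
    have "(\<lambda>k. \<integral>x. ?Fk k x \<bullet> b x \<partial>torus) \<longlonglongrightarrow> (\<integral>x. ?F x \<bullet> b x \<partial>torus)"
      using D by (intro L1_limit_inner[where D = D] iFk iF L1 borel_measurable_torus_continuous[OF cb]) auto
    from tendsto_add[OF nlim this]
    have "(\<integral>x. norm (?F x) \<partial>torus) + (\<integral>x. ?F x \<bullet> b x \<partial>torus) \<le> C"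
    proof (rule LIMSEQ_le_const2)
      have "(\<integral>x. norm (?Fk k x) \<partial>torus) + (\<integral>x. ?Fk k x \<bullet> b x \<partial>torus) \<le> C" for k
      proof -
        have "ereal (\<integral>x. (\<Sum>i\<in>UNIV. ?Fk k x $ i * divergence (\<lambda>y. \<Phi> y $ i) x) \<partial>torus) \<le> total_variation (?Fk k)"
          unfolding total_variation_def by (rule SUP_upper) (use \<Phi> in auto)
        then have "ereal (\<integral>x. norm (?Fk k x) \<partial>torus) + ereal (\<integral>x. ?Fk k x \<bullet> b x \<partial>torus) \<le> ereal C"
          using F_BV(2)[of k] unfolding BV_norm_def eq by (meson add_left_mono order_trans)
        then show ?thesis by simp
      qed
      then show "\<exists>N. \<forall>k\<ge>N. (\<integral>x. norm (?Fk k x) \<partial>torus) + (\<integral>x. ?Fk k x \<bullet> b x \<partial>torus) \<le> C" by blast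
    qed
    then show ?thesis unfolding eq by simp
  qed
  have "total_variation ?F \<le> ereal (C - (\<integral>x. norm (?F x) \<partial>torus))"
    unfolding total_variation_def by (rule SUP_least) (use tv in auto)
  note tvF = this
  have "total_variation ?F < \<infinity>" using tvF by (rule le_less_trans) simp
  then show "?F \<in> BV" unfolding BV_def using iF by simp
  have "BV_norm ?F \<le> ereal (\<integral>x. norm (?F x) \<partial>torus) + ereal (C - (\<integral>x. norm (?F x) \<partial>torus))"
    unfolding BV_norm_def by (rule add_left_mono[OF tvF])
  then show "BV_norm ?F \<le> ereal C" by simp
qed

section \<open>The continuity equation in the limit\<close>

lemma young_three_quarters:
  fixes t y s :: real
  assumes "0 \<le> t" "0 \<le> y" "0 < s"
  shows "t ^ 3 * y \<le> 1 / s ^ 3 * y ^ 4 + s * t ^ 4"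
\<comment> \<open>Young's inequality for the exponents 4/3 and 4 in a crude form: according to the
  case, one of the two terms alone dominates the product.\<close>
proof (cases "y \<le> s * t")
  case True
  then have "t ^ 3 * y \<le> t ^ 3 * (s * t)" using assms by (intro mult_left_mono) auto
  also have "\<dots> = s * t ^ 4" by (simp add: power4_eq_xxxx power3_eq_cube)
  also have "\<dots> \<le> 1 / s ^ 3 * y ^ 4 + s * t ^ 4" using assms by simp
  finally show ?thesis .
next
  case False
  then have "t \<le> y / s" using assms by (simp add: field_simps)
  then have "t ^ 3 * y \<le> (y / s) ^ 3 * y" using assms by (intro mult_right_mono power_mono) auto
  also have "\<dots> = 1 / s ^ 3 * y ^ 4" by (simp add: power_divide power4_eq_xxxx power3_eq_cube)
  also have "\<dots> \<le> 1 / s ^ 3 * y ^ 4 + s * t ^ 4" using assms by simp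
  finally show ?thesis .
qed

text \<open>By the gradient bound the flux is at most a multiple of \<open>M\<close>,
  \<open>M powr (1 + \<alpha> / 2)\<close> and \<open>M\<close> times the square root of the
  oscillation. The first two are of lower order than \<open>M powr (\<alpha> + 1)\<close>. Young's
  inequality splits the third into the square of the oscillation and \<open>M powr (4/3)\<close>,
  which is of lower order than \<open>M powr p\<close>.\<close>

lemma flux_uniformly_integrable:
  assumes \<delta>: "0 < \<delta>"
  shows "\<exists>R. \<forall>k. AE x in torus. norm (M k x *\<^sub>R G k x) \<le> R + \<delta> * (M k x powr p + M k x powr (\<alpha> + 1) + (w k x)\<^sup>2)"
proof -
  obtain K where K: "0 < K" "\<And>k. AE x in torus. 0 < M k x \<longrightarrow> norm (G k x) \<le> sqrt (K * (1 + M k x powr \<alpha> + \<bar>\<epsilon> k * w k x\<bar>))"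
    using grad_bound by blast
  define c where "c = sqrt K"
  have c: "0 < c" using K by (simp add: c_def)
  \<comment> \<open>Solves \<open>c / s ^ 3 = \<delta>\<close>, so that the squared oscillation
    receives the factor \<open>\<delta>\<close>.\<close>
  define s where "s = root 3 (c / \<delta>)"
  have s: "0 < s" "s ^ 3 = c / \<delta>" using c \<delta> by (simp_all add: s_def)
  \<comment> \<open>Two terms are absorbed into \<open>M powr (\<alpha> + 1)\<close>, and
    \<open>c\<close> multiplies both: hence \<open>\<delta> / (2 * c)\<close>. The same bookkeeping,
    with the factor \<open>s\<close> from Young's inequality, gives
    \<open>\<delta> / (c * s)\<close> further down.\<close>
  obtain R1 where R1: "0 \<le> R1" "\<And>t. 0 \<le> t \<Longrightarrow> t powr 1 \<le> R1 + \<delta> / (2 * c) * t powr (\<alpha> + 1)"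
    using powr_le_epsilon_powr[of 1 "\<alpha> + 1" "\<delta> / (2 * c)"] alpha c \<delta> by auto
  obtain R2 where R2: "0 \<le> R2" "\<And>t. 0 \<le> t \<Longrightarrow> t powr (1 + \<alpha> / 2) \<le> R2 + \<delta> / (2 * c) * t powr (\<alpha> + 1)"
    using powr_le_epsilon_powr[of "1 + \<alpha> / 2" "\<alpha> + 1" "\<delta> / (2 * c)"] alpha c \<delta> by auto
  obtain R3 where R3: "0 \<le> R3" "\<And>t. 0 \<le> t \<Longrightarrow> t powr (4/3) \<le> R3 + \<delta> / (c * s) * t powr p"
    using powr_le_epsilon_powr[of "4/3" p "\<delta> / (c * s)"] p(1) c s \<delta> by auto
  define R where "R = c * (R1 + R2 + s * R3)"
  have R: "0 \<le> R" using R1 R2 R3 c s by (simp add: R_def)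
  have "AE x in torus. norm (M k x *\<^sub>R G k x) \<le> R + \<delta> * (M k x powr p + M k x powr (\<alpha> + 1) + (w k x)\<^sup>2)" for k
    using K(2)[of k] M_nonneg[of k]
  proof eventually_elim
    case (elim x)
    let ?M = "M k x" and ?y = "sqrt \<bar>w k x\<bar>"
    show ?case
    proof (cases "0 < ?M")
      case False
      then have "?M = 0" using elim(2) by simp
      then show ?thesis using R \<delta> by simp
    next
      case True
      have "norm (G k x) \<le> sqrt (K * (1 + ?M powr \<alpha> + \<bar>\<epsilon> k * w k x\<bar>))" using elim(1) True by simp
      also have "\<dots> \<le> sqrt (K * (1 + ?M powr \<alpha> + \<bar>w k x\<bar>))"
      proof -
        have "\<bar>\<epsilon> k * w k x\<bar> \<le> 1 * \<bar>w k x\<bar>"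
          unfolding abs_mult using eps(1,2)[of k] by (intro mult_right_mono) auto
        then show ?thesis using K(1) by (intro real_sqrt_le_mono mult_left_mono) auto
      qed
      also have "\<dots> = c * sqrt (1 + ?M powr \<alpha> + \<bar>w k x\<bar>)" by (simp add: c_def real_sqrt_mult)
      also have "\<dots> \<le> c * (1 + ?M powr (\<alpha> / 2) + ?y)"
      proof (rule mult_left_mono)
        have "sqrt (1 + ?M powr \<alpha> + \<bar>w k x\<bar>) \<le> sqrt (1 + ?M powr \<alpha>) + ?y"
          by (intro sqrt_add_le_add_sqrt) auto
        also have "sqrt (1 + ?M powr \<alpha>) \<le> sqrt 1 + sqrt (?M powr \<alpha>)"
          by (intro sqrt_add_le_add_sqrt) auto
        also have "sqrt (?M powr \<alpha>) = ?M powr (\<alpha> / 2)" using True by (simp add: powr_half_sqrt_powr)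
        finally show "sqrt (1 + ?M powr \<alpha> + \<bar>w k x\<bar>) \<le> 1 + ?M powr (\<alpha> / 2) + ?y" by simp
      qed (use c in simp)
      finally have "?M * norm (G k x) \<le> ?M * (c * (1 + ?M powr (\<alpha> / 2) + ?y))"
        using True by (intro mult_left_mono) auto
      also have "\<dots> = c * (?M powr 1 + ?M powr (1 + \<alpha> / 2) + ?M * ?y)"
        using True by (simp add: powr_add algebra_simps)
      also have "\<dots> \<le> c * ((R1 + \<delta> / (2 * c) * ?M powr (\<alpha> + 1)) + (R2 + \<delta> / (2 * c) * ?M powr (\<alpha> + 1)) +
          (\<delta> / c * (w k x)\<^sup>2 + s * (R3 + \<delta> / (c * s) * ?M powr p)))"
      proof (intro mult_left_mono add_mono R1 R2)
        \<comment> \<open>Young's inequality is applied with \<open>t\<close> the cube root of the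
          density and \<open>y\<close> the square root of the oscillation.\<close>
        have "?M = (?M powr (1/3)) ^ 3" "?M powr (4/3) = (?M powr (1/3)) ^ 4"
          using True by (simp_all add: powr_power)
        moreover have "?y ^ 4 = (w k x)\<^sup>2"
        proof -
          have "(?y\<^sup>2)\<^sup>2 = (w k x)\<^sup>2" by simp
          moreover have "?y ^ 4 = (?y\<^sup>2)\<^sup>2" by (simp only: power4_eq_xxxx power2_eq_square mult.assoc)
          ultimately show ?thesis by simp
        qed
        ultimately have "?M * ?y \<le> 1 / s ^ 3 * (w k x)\<^sup>2 + s * ?M powr (4/3)"
          using young_three_quarters[of "?M powr (1/3)" ?y s] s(1) by simp
        also have "1 / s ^ 3 = \<delta> / c" using s(2) by simp
        also have "s * ?M powr (4/3) \<le> s * (R3 + \<delta> / (c * s) * ?M powr p)"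
          using R3(2)[of ?M] s(1) True by (intro mult_left_mono) auto
        finally show "?M * ?y \<le> \<delta> / c * (w k x)\<^sup>2 + s * (R3 + \<delta> / (c * s) * ?M powr p)" by simp
      qed (use True c in auto)
      also have "\<dots> = R + \<delta> * (?M powr p + ?M powr (\<alpha> + 1) + (w k x)\<^sup>2)"
        using c s(1) by (simp add: R_def field_simps)
      finally show ?thesis using True by simp
    qed
  qed
  then show ?thesis by blast
qed

lemma flux_L1:
  "integrable torus (\<lambda>x. m x *\<^sub>R Du x)"
  "(\<lambda>k. \<integral>x. norm (M k x *\<^sub>R G k x - m x *\<^sub>R Du x) \<partial>torus) \<longlonglongrightarrow> 0"
proof -
  obtain K where K: "0 < K" "\<And>k. AE x in torus. 0 < M k x \<longrightarrow> norm (G k x) \<le> sqrt (K * (1 + M k x powr \<alpha> + \<bar>\<epsilon> k * w k x\<bar>))"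
    using grad_bound by blast
  have "AE x in torus. \<forall>k. 0 < M k x \<longrightarrow> norm (G k x) \<le> sqrt (K * (1 + M k x powr \<alpha> + \<bar>\<epsilon> k * w k x\<bar>))"
    using K(2) by (simp add: AE_all_countable)
  then have lim: "AE x in torus. (\<lambda>k. M k x *\<^sub>R G k x) \<longlonglongrightarrow> m x *\<^sub>R Du x"
    using gradient_tendsto M_lim M_nonneg_all w0 m_nonneg
  proof eventually_elim
    case (elim x)
    show ?case
    proof (cases "0 < m x")
      case True
      then show ?thesis using elim by (intro tendsto_scaleR) auto
    next
      case False
      then have m0: "m x = 0" using elim(6) by simp
      then have "(\<lambda>k. M k x powr 1 *\<^sub>R G k x) \<longlonglongrightarrow> 0"
        using elim(3) by (intro vanishing_bound[OF _ _ elim(4,5,1)]) auto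
      then show ?thesis using m0 elim(4) by simp
    qed
  qed
  have i: "integrable torus (\<lambda>x. M k x *\<^sub>R G k x)" for k
    using transport[of k] by (simp add: transport_distr_def)
  have hi: "integrable torus (\<lambda>x. M k x powr p + M k x powr (\<alpha> + 1) + (w k x)\<^sup>2)" for k
    using p(2) M_pow(1) w_sq(1) by simp
  have h0: "AE x in torus. 0 \<le> M k x powr p + M k x powr (\<alpha> + 1) + (w k x)\<^sup>2" for k by simp
  have hC: "(\<integral>x. M k x powr p + M k x powr (\<alpha> + 1) + (w k x)\<^sup>2 \<partial>torus) \<le> C2 + C\<^sup>2 + C\<^sup>2" for k
  proof -
    have "(\<integral>x. M k x powr p + M k x powr (\<alpha> + 1) + (w k x)\<^sup>2 \<partial>torus) =
        (\<integral>x. M k x powr p \<partial>torus) + (\<integral>x. M k x powr (\<alpha> + 1) \<partial>torus) + (\<integral>x. (w k x)\<^sup>2 \<partial>torus)"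
      using p(2)[of k] M_pow(1)[of k] w_sq(1)[of k] by simp
    then show ?thesis using p(3)[of k] M_pow(2)[of k] w_sq(2)[of k] by linarith
  qed
  have mm: "(\<lambda>x. m x *\<^sub>R Du x) \<in> borel_measurable torus" by measurable
  from vitali_convergence[OF torus.finite_measure_axioms i mm lim hi h0 hC flux_uniformly_integrable]
  show "integrable torus (\<lambda>x. m x *\<^sub>R Du x)"
    "(\<lambda>k. \<integral>x. norm (M k x *\<^sub>R G k x - m x *\<^sub>R Du x) \<partial>torus) \<longlonglongrightarrow> 0" by simp_all
qed

text \<open>The discounted equation has the source \<open>\<epsilon> k\<close> times the difference
  of two convergent integrals, which tends to 0.\<close>

lemma flux_divergence_free:
  assumes t: "test_fun \<phi>"
  shows "(\<integral>x. (m x *\<^sub>R Du x) \<bullet> grad \<phi> x \<partial>torus) = 0"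
proof -
  have i: "integrable torus (\<lambda>x. M k x *\<^sub>R G k x)" for k
    using transport[of k] by (simp add: transport_distr_def)
  have cg: "continuous_on UNIV (grad \<phi>)" by (rule continuous_on_grad[OF t])
  obtain D where D: "0 < D" "\<And>x. x \<in> cbox 0 1 \<Longrightarrow> norm (grad \<phi> x) \<le> D" using continuous_torus_bounded[OF cg] by blast
  have 1: "(\<lambda>k. \<integral>x. (M k x *\<^sub>R G k x) \<bullet> grad \<phi> x \<partial>torus) \<longlonglongrightarrow> (\<integral>x. (m x *\<^sub>R Du x) \<bullet> grad \<phi> x \<partial>torus)"
    using D by (intro L1_limit_inner[where D = D] i flux_L1 borel_measurable_torus_continuous[OF cg]) auto
  have c\<phi>: "continuous_on UNIV \<phi>" by (rule test_fun_continuous_on[OF t])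
  obtain E where E: "0 < E" "\<And>x. x \<in> cbox 0 1 \<Longrightarrow> norm (\<phi> x) \<le> E" using continuous_torus_bounded[OF c\<phi>] by blast
  have "(\<lambda>k. \<integral>x. M k x \<bullet> \<phi> x \<partial>torus) \<longlonglongrightarrow> (\<integral>x. m x \<bullet> \<phi> x \<partial>torus)"
    using E by (intro L1_limit_inner[where D = E] M_int m_int M_L1 borel_measurable_torus_continuous[OF c\<phi>]) auto
  from tendsto_mult[OF eps(3) tendsto_diff[OF tendsto_const this, of "\<integral>x. \<phi> x \<partial>torus"]]
  have 2: "(\<lambda>k. \<epsilon> k * ((\<integral>x. \<phi> x \<partial>torus) - (\<integral>x. M k x \<bullet> \<phi> x \<partial>torus))) \<longlonglongrightarrow> 0" by simp
  have "(\<integral>x. (M k x *\<^sub>R G k x) \<bullet> grad \<phi> x \<partial>torus) = \<epsilon> k * ((\<integral>x. \<phi> x \<partial>torus) - (\<integral>x. M k x \<bullet> \<phi> x \<partial>torus))" for k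
  proof -
    have "(\<integral>x. \<epsilon> k * M k x * \<phi> x \<partial>torus) + (\<integral>x. (M k x *\<^sub>R G k x) \<bullet> grad \<phi> x \<partial>torus) = (\<integral>x. \<epsilon> k * \<phi> x \<partial>torus)"
      using transport[of k] t unfolding transport_distr_def by blast
    moreover have "(\<integral>x. \<epsilon> k * M k x * \<phi> x \<partial>torus) = \<epsilon> k * (\<integral>x. M k x \<bullet> \<phi> x \<partial>torus)"
      by (simp add: mult.assoc)
    ultimately show ?thesis by (simp add: right_diff_distrib)
  qed
  with 1 2 show ?thesis using LIMSEQ_unique by simp
qed

lemma ergodic_solution: "regular_weak_ergodic C \<alpha> V g u m H"
  unfolding regular_weak_ergodic_def
proof (intro conjI)
  show "regular_bounds C \<alpha> u m"
    unfolding regular_bounds_def u(3)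
    using m_nonneg m_int m_one m_pow_W12 W12D(4)[OF u(1)] u(1,2) flux_BV by simp
  show "nonneg_distr (\<lambda>x. ereal (H - (norm (Du x))\<^sup>2 / 2 - V x) + g (m x))"
    by (rule ergodic_nonneg_distr)
  show "AE x in torus. (ereal (H - (norm (Du x))\<^sup>2 / 2 - V x) + g (m x)) * ereal (m x) = 0"
    using ergodic_hamilton_jacobi m_nonneg
  proof eventually_elim
    case (elim x)
    then show ?case by (cases "m x = 0") (simp_all add: g_gr)
  qed
  show "transport_distr 0 0 u m"
    unfolding transport_distr_def using m_int flux_L1(1) flux_divergence_free by simp
  show "transport_ae 0 0 u m"
    unfolding transport_ae_def has_weak_div_def using flux_L1(1) flux_divergence_free
    by (intro exI[of _ "\<lambda>x. 0"]) simp
qed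

end

text \<open>For \<open>\<alpha> > 1/3\<close> the L2 norm of the power controls the exponent
  \<open>\<alpha> + 1\<close>. Otherwise the dimension is at most 5, and the Sobolev exponent
  \<open>11/4\<close> gives \<open>(\<alpha> + 1) / 2 * (11/4)\<close>, which exceeds
  \<open>11/8 > 4/3\<close>.\<close>

lemma exponent_above_four_thirds:
  fixes \<alpha> C :: real
  assumes "CARD('n::finite) \<le> 5 \<or> 1/3 < \<alpha>" "0 < \<alpha>" "0 < C"
  obtains p C2 where "4/3 < p"
    "\<And>f :: real ^ 'n \<Rightarrow> real. AE x in torus. 0 \<le> f x \<Longrightarrow> (\<lambda>x. f x powr ((\<alpha> + 1) / 2)) \<in> W12 \<Longrightarrow>
      W12_norm (\<lambda>x. f x powr ((\<alpha> + 1) / 2)) \<le> C \<Longrightarrow>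
      integrable torus (\<lambda>x. f x powr p) \<and> (\<integral>x. f x powr p \<partial>torus) \<le> C2"
proof (cases "1/3 < \<alpha>")
  case True
  show thesis
  proof (rule that[of "\<alpha> + 1" "C\<^sup>2"])
    fix f :: "real ^ 'n \<Rightarrow> real"
    assume f: "(\<lambda>x. f x powr ((\<alpha> + 1) / 2)) \<in> W12" "W12_norm (\<lambda>x. f x powr ((\<alpha> + 1) / 2)) \<le> C"
    have "(f x powr ((\<alpha> + 1) / 2))\<^sup>2 = f x powr (\<alpha> + 1)" for x
      by (simp add: power2_eq_square flip: powr_add)
    then show "integrable torus (\<lambda>x. f x powr (\<alpha> + 1)) \<and> (\<integral>x. f x powr (\<alpha> + 1) \<partial>torus) \<le> C\<^sup>2"
      using W12D(2)[OF f(1)] W12_norm_leD(1)[OF f(2)] by simp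
  qed (use True in simp)
next
  case False
  then have n: "CARD('n) \<le> 5" using assms by simp
  show thesis
  proof (rule that[of "(\<alpha> + 1) / 2 * (11/4)" "sobolev_const C"])
    fix f :: "real ^ 'n \<Rightarrow> real"
    assume f: "(\<lambda>x. f x powr ((\<alpha> + 1) / 2)) \<in> W12" "W12_norm (\<lambda>x. f x powr ((\<alpha> + 1) / 2)) \<le> C"
    have "\<bar>f x powr ((\<alpha> + 1) / 2)\<bar> powr (11/4) = f x powr ((\<alpha> + 1) / 2 * (11/4))" for x
      by (simp add: powr_powr)
    then show "integrable torus (\<lambda>x. f x powr ((\<alpha> + 1) / 2 * (11/4))) \<and>
        (\<integral>x. f x powr ((\<alpha> + 1) / 2 * (11/4)) \<partial>torus) \<le> sobolev_const C"
      using sobolev_W12[OF f n assms(3)] by simp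
  qed (use assms in simp)
qed

text \<open>\<open>(n - 4) / n\<close> reaches 1/3 exactly from \<open>n = 6\<close> on, and for
  \<open>n > 8\<close> the other bound is far larger.\<close>

lemma dimension_condition:
  assumes "4 < n \<Longrightarrow> n \<le> 8 \<Longrightarrow> (real n - 4) / real n < \<alpha>" "8 \<le> n \<Longrightarrow> (real n - 4) / 2 < \<alpha>"
  shows "n \<le> 5 \<or> 1/3 < \<alpha>"
proof (cases "n \<le> 5")
  case False
  show ?thesis
  proof (cases "n \<le> 8")
    case True
    then have "1/3 \<le> (real n - 4) / real n" using False by (simp add: field_simps)
    moreover have "(real n - 4) / real n < \<alpha>" using True False by (intro assms(1)) auto
    ultimately show ?thesis by (intro disjI2) (rule le_less_trans)
  next
    case False
    then show ?thesis using assms(2) by simp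
  qed
qed simp

theorem proposition7p1:
  fixes V :: "real ^ 'n \<Rightarrow> real"
    and g :: "real \<Rightarrow> ereal"
    and ue me :: "real \<Rightarrow> real ^ 'n \<Rightarrow> real"
    and u m :: "real ^ 'n \<Rightarrow> real"
    and \<gamma> \<alpha> c1 c2 C H :: real
  assumes gamma: "0 < \<gamma>" "\<gamma> < 1"
    and V: "C1_holder_torus \<gamma> V"
    and g_codom: "\<And>s. 0 \<le> s \<Longrightarrow> g s \<noteq> \<infinity>"
    and g_mono: "strict_mono_on {0..} g"
    and g_zero: "(g \<longlongrightarrow> g 0) (at_right 0)"
    and g_C1: "C1_holder_loc_pos \<gamma> (\<lambda>s. real_of_ereal (g s))"
    and params: "0 < c1" "0 < c2" "0 < \<alpha>"
    and g_deriv: "\<And>s. 0 < s \<Longrightarrow>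
          c1 * s powr (\<alpha> - 1) \<le> deriv (\<lambda>s. real_of_ereal (g s)) s \<and>
          deriv (\<lambda>s. real_of_ereal (g s)) s \<le> c2 * s powr (\<alpha> - 1)"
    and alpha_mid: "4 < CARD('n) \<Longrightarrow> CARD('n) \<le> 8 \<Longrightarrow>
          (real CARD('n) - 4) / real CARD('n) < \<alpha>"
    and alpha_high: "8 \<le> CARD('n) \<Longrightarrow> (real CARD('n) - 4) / 2 < \<alpha>"
    and C: "0 < C"
    and sol: "\<And>\<epsilon>. 0 < \<epsilon> \<Longrightarrow> regular_weak_discounted C \<alpha> V g \<epsilon> (ue \<epsilon>) (me \<epsilon>)"
    and m_conv: "weakly_tendsto L1 L1_norm me m (at_right 0)"
    and u_conv: "weakly_tendsto W12 W12_norm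
          (\<lambda>\<epsilon> x. ue \<epsilon> x - torus_mean (ue \<epsilon>)) u (at_right 0)"
    and H_conv: "((\<lambda>\<epsilon>. \<epsilon> * torus_mean (ue \<epsilon>)) \<longlongrightarrow> - H) (at_right 0)"
  shows "regular_weak_ergodic C \<alpha> V g u m H"
proof -
  let ?a = "(\<alpha> + 1) / 2"
  have bounds: "regular_bounds C \<alpha> (ue \<epsilon>) (me \<epsilon>)" if "0 < \<epsilon>" for \<epsilon>
    using sol[OF that] by (simp add: regular_weak_discounted_def)
  have hW: "(\<lambda>x. me \<epsilon> x powr ?a) \<in> W12" "W12_norm (\<lambda>x. me \<epsilon> x powr ?a) \<le> C"
    and wW: "(\<lambda>x. ue \<epsilon> x - torus_mean (ue \<epsilon>)) \<in> W12" "W12_norm (\<lambda>x. ue \<epsilon> x - torus_mean (ue \<epsilon>)) \<le> C"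
    and FBV: "(\<lambda>x. me \<epsilon> x powr ?a *\<^sub>R weak_grad (ue \<epsilon>) x) \<in> BV"
      "BV_norm (\<lambda>x. me \<epsilon> x powr ?a *\<^sub>R weak_grad (ue \<epsilon>) x) \<le> ereal C"
    and me0: "AE x in torus. 0 \<le> me \<epsilon> x" if "0 < \<epsilon>" for \<epsilon>
    using bounds[OF that] by (simp_all add: regular_bounds_def)
  define gr where "gr = (\<lambda>s. real_of_ereal (g s))"
  obtain A B where AB: "0 \<le> A" "0 \<le> B" "\<And>s. 0 \<le> s \<Longrightarrow> \<bar>gr s\<bar> \<le> A + B * s powr \<alpha>"
    and g_gr: "\<And>s. 0 \<le> s \<Longrightarrow> g s = ereal (gr s)" and gr_cont: "continuous_on {0..} gr"
  proof -
    have "gr differentiable (at s)" if "0 < s" for s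
      using g_C1 that by (simp add: C1_holder_loc_pos_def gr_def)
    moreover have "deriv gr s \<le> c2 * s powr (\<alpha> - 1)" if "0 < s" for s
      using g_deriv[OF that] by (simp add: gr_def)
    ultimately show thesis
      using coupling_growth[OF g_codom g_mono g_zero _ params(2,3)] that unfolding gr_def by blast
  qed
  obtain p C2 where p: "4/3 < p"
    "\<And>f :: real ^ 'n \<Rightarrow> real. AE x in torus. 0 \<le> f x \<Longrightarrow> (\<lambda>x. f x powr ?a) \<in> W12 \<Longrightarrow>
      W12_norm (\<lambda>x. f x powr ?a) \<le> C \<Longrightarrow>
      integrable torus (\<lambda>x. f x powr p) \<and> (\<integral>x. f x powr p \<partial>torus) \<le> C2"
    using exponent_above_four_thirds[OF dimension_condition[OF alpha_mid alpha_high] params(3) C] by blast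
  have u: "u \<in> W12" using u_conv by (simp add: weakly_tendsto_def)
  have u_norm: "W12_norm u \<le> C"
  proof (rule W12_norm_weak_limit_le[OF u_conv])
    show "\<forall>\<^sub>F \<epsilon> in at_right 0. W12_norm (\<lambda>x. ue \<epsilon> x - torus_mean (ue \<epsilon>)) \<le> C"
      using eventually_at_right_less[of "0::real"] by eventually_elim (rule wW)
  qed simp
  have grad_conv: "((\<lambda>\<epsilon>. \<integral>x. weak_grad (ue \<epsilon>) x \<bullet> \<Theta> x \<partial>torus) \<longlongrightarrow> (\<integral>x. weak_grad u x \<bullet> \<Theta> x \<partial>torus)) (at_right 0)"
    if "\<Theta> \<in> borel_measurable torus" "integrable torus (\<lambda>x. (norm (\<Theta> x))\<^sup>2)" for \<Theta> :: "real ^ 'n \<Rightarrow> real ^ 'n"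
    using weakly_tendstoD[OF u_conv W12_bounded_functional(1)[of "\<lambda>x. 0", OF _ that(1) _ that(2)]]
    by (simp add: weak_grad_diff_const)
  \<comment> \<open>Weak convergence tested with the constant 1: the functions along the family have
    mean 0.\<close>
  have u_mean: "torus_mean u = 0"
  proof -
    have "((\<lambda>\<epsilon>. \<integral>x. ue \<epsilon> x - torus_mean (ue \<epsilon>) \<partial>torus) \<longlongrightarrow> (\<integral>x. u x \<partial>torus)) (at_right 0)"
      using weakly_tendstoD[OF u_conv W12_bounded_functional(1)[of "\<lambda>x. 1" "\<lambda>x. 0"]] by simp
    moreover have "\<forall>\<^sub>F \<epsilon> in at_right 0. (\<integral>x. ue \<epsilon> x - torus_mean (ue \<epsilon>) \<partial>torus) = 0"
      using eventually_at_right_less[of "0::real"]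
    proof eventually_elim
      case (elim \<epsilon>)
      have "integrable torus (ue \<epsilon>)" using bounds[OF elim] by (simp add: regular_bounds_def)
      then show ?case by (simp add: torus_mean_def measure_torus)
    qed
    ultimately have "((\<lambda>\<epsilon>::real. 0) \<longlongrightarrow> (\<integral>x. u x \<partial>torus)) (at_right 0)"
      by (rule Lim_transform_eventually)
    then show ?thesis by (simp add: torus_mean_def tendsto_const_iff)
  qed
  have m: "integrable torus m" using m_conv by (simp add: weakly_tendsto_def L1_def)
  \<comment> \<open>The convergences are assumed along the whole right-sided filter, so one sequence
    suffices; this one also stays below 1.\<close>
  define e where "e k = 1 / real (Suc k)" for k
  have e: "0 < e k" "e k \<le> 1" for k by (simp_all add: e_def)
  have e_lim: "e \<longlonglongrightarrow> 0" unfolding e_def by (rule LIMSEQ_Suc[OF lim_const_over_n])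
  \<comment> \<open>Dominates both the constant \<open>1 + C\<^sup>2\<close> of the Sobolev bound
    and the constant \<open>C\<close> of the BV bound.\<close>
  define K where "K = 1 + C + C\<^sup>2"
  \<comment> \<open>The index \<open>None\<close> stands for the power of the density,
    \<open>Some i\<close> for a component of the flux: one finite family, hence one common
    subsequence.\<close>
  define f where "f j k x = (case j of None \<Rightarrow> me (e k) x powr ?a |
      Some i \<Rightarrow> (me (e k) x powr ?a *\<^sub>R weak_grad (ue (e k)) x) $ i)" for j :: "'n option" and k x
  have f_eq: "f None k = (\<lambda>x. me (e k) x powr ?a)"
    "f (Some i) k = (\<lambda>x. (me (e k) x powr ?a *\<^sub>R weak_grad (ue (e k)) x) $ i)" for i k
    by (simp_all add: f_def fun_eq_iff)
  have "bv_bound K (f j k)" for j k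
  proof (cases j)
    case None
    then show ?thesis using bv_bound_mono[OF W12_bv_bound[OF hW[OF e(1)]], of K] C by (simp add: f_eq K_def)
  next
    case (Some i)
    then show ?thesis using bv_bound_mono[OF BV_bv_bound[OF FBV[OF e(1)]], of K] C by (simp add: f_eq K_def)
  qed
  then obtain r gl where r: "strict_mono r" "\<And>j. integrable torus (gl j)"
    "\<And>j. (\<lambda>k. \<integral>x. \<bar>f j (r k) x - gl j x\<bar> \<partial>torus) \<longlonglongrightarrow> 0"
    "\<And>j. AE x in torus. (\<lambda>k. f j (r k) x) \<longlonglongrightarrow> gl j x"
    by (rule bv_compact_family) (rule that, assumption+)
  have er: "(\<lambda>k. e (r k)) \<longlonglongrightarrow> 0" using LIMSEQ_subseq_LIMSEQ[OF e_lim r(1)] by (simp add: o_def)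
  let ?w = "\<lambda>k x. ue (e k) x - torus_mean (ue (e k))"
  have wi: "integrable torus (?w k)" and wn: "(\<integral>x. \<bar>?w k x\<bar> \<partial>torus) \<le> 1 + C\<^sup>2" for k
    using W12_bv_bound[OF wW[OF e(1)]] by (simp_all add: bv_bound_def)
  \<comment> \<open>A further subsequence: the oscillations are bounded in L1, so multiplied by the
    discount they tend to 0 in L1 and along \<open>s\<close> almost everywhere.\<close>
  obtain s where s: "strict_mono s" "AE x in torus. (\<lambda>k. e (r (s k)) * ?w (r (s k)) x) \<longlonglongrightarrow> 0"
  proof (rule L1_AE_subseq[of torus "\<lambda>k x. e (r k) * ?w (r k) x" "\<lambda>x. 0"])
    show "integrable torus (\<lambda>x. e (r k) * ?w (r k) x)" for k using wi[of "r k"] by simp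
    show "(\<lambda>k. \<integral>x. norm (e (r k) * ?w (r k) x - 0) \<partial>torus) \<longlonglongrightarrow> 0"
    proof (rule LIMSEQ_null_comparison)
      show "norm (\<integral>x. norm (e (r k) * ?w (r k) x - 0) \<partial>torus) \<le> e (r k) * (1 + C\<^sup>2)" for k
        using mult_left_mono[OF wn[of "r k"] less_imp_le[OF e(1)[of "r k"]]] e(1)[of "r k"] by (simp add: abs_mult)
      show "(\<lambda>k. e (r k) * (1 + C\<^sup>2)) \<longlonglongrightarrow> 0" using tendsto_mult_right[OF er, of "1 + C\<^sup>2"] by simp
    qed
  qed (simp, rule that, assumption+)
  define \<epsilon> where "\<epsilon> k = e (r (s k))" for k
  have \<epsilon>: "0 < \<epsilon> k" "\<epsilon> k \<le> 1" for k using e by (simp_all add: \<epsilon>_def)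
  have "\<epsilon> = (\<lambda>k. e (r k)) \<circ> s" by (simp add: \<epsilon>_def fun_eq_iff)
  then have \<epsilon>_lim: "\<epsilon> \<longlonglongrightarrow> 0" using LIMSEQ_subseq_LIMSEQ[OF er s(1)] by simp
  have \<epsilon>_right: "filterlim \<epsilon> (at_right 0) sequentially"
    using \<epsilon>_lim \<epsilon>(1) by (intro tendsto_imp_filterlim_at_right) auto
  note seq = filterlim_compose[OF _ \<epsilon>_right]
  have l1: "(\<lambda>k. \<integral>x. \<bar>f j (r (s k)) x - gl j x\<bar> \<partial>torus) \<longlonglongrightarrow> 0" for j
    using LIMSEQ_subseq_LIMSEQ[OF r(3)[of j] s(1)] by (simp add: o_def)
  have ae: "AE x in torus. (\<lambda>k. f j (r (s k)) x) \<longlonglongrightarrow> gl j x" for j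
    using r(4)[of j] by eventually_elim (use LIMSEQ_subseq_LIMSEQ[OF _ s(1)] in \<open>force simp: o_def\<close>)
  define F where "F x = vec_lambda (\<lambda>i. gl (Some i) x)" for x
  let ?Fk = "\<lambda>k x. me (\<epsilon> k) x powr ?a *\<^sub>R weak_grad (ue (\<epsilon> k)) x"
  have Fki: "integrable torus (?Fk k)" for k using FBV(1)[OF \<epsilon>(1)] by (simp add: BV_def)
  have comp: "?Fk k x $ i - F x $ i = f (Some i) (r (s k)) x - gl (Some i) x" for k x i
    by (simp add: f_def F_def \<epsilon>_def)
  have Fi: "integrable torus F"
  proof -
    have "integrable torus (\<lambda>x. \<Sum>i\<in>UNIV. gl (Some i) x *\<^sub>R axis i (1::real))" using r(2) by simp
    moreover have "F = (\<lambda>x. \<Sum>i\<in>UNIV. gl (Some i) x *\<^sub>R axis i (1::real))"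
      by (auto simp: F_def fun_eq_iff vec_eq_iff axis_def if_distrib cong: if_cong)
    ultimately show ?thesis by simp
  qed
  have F_L1: "(\<lambda>k. \<integral>x. norm (?Fk k x - F x) \<partial>torus) \<longlonglongrightarrow> 0"
  proof (rule LIMSEQ_null_comparison)
    fix k
    have i: "integrable torus (\<lambda>x. \<bar>f (Some i) (r (s k)) x - gl (Some i) x\<bar>)" for i
      using integral_vec_nth(2)[OF Fki[of k], of i] r(2)[of "Some i"] by (simp add: f_def \<epsilon>_def)
    have "(\<integral>x. norm (?Fk k x - F x) \<partial>torus) \<le> (\<integral>x. (\<Sum>i\<in>UNIV. \<bar>f (Some i) (r (s k)) x - gl (Some i) x\<bar>) \<partial>torus)"
    proof (rule integral_mono)
      show "integrable torus (\<lambda>x. norm (?Fk k x - F x))" using Fki Fi by simp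
      show "norm (?Fk k x - F x) \<le> (\<Sum>i\<in>UNIV. \<bar>f (Some i) (r (s k)) x - gl (Some i) x\<bar>)" for x
        using norm_le_l1_cart[of "?Fk k x - F x"] by (simp only: vector_minus_component comp)
    qed (use i in simp)
    then show "norm (\<integral>x. norm (?Fk k x - F x) \<partial>torus) \<le> (\<Sum>i\<in>UNIV. \<integral>x. \<bar>f (Some i) (r (s k)) x - gl (Some i) x\<bar> \<partial>torus)"
      using i by simp
  next
    show "(\<lambda>k. \<Sum>i\<in>UNIV. \<integral>x. \<bar>f (Some i) (r (s k)) x - gl (Some i) x\<bar> \<partial>torus) \<longlonglongrightarrow> 0"
      using tendsto_sum[of UNIV "\<lambda>i k. \<integral>x. \<bar>f (Some i) (r (s k)) x - gl (Some i) x\<bar> \<partial>torus" "\<lambda>i. 0" sequentially, OF l1]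
      by simp
  qed
  have F_ae: "AE x in torus. (\<lambda>k. ?Fk k x) \<longlonglongrightarrow> F x"
  proof -
    have "AE x in torus. \<forall>i. (\<lambda>k. f (Some i) (r (s k)) x) \<longlonglongrightarrow> gl (Some i) x"
      using ae by (simp add: AE_all_countable)
    then show ?thesis
      by eventually_elim (intro vec_tendstoI, simp add: f_def F_def \<epsilon>_def)
  qed
  interpret vanishing_discount V g gr \<alpha> C H A B p C2 \<epsilon> "\<lambda>k. ue (\<epsilon> k)" "\<lambda>k. me (\<epsilon> k)" u m "gl None" F
  proof
    show "continuous_on UNIV V"
      using V unfolding C1_holder_torus_def
      by (auto intro!: differentiable_imp_continuous_on simp: differentiable_on_def intro: differentiable_at_withinI)
    show "regular_weak_discounted C \<alpha> V g (\<epsilon> k) (ue (\<epsilon> k)) (me (\<epsilon> k))" for k by (rule sol[OF \<epsilon>(1)])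
    show "(\<lambda>k. \<epsilon> k * torus_mean (ue (\<epsilon> k))) \<longlonglongrightarrow> - H" by (rule seq[OF H_conv])
    show "(\<lambda>k. \<integral>x. b x * me (\<epsilon> k) x \<partial>torus) \<longlonglongrightarrow> (\<integral>x. b x * m x \<partial>torus)"
      if "b \<in> borel_measurable torus" "\<And>x. \<bar>b x\<bar> \<le> 1" for b
      by (rule seq[OF weakly_tendstoD[OF m_conv L1_bounded_functional[OF that]]])
    show "(\<lambda>k. \<integral>x. weak_grad (ue (\<epsilon> k)) x \<bullet> \<Theta> x \<partial>torus) \<longlonglongrightarrow> (\<integral>x. weak_grad u x \<bullet> \<Theta> x \<partial>torus)"
      if "\<Theta> \<in> borel_measurable torus" "integrable torus (\<lambda>x. (norm (\<Theta> x))\<^sup>2)" for \<Theta>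
      by (rule seq[OF grad_conv[OF that]])
    show "(\<lambda>k. \<integral>x. \<bar>me (\<epsilon> k) x powr ?a - gl None x\<bar> \<partial>torus) \<longlonglongrightarrow> 0"
      using l1[of None] by (simp add: f_def \<epsilon>_def)
    show "AE x in torus. (\<lambda>k. me (\<epsilon> k) x powr ?a) \<longlonglongrightarrow> gl None x"
      using ae[of None] by (simp add: f_def \<epsilon>_def)
    show "AE x in torus. (\<lambda>k. \<epsilon> k * (ue (\<epsilon> k) x - torus_mean (ue (\<epsilon> k)))) \<longlonglongrightarrow> 0"
      using s(2) by (simp add: \<epsilon>_def)
    show "integrable torus (\<lambda>x. me (\<epsilon> k) x powr p)" "(\<integral>x. me (\<epsilon> k) x powr p \<partial>torus) \<le> C2" for k
      using p(2)[OF me0 hW] \<epsilon>(1) by simp_all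
  qed (fact params C g_gr gr_cont AB \<epsilon> \<epsilon>_lim m u u_norm u_mean r F_L1 F_ae Fi p)+
  show ?thesis by (rule ergodic_solution)
qed

end
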